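(* Let $w$ be a permutation of the set of integers $\le n$ that fixes all sufficiently negative integers and satisfies $w(i)>w(i-1)$ for every $i\le 0$, and let $\mu=(\mu_1\ge\dots\ge\mu_n\ge 0)$ be any partition. Let $U$ be any rc-graph in which no two strands with nonpositive labels cross, and set $u=w_U$. Then the generalized Littlewood–Richardson coefficient $c^u_{w,\mu}$ equals the number of pairs $(R,Y)$, where $R$ is an rc-graph with $w_R=w$ and $Y$ is a semistandard Young tableau of shape $\mu$ with entries in $\{1,\dots,n\}$, such that $R\leftarrow Y=U$.
   Context: Fix a positive integer $n$. Cells $(i,k)$ are pairs of integers with $i\le n$, $k\le n$; $(i,k)$ lies in row $k$ and column $i$, rows with larger $k$ drawn higher (row $n$ on top), columns with larger $i$ drawn further left (column $n$ leftmost). Given a finite set $R$ of cells, choose an integer $D$ with $D<i+k$ for all $(i,k)\in R$ and consider the staircase of cells $(i,k)$ with $i,k\le n$, $i+k>D$, plus diagonal half-cells with $i+k=D$. A cell $(i,k)\in R$ contains a crossing of two strands; every other non-diagonal cell contains two non-crossing elbows, one joining its left edge to its top edge and one joining its bottom edge to its right edge; a diagonal half-cell contains only an elbow joining its left edge to its top edge. For each row $k$ with $D-n\le k\le n$ a strand enters the left edge of cell $(n,k)$ and is labeled $k$; it travels through the tiles and exits the top edge of some column $i$; set $w_R(k)=i$, and $w_R(k)=k$ for $k<D-n$. $R$ is an rc-graph if no two strands cross more than once; equivalently, the word obtained by listing the elements of $R$ row by row from row $n$ downward, and within a row from right to left (increasing $i$), and writing $s_{i+k-n-1}$ for $(i,k)$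 ($s_j$ = transposition of $j,j+1$), is a reduced word, and $w_R$ is the composition $s_{j_1}\circ s_{j_2}\circ\cdots$ of this word. Strand labels through a given cell do not depend on $D$. $x^R=\prod_{(i,k)\in R}x_k$; the Schubert polynomial is $S_v=\sum_{R:\,w_R=v}x^R$. A semistandard Young tableau of shape $\mu$ with entries in $\{1,\dots,n\}$ (rows weakly increasing, columns strictly increasing) has monomial $x^Y=\prod_{\text{entries } e}x_e$, and $S_\mu=\sum_{Y}x^Y$ is the Schur polynomial. The coefficients $c^u_{w,\mu}$ are defined by the unique expansion $S_wS_\mu=\sum_u c^u_{w,\mu}S_u$ over permutations $u$. Insertion: a cell $(i,k)\notin R$ (non-diagonal) is an open space if the strand through its left-to-top elbow has a positive label and the strand through its bottom-to-right elbow has a nonpositive label. To insert $x\in\{1,\dots,n\}$ into $R$: set $k_1=x$, let $i_1$ be the smallest $i$ with $(i,k_1)$ open, and add $(i_1,k_1)$. Inductively, after adding $(i_j,k_j)$: if the current set is an rc-graph, stop; otherwise the two strands crossing at $(i_j,k_j)$ cross at another cell $(\ell_{j+1},k_{j+1})$ with $k_{j+1}>k_j$; remove that cell, let $i_{j+1}$ be the smallest $i>\ell_{j+1}$ with $(i,k_{j+1})$ open, add $(i_{j+1},k_{j+1})$, and continue. This terminates in an rc-graph $R\leftarrow x$. For a word $v=v_1\cdots v_m$, $R\leftarrow v=(\cdots(R\leftarrow v_1)\cdots)\leftarrow v_m$. For a tableau $Y$, $v(Y)$ is the word read left to right along each row, from the bottom row to the top row, and $R\leftarrow Y=R\leftarrow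 v(Y)$. *)

theory Defs
  imports "HOL-Library.Poly_Mapping" "HOL-Combinatorics.Permutations"
begin

text \<open>
  A cell is a pair \<open>(i, k)\<close>: column \<open>i\<close>, row \<open>k\<close>, both at most \<open>n\<close>.  Columns are numbered from right
  to left and rows from bottom to top, so moving right lowers \<open>i\<close> and moving up raises \<open>k\<close>.
\<close>

type_synonym cell = "int \<times> int"

text \<open>
  Every edge of the picture is the left or the bottom edge of exactly one cell: the right edge of
  \<open>(i, k)\<close> is the left edge of \<open>(i - 1, k)\<close>, and its top edge is the bottom edge of \<open>(i, k + 1)\<close>.  In
  particular the top edge of column \<open>i\<close> is \<open>Bottom_edge (i, n + 1)\<close>.
\<close>

datatype edge = Left_edge cell | Bottom_edge cell

definition admissible_cut :: "cell set \<Rightarrow> int \<Rightarrow> bool" where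
  "admissible_cut R D \<longleftrightarrow> (\<forall>(i, k) \<in> R. D < i + k)"

text \<open>
  \<open>strand n D R p e\<close>: in the staircase cut off along \<open>i + k = D\<close>, the strand labeled \<open>p\<close> passes through
  the edge \<open>e\<close>.  The cells of \<open>R\<close> are crossings, and the half-cells \<open>i + k = D\<close> have no elbow from the
  bottom to the right.
\<close>

inductive strand :: "int \<Rightarrow> int \<Rightarrow> cell set \<Rightarrow> int \<Rightarrow> edge \<Rightarrow> bool"
  for n D :: int and R :: "cell set" and p :: int where
  enter: "D - n \<le> p \<Longrightarrow> p \<le> n \<Longrightarrow> strand n D R p (Left_edge (n, p))"
| cross_right: "strand n D R p (Left_edge (i, k)) \<Longrightarrow> (i, k) \<in> R
    \<Longrightarrow> strand n D R p (Left_edge (i - 1, k))"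
| cross_up: "strand n D R p (Bottom_edge (i, k)) \<Longrightarrow> (i, k) \<in> R
    \<Longrightarrow> strand n D R p (Bottom_edge (i, k + 1))"
| elbow_up: "strand n D R p (Left_edge (i, k)) \<Longrightarrow> (i, k) \<notin> R \<Longrightarrow> D \<le> i + k
    \<Longrightarrow> strand n D R p (Bottom_edge (i, k + 1))"
| elbow_right: "strand n D R p (Bottom_edge (i, k)) \<Longrightarrow> (i, k) \<notin> R \<Longrightarrow> D < i + k \<Longrightarrow> k \<le> n
    \<Longrightarrow> strand n D R p (Left_edge (i - 1, k))"

text \<open>
  The labels of the strands at a non-diagonal cell.  They are the same for every cut below the cell,
  so it does not matter that the cut is existentially quantified.
\<close>

definition enters_left :: "int \<Rightarrow> cell set \<Rightarrow> int \<Rightarrow> cell \<Rightarrow> bool" where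
  "enters_left n R p c \<longleftrightarrow>
     (\<exists>D. admissible_cut R D \<and> D < fst c + snd c \<and> strand n D R p (Left_edge c))"

definition enters_bottom :: "int \<Rightarrow> cell set \<Rightarrow> int \<Rightarrow> cell \<Rightarrow> bool" where
  "enters_bottom n R p c \<longleftrightarrow>
     (\<exists>D. admissible_cut R D \<and> D < fst c + snd c \<and> strand n D R p (Bottom_edge c))"

definition cross_at :: "int \<Rightarrow> cell set \<Rightarrow> int \<Rightarrow> int \<Rightarrow> cell \<Rightarrow> bool" where
  "cross_at n R p q c \<longleftrightarrow> c \<in> R \<and>
     (enters_left n R p c \<and> enters_bottom n R q c \<or> enters_left n R q c \<and> enters_bottom n R p c)"

definition rc_graph :: "int \<Rightarrow> cell set \<Rightarrow> bool" where
  "rc_graph n R \<longleftrightarrow> finite R \<and> R \<subseteq> {..n} \<times> {..n} \<and>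
     (\<forall>p q c d. cross_at n R p q c \<longrightarrow> cross_at n R p q d \<longrightarrow> c = d)"

text \<open>
  \<open>w\<^sub>R\<close>; the value does not depend on the choice of the cut.  Permutations of \<open>{..n}\<close> are represented
  as functions on all integers that are the identity above \<open>n\<close>, in the sense of \<open>permutes\<close>.
\<close>

definition rc_perm :: "int \<Rightarrow> cell set \<Rightarrow> int \<Rightarrow> int" where
  "rc_perm n R p = (let D = (SOME D. admissible_cut R D) in
     if D - n \<le> p \<and> p \<le> n then THE i. strand n D R p (Bottom_edge (i, n + 1)) else p)"

definition fin_perms :: "int \<Rightarrow> (int \<Rightarrow> int) set" where
  "fin_perms n = {w. w permutes {..n} \<and> (\<exists>m. \<forall>i\<le>m. w i = i)}"

text \<open>
  Integer polynomials in variables indexed by the integers: an exponent vector is a finitely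
  supported function \<open>int \<Rightarrow>\<^sub>0 nat\<close>, and multiplication is convolution.
\<close>

type_synonym zpoly = "(int \<Rightarrow>\<^sub>0 nat) \<Rightarrow>\<^sub>0 int"

definition Var :: "int \<Rightarrow> zpoly" where
  "Var k = Poly_Mapping.single (Poly_Mapping.single k 1) 1"

text \<open>The index set of the following sum is finite for every \<open>v\<close> in \<open>fin_perms n\<close>.\<close>

definition schubert :: "int \<Rightarrow> (int \<Rightarrow> int) \<Rightarrow> zpoly" where
  "schubert n v = (\<Sum>R | rc_graph n R \<and> rc_perm n R = v. \<Prod>(i, k)\<in>R. Var k)"

text \<open>
  A partition \<open>\<mu>\<^sub>1 \<ge> \<dots> \<ge> \<mu>\<^sub>n \<ge> 0\<close> is a list of length \<open>n\<close>, trailing zeros included.  A tableau is the list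
  of its rows from top (longest) to bottom, with empty rows for the zero parts.
\<close>

definition partitions_n :: "int \<Rightarrow> nat list set" where
  "partitions_n n = {\<mu>. int (length \<mu>) = n \<and> sorted_wrt (\<ge>) \<mu>}"

definition ssyt :: "int \<Rightarrow> nat list \<Rightarrow> int list list set" where
  "ssyt n \<mu> = {Y. map length Y = \<mu> \<and>
     (\<forall>row\<in>set Y. set row \<subseteq> {1..n} \<and> sorted row) \<and>
     (\<forall>r c. Suc r < length Y \<longrightarrow> c < length (Y ! Suc r) \<longrightarrow> Y ! r ! c < Y ! Suc r ! c)}"

definition schur :: "int \<Rightarrow> nat list \<Rightarrow> zpoly" where
  "schur n \<mu> = (\<Sum>Y\<in>ssyt n \<mu>. \<Prod>e\<leftarrow>concat Y. Var e)"

definition reading_word :: "int list list \<Rightarrow> int list" where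
  "reading_word Y = concat (rev Y)"

definition schubert_schur_expansion ::
    "int \<Rightarrow> (int \<Rightarrow> int) \<Rightarrow> nat list \<Rightarrow> ((int \<Rightarrow> int) \<Rightarrow> int) \<Rightarrow> bool" where
  "schubert_schur_expansion n w \<mu> c \<longleftrightarrow>
     finite {u. c u \<noteq> 0} \<and> {u. c u \<noteq> 0} \<subseteq> fin_perms n \<and>
     schubert n w * schur n \<mu> = (\<Sum>u | c u \<noteq> 0. of_int (c u) * schubert n u)"

definition lr_coeff :: "int \<Rightarrow> (int \<Rightarrow> int) \<Rightarrow> nat list \<Rightarrow> (int \<Rightarrow> int) \<Rightarrow> int" where
  "lr_coeff n w \<mu> = (THE c. schubert_schur_expansion n w \<mu> c)"

definition open_space :: "int \<Rightarrow> cell set \<Rightarrow> cell \<Rightarrow> bool" where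
  "open_space n R c \<longleftrightarrow> c \<in> {..n} \<times> {..n} \<and> c \<notin> R \<and>
     (\<exists>p>0. enters_left n R p c) \<and> (\<exists>q\<le>0. enters_bottom n R q c)"

definition least_element :: "int set \<Rightarrow> int \<Rightarrow> bool" where
  "least_element A i \<longleftrightarrow> i \<in> A \<and> (\<forall>j\<in>A. i \<le> j)"

text \<open>
  \<open>insertion_step n R x S c\<close>: while \<open>x\<close> is being inserted into \<open>R\<close>, the set \<open>S\<close> is reached and \<open>c\<close> is the
  cell that was added last.
\<close>

inductive insertion_step :: "int \<Rightarrow> cell set \<Rightarrow> int \<Rightarrow> cell set \<Rightarrow> cell \<Rightarrow> bool"
  for n :: int and R :: "cell set" and x :: int where
  first: "least_element {i. open_space n R (i, x)} i
    \<Longrightarrow> insertion_step n R x (insert (i, x) R) (i, x)"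
| bump: "insertion_step n R x S (i, k) \<Longrightarrow> \<not> rc_graph n S
    \<Longrightarrow> cross_at n S p q (i, k) \<Longrightarrow> cross_at n S p q (l, k') \<Longrightarrow> k < k'
    \<Longrightarrow> least_element {j. l < j \<and> open_space n (S - {(l, k')}) (j, k')} i'
    \<Longrightarrow> insertion_step n R x (insert (i', k') (S - {(l, k')})) (i', k')"

text \<open>\<open>insert_letter n R x S\<close> is \<open>R \<leftarrow> x = S\<close>, and \<open>insert_word n R v U\<close> is \<open>R \<leftarrow> v = U\<close>.\<close>

definition insert_letter :: "int \<Rightarrow> cell set \<Rightarrow> int \<Rightarrow> cell set \<Rightarrow> bool" where
  "insert_letter n R x S \<longleftrightarrow> (\<exists>c. insertion_step n R x S c) \<and> rc_graph n S"

primrec insert_word :: "int \<Rightarrow> cell set \<Rightarrow> int list \<Rightarrow> cell set \<Rightarrow> bool" where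
  "insert_word n R [] U \<longleftrightarrow> R = U"
| "insert_word n R (x # v) U \<longleftrightarrow> (\<exists>S. insert_letter n R x S \<and> insert_word n S v U)"

definition insert_tableau :: "int \<Rightarrow> cell set \<Rightarrow> int list list \<Rightarrow> cell set \<Rightarrow> bool" where
  "insert_tableau n R Y U \<longleftrightarrow> insert_word n R (reading_word Y) U"

end

theory Submission
  imports Defs "HOL-Library.Sublist"
begin

text \<open>
  Read an rc-graph row by row from the bottom.  Inserting a word of letters is then a sweep during which
  each letter turns, on reaching its row, into a jump of a strand over others, and a crossing either lets
  the jump pass or is bumped by it.  Given \<open>U\<close>, the sweep is reversible: the pairs \<open>(R, v)\<close> with
  \<open>R \<leftarrow> v = U\<close> correspond to the possible sequences of jumps, which depend on \<open>w\<^sub>R\<close> and \<open>w\<^sub>U\<close> only.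

  The key fact is that a Knuth move on three consecutive letters stays, past every crossing, a move of the
  same kind on the three jumps, without changing the resulting diagram.  Hence two words whose insertions
  have the same jumps are tableau words of the same shape or neither is, and the number \<open>N(U)\<close> of pairs
  \<open>(R, Y)\<close> with \<open>R \<leftarrow> Y = U\<close> depends only on \<open>w\<^sub>U\<close>.  As \<open>x\<^sup>R x\<^sup>Y = x\<^sup>U\<close>, summing over all pairs expands
  \<open>S\<^sub>w S\<^sub>\<mu>\<close> into Schubert polynomials with coefficients \<open>N(U)\<close>.  The expansion is unique since the
  left-justified diagrams provide distinct leading monomials.
\<close>

section \<open>Moving a jump past a crossing\<close>

text \<open>The state after a whole word is the inverse of \<open>w\<^sub>R\<close>, because each
  crossing composes on the side of the positions. A jump there is a Bruhat cover of
  \<open>w\<^sub>R\<close> that exchanges a positive with a nonpositive label. The chain of covers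
  from \<open>w\<^sub>R\<close> to \<open>w\<^sub>U\<close> forgets the diagram, so it can be run
  backwards through any diagram of \<open>w\<^sub>U\<close>. What remains is to see that it
  remembers enough of the word. The right ends of its jumps show the ascents and descents between
  consecutive letters, hence which rows are sorted. Column strictness is no condition on
  neighbouring letters; it is read off from the Knuth class, through the longest sorted end that
  Knuth moves can produce. So Knuth moves must be followed through the sweep. The obstacle is that a
  bump can drive one jump up to another, so that they share a position and no longer commute. The
  relation \<open>kd_same\<close>, which then takes the place of the commutation, closes the system
  under crossings.\<close>

abbreviation sw :: "int \<Rightarrow> int \<Rightarrow> int" where
  "sw j \<equiv> transpose j (j + 1)"

text \<open>A positive label is a particle, a nonpositive one a hole. No label in between lies
  between \<open>f q\<close> and \<open>f p\<close>, so the exchange adds exactly one inversion.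
  Labels below \<open>f q\<close> are excluded as well: in a diagram of the sweep holes never cross,
  so they stand in increasing order and one left of \<open>q\<close> exceeds
  \<open>f q\<close>.\<close>

definition jump :: "(int \<Rightarrow> int) \<Rightarrow> int \<Rightarrow> int \<Rightarrow> bool" where
  "jump f p q \<longleftrightarrow> q < p \<and> 0 < f p \<and> f q \<le> 0 \<and> (\<forall>r. q < r \<longrightarrow> r < p \<longrightarrow> f p < f r)"

text \<open>A cell at \<open>j\<close> has position \<open>j + 1\<close> on its left edge and
  position \<open>j\<close> on its bottom edge, so an open space is a particle directly left of a
  hole. A bump leaves a hole at \<open>j + 1\<close>, and the search goes left to the end of that
  run of holes.\<close>

definition next_open :: "(int \<Rightarrow> int) \<Rightarrow> int \<Rightarrow> int \<Rightarrow> bool" where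
  "next_open g j j' \<longleftrightarrow> j < j' \<and> 0 < g (j' + 1) \<and> (\<forall>r. j < r \<longrightarrow> r \<le> j' \<longrightarrow> g r \<le> 0)"

text \<open>The first half keeps the word reduced, the second forbids a crossing of two
  holes.\<close>

definition ascent :: "(int \<Rightarrow> int) \<Rightarrow> int \<Rightarrow> bool" where
  "ascent f j \<longleftrightarrow> f j < f (j + 1) \<and> 0 < f (j + 1)"

text \<open>
  A state \<open>f\<close> gives the label of the strand at each position.  A jump \<open>(p, q)\<close> means that, compared
  with the diagram before the insertion, the strands at positions \<open>p\<close> and \<open>q\<close> are exchanged.  If the next
  crossing of the diagram, at \<open>j\<close>, is between these very strands, it is bumped to the next open space
  \<open>j'\<close> of its row; otherwise it stays and only moves the jump.
\<close>

definition cstep :: "(int \<Rightarrow> int) \<Rightarrow> int \<Rightarrow> int \<Rightarrow> int \<Rightarrow> int \<Rightarrow> int \<Rightarrow> int \<Rightarrow> bool" where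
  "cstep f j p q j' p' q' \<longleftrightarrow>
     (if p = j + 1 \<and> q = j then next_open (f \<circ> sw j) j j' \<and> p' = j' + 1 \<and> q' = j'
      else j' = j \<and> p' = sw j p \<and> q' = sw j q)"

lemma next_open_unique: "next_open g j m \<Longrightarrow> next_open g j m' \<Longrightarrow> m = m'"
  unfolding next_open_def by (metis add.commute leD linorder_neqE zle_add1_eq_le zless_add1_eq)

lemma next_open_cong:
  assumes "\<And>r. j < r \<Longrightarrow> g r = h r" shows "next_open g j m \<longleftrightarrow> next_open h j m"
  using assms unfolding next_open_def by auto

lemma cstep_pass: "p \<noteq> j + 1 \<or> q \<noteq> j \<Longrightarrow> cstep f j p q j' p' q' \<longleftrightarrow> j' = j \<and> p' = sw j p \<and> q' = sw j q"
  unfolding cstep_def by auto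

text \<open>The commuting square of the sweep: the jump and then the new crossing, or the old
  crossing and then the new jump. In a bump the jump coincides with the crossing that it removes,
  and the crossing that it adds becomes the new jump.\<close>

lemma cstep_state:
  assumes "cstep f j p q j' p' q'"
  shows "f \<circ> transpose p q \<circ> sw j' = f \<circ> sw j \<circ> transpose p' q'"
proof (cases "p = j + 1 \<and> q = j")
  case True
  then show ?thesis using assms unfolding cstep_def
    by (auto simp: transpose_commute comp_assoc)
next
  case False
  then show ?thesis using assms unfolding cstep_def
    by (auto simp: fun_eq_iff transpose_def)
qed

text \<open>A passing jump is endangered only by a crossing at one of its ends. If
  \<open>p = j + 1\<close> and \<open>q < j\<close>, the label at \<open>j\<close> would exceed
  \<open>f p\<close>, against the ascent; \<open>q = j + 1\<close> would make the larger label of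
  the crossing a hole. A bump runs over holes only, so it lands at a particle left of a hole
  again.\<close>

lemma cstep_jump:
  assumes "jump f p q" "ascent f j" "cstep f j p q j' p' q'"
  shows "jump (f \<circ> sw j) p' q'" "ascent (f \<circ> transpose p q) j'"
proof -
  have "jump (f \<circ> sw j) p' q' \<and> ascent (f \<circ> transpose p q) j'"
  proof (cases "p = j + 1 \<and> q = j")
    case True
    then have "next_open (f \<circ> sw j) j j'" "p' = j' + 1" "q' = j'" "p = j + 1" "q = j"
      using assms(3) unfolding cstep_def by auto
    moreover have "f \<circ> transpose p q = f \<circ> sw j"
      using True by (simp add: transpose_commute)
    ultimately show ?thesis
      unfolding jump_def next_open_def ascent_def by auto
  next
    case False
    then have e: "j' = j" "p' = sw j p" "q' = sw j q"
      using assms(3) unfolding cstep_def by auto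
    have a: "q < p" "0 < f p" "f q \<le> 0" and b: "\<And>r. q < r \<Longrightarrow> r < p \<Longrightarrow> f p < f r"
      using assms(1) unfolding jump_def by auto
    have c: "f j < f (j + 1)" "0 < f (j + 1)" using assms(2) unfolding ascent_def by auto
    have q: "q \<noteq> j + 1" using a c by auto
    have p: "p = j + 1 \<Longrightarrow> \<not> q < j" using b[of j] c by auto
    have "ascent (f \<circ> transpose p q) j"
      using a b[of "j + 1"] c q p False unfolding ascent_def transpose_def by (auto; smt (verit))
    moreover have "q' < p'" unfolding e transpose_def using a q p False by auto
    moreover have "(f \<circ> sw j) p' = f p" "(f \<circ> sw j) q' = f q" unfolding e by auto
    moreover have "f p < (f \<circ> sw j) r" if "q' < r" "r < p'" for r
    proof -
      consider "r = j" | "r = j + 1" | "r \<noteq> j" "r \<noteq> j + 1" by auto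
      then show ?thesis
      proof cases
        case 1
        then have "q < j" using that q unfolding e transpose_def by (auto split: if_splits)
        moreover have "j \<le> p" using that 1 unfolding e transpose_def by (auto split: if_splits)
        ultimately have "j + 1 < p \<or> p = j" using p by force
        then show ?thesis using 1 b[of "j + 1"] c \<open>q < j\<close> by auto
      next
        case 2
        have "q \<noteq> j" using that 2 unfolding e transpose_def by (auto split: if_splits)
        have "p \<noteq> j" using that 2 q a unfolding e transpose_def by (auto split: if_splits)
        have "q < j" using that 2 q \<open>q \<noteq> j\<close> unfolding e transpose_def by (auto split: if_splits)
        have "j < p" using that 2 \<open>p \<noteq> j\<close> p \<open>q < j\<close> unfolding e transpose_def by (auto split: if_splits)
        then show ?thesis using 2 b[of j] \<open>q < j\<close> by auto
      next
        case 3
        then have "q < r" using that unfolding e transpose_def by (auto split: if_splits)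
        moreover have "r < p" using that 3 unfolding e transpose_def by (auto split: if_splits)
        ultimately show ?thesis using b[of r] 3 by auto
      qed
    qed
    ultimately show ?thesis using a e(1) unfolding jump_def by auto
  qed
  then show "jump (f \<circ> sw j) p' q'" "ascent (f \<circ> transpose p q) j'" by auto
qed

text \<open>Right ends carry the order of the letters, so consecutive jumps must keep it. The first
  jump leaves a particle at its right end, which stops a second one bumped from further right. If
  the first is bumped over holes, the second cannot end at one of these before the last, since a
  jump spans no hole.\<close>

lemma cstep_order:
  assumes "jump f p1 q1" "jump (f \<circ> transpose p1 q1) p2 q2" "ascent f j"
    "cstep f j p1 q1 j1 u1 v1" "cstep (f \<circ> transpose p1 q1) j1 p2 q2 j2 u2 v2"
  shows "q1 \<noteq> q2" "v2 < v1 \<longleftrightarrow> q2 < q1" "v1 \<noteq> v2"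
proof -
  note d = jump_def next_open_def ascent_def
  define g where "g = f \<circ> transpose p1 q1"
  have g: "g q1 = f p1" "g p1 = f q1" "\<And>r. r \<noteq> p1 \<Longrightarrow> r \<noteq> q1 \<Longrightarrow> g r = f r" unfolding g_def by auto
  have 1: "q1 < p1" "0 < f p1" "f q1 \<le> 0" and k1b: "\<And>r. q1 < r \<Longrightarrow> r < p1 \<Longrightarrow> f p1 < f r"
    using assms(1) unfolding d by auto
  have 2: "q2 < p2" "0 < g p2" "g q2 \<le> 0" and k2b: "\<And>r. q2 < r \<Longrightarrow> r < p2 \<Longrightarrow> g p2 < g r"
    using assms(2) unfolding d g_def[symmetric] by auto
  have j: "f j < f (j + 1)" "0 < f (j + 1)" using assms(3) unfolding d by auto
  show ne: "q1 \<noteq> q2" using 1 2 g by auto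
  have J1: "jump (f \<circ> sw j) u1 v1" and a1: "ascent g j1" using cstep_jump[OF assms(1,3,4)] unfolding g_def by auto
  have j1: "g j1 < g (j1 + 1)" "0 < g (j1 + 1)" using a1 unfolding d by auto
  have q2j: "q2 \<noteq> j1 + 1" using 2 j1 by auto
  have c2: "(p2 = j1 + 1 \<and> q2 = j1 \<and> next_open (g \<circ> sw j1) j1 j2 \<and> v2 = j2) \<or>
     (\<not> (p2 = j1 + 1 \<and> q2 = j1) \<and> v2 = (if q2 = j1 then j1 + 1 else q2))"
    using assms(5) q2j unfolding cstep_def g_def[symmetric] by (auto simp: transpose_def split: if_splits)
  have q1j: "q1 \<noteq> j + 1" using 1 j by auto
  have up: "q1 < q2 \<Longrightarrow> v1 < v2"
  proof -
    assume q: "q1 < q2"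
    show "v1 < v2"
    proof (cases "p1 = j + 1 \<and> q1 = j")
      case False
      then have e: "j1 = j" "v1 = (if q1 = j then j + 1 else q1)"
        using assms(4) q1j unfolding cstep_def by (auto simp: transpose_def)
      have "q2 \<noteq> j1 + 1 " using q2j .
      then show ?thesis using c2 q e
        by (cases "q1 = j") (auto simp: next_open_def)
    next
      case True
      then have e: "next_open (f \<circ> sw j) j j1" "v1 = j1"
        using assms(4) unfolding cstep_def by auto
      have gs: "g = f \<circ> sw j" using True unfolding g_def by (simp add: transpose_commute)
      have h: "\<And>r. j < r \<Longrightarrow> r \<le> j1 \<Longrightarrow> g r \<le> 0" "0 < g (j1 + 1)" "j < j1"
        using e unfolding d gs[symmetric] by auto
      have "q2 \<ge> j1"
      proof (rule ccontr)
        assume "\<not> q2 \<ge> j1"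
        then have "g (q2 + 1) \<le> 0" using h q True by auto
        then have "p2 \<noteq> q2 + 1" using 2 by auto
        then show False using k2b[of "q2 + 1"] 2 \<open>g (q2 + 1) \<le> 0\<close> by auto
      qed
      then show ?thesis using c2 e(2) q2j by (auto simp: next_open_def)
    qed
  qed
  have down: "q2 < q1 \<Longrightarrow> v2 < v1"
  proof -
    assume q: "q2 < q1"
    \<comment> \<open>Otherwise the second jump spans the particle \<open>f p1\<close> at
      \<open>q1\<close>, so \<open>g p2 < f p1\<close>; but then \<open>p2\<close> lies inside the
      first jump, where all labels exceed \<open>f p1\<close>.\<close>
    have "p2 \<le> q1"
    proof (rule ccontr)
      assume n: "\<not> p2 \<le> q1"
      have "g p2 < f p1" using k2b[of q1] q n g by auto
      moreover have "p2 \<noteq> p1" using g 1 2 by auto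
      moreover have "p2 < p1" using k2b[of p1] q n g 1 2 \<open>p2 \<noteq> p1\<close> by force
      ultimately show False using k1b[of p2] g(3)[of p2] n by auto
    qed
    show "v2 < v1"
    proof (cases "p1 = j + 1 \<and> q1 = j")
      case False
      then have e: "j1 = j" "v1 = (if q1 = j then j + 1 else q1)"
        using assms(4) q1j unfolding cstep_def by (auto simp: transpose_def)
      have "j2 < q1" if "p2 = j + 1" "q2 = j" "next_open (g \<circ> sw j) j j2"
      proof -
        have "p2 < q1" using \<open>p2 \<le> q1\<close> that q1j by auto
        then have "(g \<circ> sw j) q1 > 0" using that 1 g by (auto simp: transpose_def)
        then show ?thesis using that(3) \<open>p2 < q1\<close> that(1) unfolding d by (meson leI less_add_one less_trans not_less)
      qed
      then show ?thesis using c2 q e q1j by auto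
    next
      case True
      then have e: "next_open (f \<circ> sw j) j j1" "v1 = j1" "j < j1"
        using assms(4) unfolding cstep_def d by auto
      then show ?thesis using c2 q True \<open>p2 \<le> q1\<close> by (auto split: if_splits)
    qed
  qed
  show "v2 < v1 \<longleftrightarrow> q2 < q1" "v1 \<noteq> v2" using up down ne by force+
qed

section \<open>Dual Knuth relations for jumps\<close>

text \<open>
  What the sweep through a diagram carries: a letter that has not reached its row yet, or the jump that
  its insertion has caused.
\<close>

datatype signal = Wait int | Jump int int

text \<open>A larger letter ends further right, and once its sweep has begun \<open>q\<close> speaks
  for it. A letter still waiting exceeds those that have started, which explains the mixed
  rules.\<close>

fun right_of :: "signal \<Rightarrow> signal \<Rightarrow> bool" where
  "right_of (Jump p q) (Jump p' q') \<longleftrightarrow> q < q'"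
| "right_of (Wait x) (Jump p q) \<longleftrightarrow> True"
| "right_of (Jump p q) (Wait x) \<longleftrightarrow> False"
| "right_of (Wait x) (Wait y) \<longleftrightarrow> y < x"

text \<open>Of two equal letters the later one ends further right, so the comparison is weak when
  the first argument comes later. Consecutive jumps have different right ends, and both versions
  agree on them.\<close>

fun weakly_right_of :: "signal \<Rightarrow> signal \<Rightarrow> bool" where
  "weakly_right_of (Jump p q) (Jump p' q') \<longleftrightarrow> q < q'"
| "weakly_right_of (Wait x) (Jump p q) \<longleftrightarrow> True"
| "weakly_right_of (Jump p q) (Wait x) \<longleftrightarrow> False"
| "weakly_right_of (Wait x) (Wait y) \<longleftrightarrow> y \<le> x"

text \<open>Disjoint spans, the second one on the right: then the two exchanges commute.\<close>

fun apart :: "signal \<Rightarrow> signal \<Rightarrow> bool" where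
  "apart (Jump p q) (Jump p' q') \<longleftrightarrow> p' < q"
| "apart _ _ \<longleftrightarrow> True"

text \<open>
  Restricted to \<open>Wait\<close>, the last two rules are the two Knuth relations.  The first rule covers the only way
  in which sharing a position can prevent the jumps from commuting.
\<close>

inductive knuth_dual :: "signal list \<Rightarrow> signal list \<Rightarrow> bool" where
  kd_same: "q2 < q1 \<Longrightarrow> q1 < p3 \<Longrightarrow> p3 < p1 \<Longrightarrow>
    knuth_dual [Jump p1 q1, Jump q1 q2, Jump p3 q1] [Jump p3 q1, Jump p1 p3, Jump p3 q2]"
| kd_first: "apart s1 s2 \<Longrightarrow> right_of s2 s3 \<Longrightarrow> weakly_right_of s3 s1 \<Longrightarrow>
    knuth_dual [s1, s2, s3] [s2, s1, s3]"
| kd_last: "apart s3 s2 \<Longrightarrow> weakly_right_of s2 s1 \<Longrightarrow> right_of s1 s3 \<Longrightarrow>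
    knuth_dual [s1, s2, s3] [s1, s3, s2]"

lemma jump_cong:
  assumes "\<And>r. q \<le> r \<Longrightarrow> r \<le> p \<Longrightarrow> f r = g r" shows "jump f p q \<longleftrightarrow> jump g p q"
proof (cases "q < p")
  case True
  then have "f p = g p" "f q = g q" using assms by auto
  moreover have "f r = g r" if "q < r" "r < p" for r using assms that by auto
  ultimately show ?thesis unfolding jump_def by auto
qed (simp add: jump_def)

lemma jump_apart:
  assumes "p2 < q1" "q1 < p1"
  shows "jump (f \<circ> transpose p1 q1) p2 q2 \<longleftrightarrow> jump f p2 q2"
  by (rule jump_cong) (use assms in \<open>simp add: transpose_def\<close>)

lemma next_open_eqI:
  assumes "next_open g j m" "j < k" "0 < g (k + 1)" "\<And>r. j < r \<Longrightarrow> r \<le> k \<Longrightarrow> g r \<le> 0"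
  shows "m = k"
  using next_open_unique[OF assms(1)] assms(2-4) unfolding next_open_def by auto

text \<open>The right jump can notice the left one only if it is bumped up to it. With the left jump
  done first, the particle now at \<open>qL\<close> stops it; done second, the bump runs on over the
  hole at \<open>qL\<close>. Assumption \<open>nb\<close> excludes exactly this run of
  holes.\<close>

lemma cstep_apart_commute:
  assumes ap: "pR < qL" and L: "jump f pL qL" and R: "jump f pR qR" and asc: "ascent f j"
    and c: "cstep f j pL qL j1 u1 v1" "cstep (f \<circ> transpose pL qL) j1 pR qR j2 u2 v2"
      "cstep f j pR qR k1 a1 b1" "cstep (f \<circ> transpose pR qR) k1 pL qL k2 a2 b2"
    and nb: "\<not> (pR = j + 1 \<and> qR = j \<and> (\<forall>r. j + 1 < r \<longrightarrow> r \<le> qL \<longrightarrow> f r \<le> 0))"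
  shows "j2 = k2 \<and> u2 = a1 \<and> v2 = b1 \<and> u1 = a2 \<and> v1 = b2 \<and> u2 < v1"
proof -
  have l: "qL < pL" "0 < f pL" "f qL \<le> 0" and r: "qR < pR" "0 < f pR" "f qR \<le> 0"
    using L R unfolding jump_def by auto
  have a: "f j < f (j + 1)" "0 < f (j + 1)" using asc unfolding ascent_def by auto
  show ?thesis
  proof (cases "pL = j + 1 \<and> qL = j")
    case True
    then have 1: "next_open (f \<circ> sw j) j j1" "u1 = j1 + 1" "v1 = j1" using c(1) unfolding cstep_def by auto
    then have "j < j1" unfolding next_open_def by auto
    then have 2: "j2 = j1" "u2 = pR" "v2 = qR" using c(2) True ap r unfolding cstep_def by auto
    have 3: "k1 = j" "a1 = pR" "b1 = qR" using c(3) True ap r unfolding cstep_def by auto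
    have k2: "next_open (f \<circ> transpose pR qR \<circ> sw j) j k2" "a2 = k2 + 1" "b2 = k2"
      using c(4) 3 True unfolding cstep_def by auto
    have eq: "(f \<circ> transpose pR qR \<circ> sw j) s = (f \<circ> sw j) s" if "j < s" for s
      using that True ap r by (simp add: transpose_def)
    have "next_open (f \<circ> sw j) j k2"
      using k2(1) next_open_cong[of j "f \<circ> transpose pR qR \<circ> sw j" "f \<circ> sw j" k2, OF eq] by blast
    then have "j1 = k2" using 1(1) next_open_unique by blast
    then show ?thesis using 1 2 3 \<open>a2 = k2 + 1\<close> \<open>b2 = k2\<close> \<open>j < j1\<close> True ap by auto
  next
    case nL: False
    then have 1: "j1 = j" "u1 = sw j pL" "v1 = sw j qL" using c(1) unfolding cstep_def by auto
    show ?thesis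
    proof (cases "pR = j + 1 \<and> qR = j")
      case True
      then have n2: "next_open (f \<circ> transpose pL qL \<circ> sw j) j j2" "u2 = j2 + 1" "v2 = j2"
        using c(2) 1 unfolding cstep_def by auto
      have n3: "next_open (f \<circ> sw j) j k1" "a1 = k1 + 1" "b1 = k1"
        using c(3) True unfolding cstep_def by auto
      obtain s where s: "j + 1 < s" "s \<le> qL" "0 < f s" using nb True by force
      have k1: "j < k1" "0 < (f \<circ> sw j) (k1 + 1)" "\<And>r. j < r \<Longrightarrow> r \<le> k1 \<Longrightarrow> (f \<circ> sw j) r \<le> 0"
        using n3 unfolding next_open_def by auto
      have "s < qL" using s l by (cases "s = qL") auto
      have "k1 + 1 \<le> s"
      proof (rule ccontr)
        assume "\<not> k1 + 1 \<le> s"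
        then show False using k1(3)[of s] s by (auto simp: transpose_def)
      qed
      have "j2 = k1"
      proof (rule next_open_eqI[OF n2(1) k1(1)])
        show "0 < (f \<circ> transpose pL qL \<circ> sw j) (k1 + 1)"
          using k1(1,2) \<open>k1 + 1 \<le> s\<close> \<open>s < qL\<close> l by (auto simp: transpose_def)
        show "(f \<circ> transpose pL qL \<circ> sw j) r \<le> 0" if "j < r" "r \<le> k1" for r
          using k1(3)[OF that] that \<open>k1 + 1 \<le> s\<close> \<open>s < qL\<close> l by (auto simp: transpose_def split: if_splits)
      qed
      moreover have "k2 = k1 \<and> a2 = pL \<and> b2 = qL"
        using c(4) \<open>k1 + 1 \<le> s\<close> \<open>s < qL\<close> l unfolding cstep_def by (auto simp: transpose_def split: if_splits)
      ultimately show ?thesis using 1 n2 n3 \<open>k1 + 1 \<le> s\<close> \<open>s < qL\<close> s l by (auto simp: transpose_def)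
    next
      case False
      then have 2: "j2 = j" "u2 = sw j pR" "v2 = sw j qR" using c(2) 1 unfolding cstep_def by auto
      have 3: "k1 = j" "a1 = sw j pR" "b1 = sw j qR" using c(3) False unfolding cstep_def by auto
      have 4: "k2 = j" "a2 = sw j pL" "b2 = sw j qL" using c(4) nL 3 unfolding cstep_def by auto
      have "\<not> (pR = j \<and> qL = j + 1)" using a r l by auto
      then show ?thesis using 1 2 3 4 ap by (auto simp: transpose_def)
    qed
  qed
qed

text \<open>A commutation survives unless the right jump of the pair is bumped over holes up to the
  left one. In \<open>kd_last\<close> the particle left at \<open>q1\<close> prevents this. In
  \<open>kd_first\<close> it can happen and yields \<open>kd_same\<close>, or \<open>kd_last\<close>
  if \<open>p1 = q1 + 1\<close>, where the left jump is bumped in the other chain as well. From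
  \<open>kd_same\<close> a crossing leads to \<open>kd_same\<close> again or to
  \<open>kd_last\<close>.\<close>

lemma knuth_dual_cstep:
  assumes k: "knuth_dual [Jump p1 q1, Jump p2 q2, Jump p3 q3] [Jump a1 b1, Jump a2 b2, Jump a3 b3]"
    and p: "jump f p1 q1" "jump (f \<circ> transpose p1 q1) p2 q2"
      "jump (f \<circ> transpose p1 q1 \<circ> transpose p2 q2) p3 q3"
    and a: "jump f a1 b1" "jump (f \<circ> transpose a1 b1) a2 b2"
      "jump (f \<circ> transpose a1 b1 \<circ> transpose a2 b2) a3 b3"
    and asc: "ascent f j"
    and c: "cstep f j p1 q1 j1 u1 v1" "cstep (f \<circ> transpose p1 q1) j1 p2 q2 j2 u2 v2"
      "cstep (f \<circ> transpose p1 q1 \<circ> transpose p2 q2) j2 p3 q3 j3 u3 v3"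
    and d: "cstep f j a1 b1 k1 x1 y1" "cstep (f \<circ> transpose a1 b1) k1 a2 b2 k2 x2 y2"
      "cstep (f \<circ> transpose a1 b1 \<circ> transpose a2 b2) k2 a3 b3 k3 x3 y3"
  shows "j3 = k3 \<and> knuth_dual [Jump u1 v1, Jump u2 v2, Jump u3 v3] [Jump x1 y1, Jump x2 y2, Jump x3 y3]"
proof -
  have oc1: "v2 < v1 \<longleftrightarrow> q2 < q1" "v1 \<noteq> v2" "q1 \<noteq> q2" using cstep_order[OF p(1,2) asc c(1,2)] by auto
  have asc1: "ascent (f \<circ> transpose p1 q1) j1" using cstep_jump[OF p(1) asc c(1)] by auto
  have oc2: "v3 < v2 \<longleftrightarrow> q3 < q2" "v2 \<noteq> v3" "q2 \<noteq> q3" using cstep_order[OF p(2,3) asc1 c(2,3)] by auto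
  have od1: "y2 < y1 \<longleftrightarrow> b2 < b1" "y1 \<noteq> y2" "b1 \<noteq> b2" using cstep_order[OF a(1,2) asc d(1,2)] by auto
  have ascd1: "ascent (f \<circ> transpose a1 b1) k1" using cstep_jump[OF a(1) asc d(1)] by auto
  have od2: "y3 < y2 \<longleftrightarrow> b3 < b2" "y2 \<noteq> y3" "b2 \<noteq> b3" using cstep_order[OF a(2,3) ascd1 d(2,3)] by auto
  have A: "f j < f (j + 1)" "0 < f (j + 1)" using asc unfolding ascent_def by auto
  have P1: "q1 < p1" "0 < f p1" "f q1 \<le> 0" "\<And>r. q1 < r \<Longrightarrow> r < p1 \<Longrightarrow> f p1 < f r"
    using p(1) unfolding jump_def by auto
  from k show ?thesis
  proof cases
    case kd_same
    have q12: "q2 < q1" "q1 < p3" "p3 < p1" "p2 = q1" "q3 = q1" "a1 = p3" "b1 = q1" "a2 = p1" "b2 = p3" "a3 = p3" "b3 = q2"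
      using kd_same by auto
    have n1: "\<not> (p1 = j + 1 \<and> q1 = j)" using q12 by auto
    have n2: "q1 \<noteq> j + 1" using A P1 by auto
    have c12: "j1 = j" "u1 = sw j p1" "v1 = sw j q1" "j2 = j" "u2 = sw j q1" "v2 = sw j q2"
      using c(1,2) n1 n2 q12 unfolding cstep_def by auto
    have lc: "f p1 < f p3" using P1(4)[of p3] q12 by auto
    have n3: "\<not> (p1 = j + 1 \<and> p3 = j)" using lc A by auto
    have fq2: "f q2 \<le> 0" using p(2) q12 P1 unfolding jump_def by (auto simp: transpose_def split: if_splits)
    show ?thesis
    proof (cases "p3 = j + 1 \<and> q1 = j")
      case False
      have c3: "j3 = j" "u3 = sw j p3" "v3 = sw j q1" using c(3) c12 False q12 unfolding cstep_def by auto
      have d1: "k1 = j" "x1 = sw j p3" "y1 = sw j q1" using d(1) False q12 unfolding cstep_def by auto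
      have d2: "k2 = j" "x2 = sw j p1" "y2 = sw j p3" using d(2) d1 n3 q12 unfolding cstep_def by auto
      have d3: "k3 = j" "x3 = sw j p3" "y3 = sw j q2" using d(3) d2 q12 unfolding cstep_def by auto
      have "sw j q2 < sw j q1" "sw j q1 < sw j p3" "sw j p3 < sw j p1"
        using q12 n2 n3 False by (auto simp: transpose_def)
      then show ?thesis using c12 c3 d1 d2 d3 by (auto intro: knuth_dual.kd_same)
    next
      case True
      have u: "u1 = p1" "v1 = q1 + 1" "u2 = q1 + 1" "v2 = q2" using c12 True q12 by (auto simp: transpose_def)
      have n3: "next_open (f \<circ> transpose p1 q1 \<circ> transpose q1 q2 \<circ> sw q1) q1 j3" "u3 = j3 + 1" "v3 = j3"
        using c(3) c12 True q12 unfolding cstep_def by auto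
      have e1: "next_open (f \<circ> sw q1) q1 k1" "x1 = k1 + 1" "y1 = k1"
        using d(1) True q12 unfolding cstep_def by auto
      have "0 < f (q1 + 2)" using P1(2) P1(4)[of "q1 + 2"] q12 True by (cases "p1 = q1 + 2") auto
      then have f2': "0 < f (2 + q1)" by (simp add: add.commute)
      have k1: "k1 = q1 + 1"
        using True P1(3) f2' by (intro next_open_eqI[OF e1(1)]) (auto simp: transpose_def)
      \<comment> \<open>If \<open>p1 = q1 + 2\<close>, the positions \<open>q1\<close>,
        \<open>p3\<close>, \<open>p1\<close> are adjacent, and after the first bump of the
        right-hand chain its second jump meets the bumped crossing and moves it on.\<close>
      show ?thesis
      proof (cases "p1 = q1 + 2")
        case False
        have "0 < f (q1 + 2)" by fact
        have j3: "j3 = q1 + 1"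
          using True P1(3) f2' fq2 q12 False \<open>0 < f (q1 + 2)\<close>
          by (intro next_open_eqI[OF n3(1)]) (auto simp: transpose_def)
        have d2: "k2 = q1 + 1" "x2 = p1" "y2 = q1 + 2"
          using d(2) k1 False True q12 unfolding cstep_def by (auto simp: transpose_def split: if_splits)
        have d3: "k3 = q1 + 1" "x3 = q1 + 2" "y3 = q2"
          using d(3) d2 True q12 unfolding cstep_def by (auto simp: transpose_def split: if_splits)
        show ?thesis unfolding u n3(2,3) j3 e1(2,3) k1 d2 d3
          using knuth_dual.kd_same[of q2 "q1 + 1" "q1 + 2" p1] q12 True False by (auto simp: add.assoc)
      next
        case eq: True
        have d2: "next_open (f \<circ> transpose p3 q1 \<circ> sw (q1 + 1)) (q1 + 1) k2" "x2 = k2 + 1" "y2 = k2"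
          using d(2) k1 eq True q12 unfolding cstep_def by auto
        have k2: "q1 + 1 < k2" "0 < (f \<circ> transpose p3 q1 \<circ> sw (q1 + 1)) (k2 + 1)"
          "\<And>r. q1 + 1 < r \<Longrightarrow> r \<le> k2 \<Longrightarrow> (f \<circ> transpose p3 q1 \<circ> sw (q1 + 1)) r \<le> 0"
          using d2 unfolding next_open_def by auto
        have p3q: "p3 = q1 + 1" using True by simp
        have j3: "j3 = k2"
        proof (rule next_open_eqI[OF n3(1)])
          show "q1 < k2" using k2(1) by simp
          show "0 < (f \<circ> transpose p1 q1 \<circ> transpose q1 q2 \<circ> sw q1) (k2 + 1)"
            using k2(1,2) p3q eq q12(1) by (simp add: transpose_def)
          fix r assume r: "q1 < r" "r \<le> k2"
          consider "r = q1 + 1" | "r = q1 + 2" | "q1 + 2 < r" using r(1) by force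
          then show "(f \<circ> transpose p1 q1 \<circ> transpose q1 q2 \<circ> sw q1) r \<le> 0"
          proof cases
            case 3
            then show ?thesis using k2(3)[of r] r(2) p3q eq q12(1) by (simp add: transpose_def)
          qed (use eq q12(1) fq2 P1(3) in \<open>simp_all add: transpose_def\<close>)
        qed
        have d3: "k3 = k2" "x3 = q1 + 1" "y3 = q2"
          using d(3) k2(1) True q12 unfolding cstep_def by (auto simp: transpose_def split: if_splits)
        have x1: "x1 = q1 + 2" using e1(2) k1 by simp
        have pp: "p1 = q1 + 2" "x3 = q1 + 1" "k2 > q1 + 1" "q2 < q1 + 1" using eq d3 k2(1) q12(1) by auto
        have fin: "knuth_dual [Jump (q1 + 2) (q1 + 1), Jump (q1 + 1) q2, Jump (k2 + 1) k2]
          [Jump (q1 + 2) (q1 + 1), Jump (k2 + 1) k2, Jump (q1 + 1) q2]"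
          by (rule knuth_dual.kd_last) (use pp(3,4) in simp_all)
        show ?thesis using fin by (simp only: u n3(2,3) j3 e1(3) k1 d2(2,3) d3(1,2,3) x1 pp(1))
      qed
    qed
  next
    case kd_first
    have e: "p2 < q1" "q2 < q3" "q3 < q1" "a1 = p2" "b1 = q2" "a2 = p1" "b2 = q1" "a3 = p3" "b3 = q3"
      using kd_first by auto
    have R: "jump f p2 q2" using jump_apart[of p2 q1 p1 f q2] p(2) e P1 by auto
    have P2: "q2 < p2" "0 < f p2" "f q2 \<le> 0" "\<And>r. q2 < r \<Longrightarrow> r < p2 \<Longrightarrow> f p2 < f r"
      using R unfolding jump_def by auto
    have st: "f \<circ> transpose p1 q1 \<circ> transpose p2 q2 = f \<circ> transpose p2 q2 \<circ> transpose p1 q1"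
      using e P1 P2 by (auto simp: fun_eq_iff transpose_def)
    show ?thesis
    proof (cases "p2 = j + 1 \<and> q2 = j \<and> (\<forall>r. j + 1 < r \<longrightarrow> r \<le> q1 \<longrightarrow> f r \<le> 0)")
      case False
      have "j2 = k2 \<and> u2 = x1 \<and> v2 = y1 \<and> u1 = x2 \<and> v1 = y2 \<and> u2 < v1"
        by (rule cstep_apart_commute[OF e(1) p(1) R asc c(1,2) _ _ False]) (use d(1,2) e in auto)
      then have m: "j2 = k2" "u2 = x1" "v2 = y1" "u1 = x2" "v1 = y2" "u2 < v1" by auto
      have "j3 = k3" "u3 = x3" "v3 = y3"
        using c(3) d(3) m(1) st e unfolding cstep_def
        by (auto split: if_splits dest: next_open_unique)
      moreover have "v2 < v3" "v3 < v1" using oc1 oc2 od1 od2 e m \<open>v3 = y3\<close> by auto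
      ultimately show ?thesis using m by (auto intro!: knuth_dual.kd_first)
    next
      case True
      then have t: "p2 = j + 1" "q2 = j" and h: "\<And>r. j + 1 < r \<Longrightarrow> r \<le> q1 \<Longrightarrow> f r \<le> 0" by auto
      have c1: "j1 = j" "u1 = p1" "v1 = q1" using c(1) t e P1 unfolding cstep_def by (auto simp: transpose_def split: if_splits)
      have n2: "next_open (f \<circ> transpose p1 q1 \<circ> sw j) j j2" "u2 = j2 + 1" "v2 = j2"
        using c(2) c1 t unfolding cstep_def by auto
      have "j2 = q1 - 1"
        using P1 h e t P2 by (intro next_open_eqI[OF n2(1)]) (auto simp: transpose_def)
      define g where "g = f \<circ> transpose p1 q1 \<circ> transpose p2 q2"
      have P3: "q3 < p3" "0 < g p3" "g q3 \<le> 0" "\<And>r. q3 < r \<Longrightarrow> r < p3 \<Longrightarrow> g p3 < g r"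
        using p(3) unfolding jump_def g_def by auto
      have g: "g r \<le> 0" if "j < r" "r < q1" for r
        unfolding g_def using that h e t P1 P2 by (auto simp: transpose_def)
      have gq: "g q1 = f p1" unfolding g_def using e P1 P2 by (auto simp: transpose_def)
      have gp: "g p1 \<le> 0" unfolding g_def using e P1 P2 by (auto simp: transpose_def)
      have "q1 \<le> p3" using g[of p3] P3 e t by force
      \<comment> \<open>There are only holes strictly between \<open>j\<close> and
        \<open>q1\<close>, and a jump spans none, so the third jump must end directly right of
        \<open>q1\<close>. It also starts at \<open>q1\<close>: a longer span would need a label
        below \<open>f p1\<close> inside the first jump.\<close>
      have q3: "q3 = q1 - 1"
      proof (rule ccontr)
        assume "q3 \<noteq> q1 - 1"
        then show False using P3(4)[of "q1 - 1"] g[of "q1 - 1"] P3(2) \<open>q1 \<le> p3\<close> e t by auto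
      qed
      have p3: "p3 = q1"
      proof (rule ccontr)
        assume "p3 \<noteq> q1"
        then have lt: "g p3 < f p1" "q1 < p3" using P3(4)[of q1] gq q3 \<open>q1 \<le> p3\<close> by auto
        have "p3 \<noteq> p1" using gp P3 by auto
        moreover have "p3 < p1" using P3(4)[of p1] gp P3(2) \<open>p3 \<noteq> p1\<close> P1 q3 by force
        then have "f p1 < g p3" unfolding g_def using P1(4)[of p3] lt e P2 by (auto simp: transpose_def)
        then show False using lt by auto
      qed
      have n3: "next_open (g \<circ> sw (q1 - 1)) (q1 - 1) j3" "u3 = j3 + 1" "v3 = j3"
        using c(3) \<open>j2 = q1 - 1\<close> p3 q3 unfolding cstep_def g_def by auto
      have e1: "next_open (f \<circ> sw j) j k1" "x1 = k1 + 1" "y1 = k1"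
        using d(1) t e unfolding cstep_def by auto
      have fq: "0 < f (q1 + 1)" using P1(1,2) P1(4)[of "q1 + 1"] by (cases "p1 = q1 + 1") auto
      have k1: "k1 = q1"
        using h e t fq P2 by (intro next_open_eqI[OF e1(1)]) (auto simp: transpose_def)
      show ?thesis
      proof (cases "p1 = q1 + 1")
        case False
        have j3: "j3 = q1"
          using fq False e t P2 P1 g[of "q1 - 1"]
          by (intro next_open_eqI[OF n3(1)]) (auto simp: transpose_def g_def)
        have d2: "k2 = q1" "x2 = p1" "y2 = q1 + 1"
          using d(2) e k1 False P1 unfolding cstep_def by (auto simp: transpose_def split: if_splits)
        have d3: "k3 = q1" "x3 = q1 + 1" "y3 = q1 - 1"
          using d(3) d2 p3 q3 e unfolding cstep_def by (auto simp: transpose_def split: if_splits)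
        show ?thesis unfolding c1 n2(2,3) \<open>j2 = q1 - 1\<close> n3(2,3) j3 e1(2,3) k1 d2 d3
          using knuth_dual.kd_same[of "q1 - 1" q1 "q1 + 1" p1] False P1 by auto
      next
        case eq: True
        have d2: "next_open (f \<circ> transpose p2 q2 \<circ> sw q1) q1 k2" "x2 = k2 + 1" "y2 = k2"
          using d(2) k1 eq e unfolding cstep_def by auto
        have k2: "q1 < k2" "0 < (f \<circ> transpose p2 q2 \<circ> sw q1) (k2 + 1)"
          "\<And>r. q1 < r \<Longrightarrow> r \<le> k2 \<Longrightarrow> (f \<circ> transpose p2 q2 \<circ> sw q1) r \<le> 0"
          using d2 unfolding next_open_def by auto
        have j3: "j3 = k2"
        proof (rule next_open_eqI[OF n3(1)])
          show "q1 - 1 < k2" using k2(1) by simp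
          show "0 < (g \<circ> sw (q1 - 1)) (k2 + 1)" unfolding g_def
            using k2(1,2) eq t e(1,4,5) by (simp add: transpose_def)
          fix r assume r: "q1 - 1 < r" "r \<le> k2"
          show "(g \<circ> sw (q1 - 1)) r \<le> 0"
          proof (cases "r = q1")
            case True
            then show ?thesis using g[of "q1 - 1"] e t by auto
          next
            case False
            then show ?thesis using k2(3)[of r] r eq t e P1(3) unfolding g_def
              by (auto simp: transpose_def split: if_splits)
          qed
        qed
        have d3: "k3 = k2" "x3 = q1" "y3 = q1 - 1"
          using d(3) k2(1) p3 q3 e unfolding cstep_def by (auto simp: transpose_def split: if_splits)
        show ?thesis unfolding c1 n2(2,3) \<open>j2 = q1 - 1\<close> n3(2,3) j3 e1(2,3) k1 d2(2,3) d3 eq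
          using knuth_dual.kd_last[of "Jump (k2 + 1) k2" "Jump q1 (q1 - 1)" "Jump (q1 + 1) q1"] k2(1)
          by simp
      qed
    qed
  next
    case kd_last
    have e: "p2 < q3" "q2 < q1" "q1 < q3" "a1 = p1" "b1 = q1" "a2 = p3" "b2 = q3" "a3 = p2" "b3 = q2"
      using kd_last by auto
    define g where "g = f \<circ> transpose p1 q1"
    have g1: "jump g p2 q2" "jump (g \<circ> transpose p2 q2) p3 q3" "jump g p3 q3" "jump (g \<circ> transpose p3 q3) p2 q2"
      "ascent g j1"
      using p a e asc1 unfolding g_def by auto
    have m1: "k1 = j1" "x1 = u1" "y1 = v1"
      using c(1) d(1) e unfolding cstep_def by (auto split: if_splits dest: next_open_unique)
    have P2: "q2 < p2" "0 < g p2" "g q2 \<le> 0" and P3: "q3 < p3" using g1 unfolding jump_def by auto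
    \<comment> \<open>The first jump has left a particle at \<open>q1\<close>, between
      \<open>q2\<close> and \<open>q3\<close>. It escapes the run of holes only as
      \<open>q1 = j1 + 1\<close>, which neither a bump nor a pass of the first jump allows.\<close>
    have False if t: "p2 = j1 + 1" "q2 = j1" and h: "\<forall>r. j1 + 1 < r \<longrightarrow> r \<le> q3 \<longrightarrow> g r \<le> 0"
    proof -
      have "g q1 = f p1" unfolding g_def by auto
      then have "\<not> (j1 + 1 < q1)" using h e P1 by auto
      then have q1: "q1 = j1 + 1" using t e by auto
      show False
      proof (cases "p1 = j + 1 \<and> q1 = j")
        case True
        then show False using c(1) q1 unfolding cstep_def next_open_def by auto
      next
        case False
        then have "j1 = j" using c(1) unfolding cstep_def by auto
        then show False using q1 A P1 by auto
      qed
    qed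
    then have nb: "\<not> (p2 = j1 + 1 \<and> q2 = j1 \<and> (\<forall>r. j1 + 1 < r \<longrightarrow> r \<le> q3 \<longrightarrow> g r \<le> 0))" by blast
    have h: "cstep g j1 p3 q3 k2 x2 y2" "cstep (g \<circ> transpose p3 q3) k2 p2 q2 k3 x3 y3"
      "cstep g j1 p2 q2 j2 u2 v2" "cstep (g \<circ> transpose p2 q2) j2 p3 q3 j3 u3 v3"
      using c(2,3) d(2,3) m1(1) e unfolding g_def by simp_all
    have m: "k3 = j3 \<and> x3 = u2 \<and> y3 = v2 \<and> x2 = u3 \<and> y2 = v3 \<and> x3 < y2"
      by (rule cstep_apart_commute[OF e(1) g1(3,1,5) h nb])
    then show ?thesis using m1 oc1 oc2 od1 od2 e by (auto intro!: knuth_dual.kd_last)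
  qed
qed

section \<open>Insertion as a sweep from the lowest row upwards\<close>

text \<open>
  \<open>End k\<close> marks the end of row \<open>k\<close>: there the state is known at which a letter \<open>k\<close> finds its first open
  space.
\<close>

datatype item = Cross int int | End int

fun apply_item :: "(int \<Rightarrow> int) \<Rightarrow> item \<Rightarrow> int \<Rightarrow> int" where
  "apply_item f (Cross k j) = f \<circ> sw j"
| "apply_item f (End k) = f"

definition run :: "(int \<Rightarrow> int) \<Rightarrow> item list \<Rightarrow> int \<Rightarrow> int" where
  "run = foldl apply_item"

fun act :: "(int \<Rightarrow> int) \<Rightarrow> signal \<Rightarrow> int \<Rightarrow> int" where
  "act f (Wait x) = f"
| "act f (Jump p q) = f \<circ> transpose p q"

fun jump_ok :: "(int \<Rightarrow> int) \<Rightarrow> signal \<Rightarrow> bool" where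
  "jump_ok f (Wait x) \<longleftrightarrow> True"
| "jump_ok f (Jump p q) \<longleftrightarrow> jump f p q"

fun item_ok :: "(int \<Rightarrow> int) \<Rightarrow> item \<Rightarrow> bool" where
  "item_ok f (Cross k j) \<longleftrightarrow> ascent f j"
| "item_ok f (End k) \<longleftrightarrow> True"

fun good :: "(int \<Rightarrow> int) \<Rightarrow> item list \<Rightarrow> bool" where
  "good f [] \<longleftrightarrow> True"
| "good f (x # xs) \<longleftrightarrow> item_ok f x \<and> good (apply_item f x) xs"

text \<open>No particle stands further right than \<open>j + 1\<close>, so this is the open space in
  the smallest column, where a new letter enters.\<close>

definition rightmost :: "(int \<Rightarrow> int) \<Rightarrow> int \<Rightarrow> bool" where
  "rightmost f j \<longleftrightarrow> 0 < f (j + 1) \<and> (\<forall>r\<le>j. f r \<le> 0)"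

text \<open>A new crossing is written directly in front of \<open>End k\<close>: the smallest open
  column lies to the right of all crossings of the row, hence after them in reading order.\<close>

fun istep :: "(int \<Rightarrow> int) \<Rightarrow> item \<Rightarrow> signal \<Rightarrow> item list \<Rightarrow> signal \<Rightarrow> bool" where
  "istep f (Cross k j) (Wait x) ys t \<longleftrightarrow> ys = [Cross k j] \<and> t = Wait x"
| "istep f (Cross k j) (Jump p q) ys t \<longleftrightarrow>
     (\<exists>j' p' q'. cstep f j p q j' p' q' \<and> ys = [Cross k j'] \<and> t = Jump p' q')"
| "istep f (End k) (Jump p q) ys t \<longleftrightarrow> ys = [End k] \<and> t = Jump p q"
| "istep f (End k) (Wait x) ys t \<longleftrightarrow>
     (if x = k then \<exists>j. rightmost f j \<and> ys = [Cross k j, End k] \<and> t = Jump (j + 1) j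
      else ys = [End k] \<and> t = Wait x)"

fun thru :: "(int \<Rightarrow> int) \<Rightarrow> item list \<Rightarrow> signal \<Rightarrow> item list \<Rightarrow> signal \<Rightarrow> bool" where
  "thru f [] s ys t \<longleftrightarrow> ys = [] \<and> t = s"
| "thru f (x # xs) s ys t \<longleftrightarrow>
     (\<exists>y1 y2 s1. istep f x s y1 s1 \<and> thru (apply_item f x) xs s1 y2 t \<and> ys = y1 @ y2)"

fun mthru :: "(int \<Rightarrow> int) \<Rightarrow> item list \<Rightarrow> signal list \<Rightarrow> item list \<Rightarrow> signal list \<Rightarrow> bool" where
  "mthru f xs [] ys ts \<longleftrightarrow> ys = xs \<and> ts = []"
| "mthru f xs (s # ss) ys ts \<longleftrightarrow>
     (\<exists>zs t ts'. ts = t # ts' \<and> thru f xs s zs t \<and> mthru (act f s) zs ss ys ts')"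

fun jumps_ok :: "(int \<Rightarrow> int) \<Rightarrow> signal list \<Rightarrow> bool" where
  "jumps_ok f [] \<longleftrightarrow> True"
| "jumps_ok f (s # ss) \<longleftrightarrow> jump_ok f s \<and> jumps_ok (act f s) ss"

fun ends :: "item list \<Rightarrow> int list" where
  "ends [] = []"
| "ends (Cross k j # xs) = ends xs"
| "ends (End k # xs) = k # ends xs"

text \<open>Excludes letters whose row has already gone by; these would never become jumps.\<close>

fun awaits :: "item list \<Rightarrow> signal \<Rightarrow> bool" where
  "awaits xs (Wait x) \<longleftrightarrow> x \<in> set (ends xs)"
| "awaits xs (Jump p q) \<longleftrightarrow> True"

lemma run_simps [simp]: "run f [] = f" "run f (x # xs) = run (apply_item f x) xs"
  "run f (xs @ ys) = run (run f xs) ys"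
  by (simp_all add: run_def)

lemma ends_append [simp]: "ends (xs @ ys) = ends xs @ ends ys"
  by (induction xs rule: ends.induct) auto

lemma good_append [simp]: "good f (xs @ ys) \<longleftrightarrow> good f xs \<and> good (run f xs) ys"
  by (induction xs arbitrary: f) auto

lemma thru_append: "thru f (xs @ ys) s zs t \<longleftrightarrow>
    (\<exists>z1 z2 s1. thru f xs s z1 s1 \<and> thru (run f xs) ys s1 z2 t \<and> zs = z1 @ z2)"
proof (induction xs arbitrary: f s zs)
  case (Cons x xs)
  show ?case
  proof
    assume "thru f ((x # xs) @ ys) s zs t"
    then show "\<exists>z1 z2 s1. thru f (x # xs) s z1 s1 \<and> thru (run f (x # xs)) ys s1 z2 t \<and> zs = z1 @ z2"
      using Cons by (auto simp del: append_assoc) (metis append.assoc)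
  next
    assume "\<exists>z1 z2 s1. thru f (x # xs) s z1 s1 \<and> thru (run f (x # xs)) ys s1 z2 t \<and> zs = z1 @ z2"
    then show "thru f ((x # xs) @ ys) s zs t"
      using Cons by (simp del: append_assoc) (metis append.assoc)
  qed
qed simp

lemma transpose_adjacent: "transpose (j + 1) j = sw j"
  by (simp add: transpose_commute)

lemma istep_state: "istep f x s ys t \<Longrightarrow> run (act f s) ys = act (apply_item f x) t"
  by (cases "(f, x, s, ys, t)" rule: istep.cases)
    (auto dest: cstep_state simp: transpose_adjacent split: if_splits)

lemma thru_state: "thru f xs s ys t \<Longrightarrow> run (act f s) ys = act (run f xs) t"
proof (induction xs arbitrary: f s ys)
  case (Cons x xs)
  then show ?case using istep_state by fastforce
qed simp

lemma istep_ends: "istep f x s ys t \<Longrightarrow> ends ys = ends [x]"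
  by (cases "(f, x, s, ys, t)" rule: istep.cases) (auto split: if_splits)

lemma thru_ends: "thru f xs s ys t \<Longrightarrow> ends ys = ends xs"
proof (induction xs arbitrary: f s ys)
  case (Cons x xs)
  then show ?case using istep_ends[of f x s] by (cases x) fastforce+
qed simp

lemma rightmost_unique: "rightmost f i \<Longrightarrow> rightmost f j \<Longrightarrow> i = j"
  unfolding rightmost_def by (metis leD linorder_neqE zless_imp_add1_zle)

lemma cstep_unique: "cstep f j p q a b c \<Longrightarrow> cstep f j p q a' b' c' \<Longrightarrow> a = a' \<and> b = b' \<and> c = c'"
  unfolding cstep_def by (auto split: if_splits dest: next_open_unique)

lemma istep_unique: "istep f x s ys t \<Longrightarrow> istep f x s ys' t' \<Longrightarrow> ys = ys' \<and> t = t'"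
  by (cases "(f, x, s, ys, t)" rule: istep.cases)
    (auto dest: cstep_unique rightmost_unique split: if_splits)

lemma thru_unique: "thru f xs s ys t \<Longrightarrow> thru f xs s ys' t' \<Longrightarrow> ys = ys' \<and> t = t'"
proof (induction xs arbitrary: f s ys ys')
  case (Cons x xs)
  then show ?case by simp (metis istep_unique)
qed simp

lemma mthru_unique: "mthru f xs ss ys ts \<Longrightarrow> mthru f xs ss ys' ts' \<Longrightarrow> ys = ys' \<and> ts = ts'"
proof (induction ss arbitrary: f xs ts ts')
  case (Cons s ss)
  then show ?case by simp (metis thru_unique)
qed simp

lemma rightmost_jump: "rightmost f j \<Longrightarrow> jump f (j + 1) j \<and> ascent f j"
  unfolding rightmost_def jump_def ascent_def by (auto intro: le_less_trans)

lemma istep_ok: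
  assumes "istep f x s ys t" "item_ok f x" "jump_ok f s"
  shows "jump_ok (apply_item f x) t" "good (act f s) ys"
  using assms
  by (cases "(f, x, s, ys, t)" rule: istep.cases;
      auto dest: cstep_jump rightmost_jump split: if_splits)+

lemma thru_ok:
  assumes "thru f xs s ys t" "good f xs" "jump_ok f s"
  shows "jump_ok (run f xs) t" "good (act f s) ys"
proof -
  have "jump_ok (run f xs) t \<and> good (act f s) ys"
    using assms
  proof (induction xs arbitrary: f s ys)
    case (Cons x xs)
    from Cons.prems(1) obtain y1 y2 s1 where h: "istep f x s y1 s1" "thru (apply_item f x) xs s1 y2 t" "ys = y1 @ y2"
      by auto
    have "jump_ok (apply_item f x) s1" "good (act f s) y1"
      using istep_ok[OF h(1)] Cons.prems by auto
    moreover have "jump_ok (run (apply_item f x) xs) t \<and> good (act (apply_item f x) s1) y2"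
      using Cons.IH[OF h(2)] Cons.prems calculation by auto
    ultimately show ?case using istep_state[OF h(1)] h(3) by auto
  qed simp
  then show "jump_ok (run f xs) t" "good (act f s) ys" by auto
qed

lemma mthru_ok:
  assumes "mthru f xs ss ys ts" "good f xs" "jumps_ok f ss"
  shows "jumps_ok (run f xs) ts" "good (foldl act f ss) ys" "run (foldl act f ss) ys = foldl act (run f xs) ts"
proof -
  have "jumps_ok (run f xs) ts \<and> good (foldl act f ss) ys \<and> run (foldl act f ss) ys = foldl act (run f xs) ts"
    using assms
  proof (induction ss arbitrary: f xs ts)
    case (Cons s ss)
    then obtain zs t ts' where h: "ts = t # ts'" "thru f xs s zs t" "mthru (act f s) zs ss ys ts'"
      by auto
    have "jump_ok (run f xs) t" "good (act f s) zs" using thru_ok[OF h(2)] Cons.prems by auto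
    moreover have "jumps_ok (run (act f s) zs) ts' \<and> good (foldl act (act f s) ss) ys
        \<and> run (foldl act (act f s) ss) ys = foldl act (run (act f s) zs) ts'"
      using Cons.IH[OF h(3)] calculation Cons.prems by auto
    ultimately show ?case using h thru_state[OF h(2)] by auto
  qed auto
  then show "jumps_ok (run f xs) ts" "good (foldl act f ss) ys"
    "run (foldl act f ss) ys = foldl act (run f xs) ts" by auto
qed

text \<open>Exchanges the two loops: all signals are taken past one part of the diagram before any
  of them meets the next part. Only in this order can a triple of signals be followed item by
  item.\<close>

lemma mthru_append_items: "mthru f (xs @ ys) ss zs ts \<Longrightarrow>
    \<exists>z1 z2 us. mthru f xs ss z1 us \<and> mthru (run f xs) ys us z2 ts \<and> zs = z1 @ z2"
proof (induction ss arbitrary: f xs ys ts)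
  case (Cons s ss)
  then obtain ws t ts' where h: "ts = t # ts'" "thru f (xs @ ys) s ws t" "mthru (act f s) ws ss zs ts'"
    by auto
  from h(2) obtain w1 w2 s1 where w: "thru f xs s w1 s1" "thru (run f xs) ys s1 w2 t" "ws = w1 @ w2"
    unfolding thru_append by auto
  from Cons.IH[of "act f s" w1 w2 ts'] h(3) w(3) obtain z1 z2 us where
    z: "mthru (act f s) w1 ss z1 us" "mthru (run (act f s) w1) w2 us z2 ts'" "zs = z1 @ z2"
    by blast
  have "mthru f xs (s # ss) z1 (s1 # us)" using w(1) z(1) by auto
  moreover have "mthru (run f xs) ys (s1 # us) z2 ts"
    using w(2) z(2) h(1) unfolding thru_state[OF w(1)] by auto
  ultimately show ?case using z(3) by blast
qed auto

lemma mthru_length: "mthru f xs ss ys ts \<Longrightarrow> length ts = length ss"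
  by (induction ss arbitrary: f xs ts) auto

lemma mthru_ends: "mthru f xs ss ys ts \<Longrightarrow> ends ys = ends xs"
  by (induction ss arbitrary: f xs ts) (auto dest: thru_ends)

lemma mthru_append_signals: "mthru f xs (ss @ ss') ys ts \<longleftrightarrow>
    (\<exists>zs us us'. ts = us @ us' \<and> mthru f xs ss zs us \<and> mthru (foldl act f ss) zs ss' ys us')"
proof (induction ss arbitrary: f xs ts)
  case (Cons s ss)
  show ?case (is "?L \<longleftrightarrow> ?R")
  proof
    assume ?L
    then obtain ws t ts' where "ts = t # ts'" "thru f xs s ws t" "mthru (act f s) ws (ss @ ss') ys ts'"
      by auto
    moreover then obtain zs us us' where "ts' = us @ us'" "mthru (act f s) ws ss zs us"
      "mthru (foldl act (act f s) ss) zs ss' ys us'" using Cons by blast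
    ultimately have "ts = (t # us) @ us' \<and> mthru f xs (s # ss) zs (t # us)
        \<and> mthru (foldl act f (s # ss)) zs ss' ys us'" by auto
    then show ?R by blast
  next
    assume ?R
    then obtain zs us us' where h: "ts = us @ us'" "mthru f xs (s # ss) zs us"
      "mthru (foldl act (act f s) ss) zs ss' ys us'" by (metis foldl_Cons)
    then obtain ws t vs where v: "us = t # vs" "thru f xs s ws t" "mthru (act f s) ws ss zs vs"
      by auto
    then have "mthru (act f s) ws (ss @ ss') ys (vs @ us')" using Cons h by blast
    then show ?L using h v by auto
  qed
qed simp

fun compatible :: "item \<Rightarrow> signal \<Rightarrow> bool" where
  "compatible (End k) (Wait x) \<longleftrightarrow> k \<le> x"
| "compatible _ _ \<longleftrightarrow> True"

text \<open>A jump spans no hole, and everything up to \<open>j\<close> is a hole.\<close>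

lemma jump_hole_below:
  assumes "jump f p q" "0 < f (j + 1)" "\<forall>r\<le>j. f r \<le> 0"
  shows "j \<le> q" "q \<noteq> j + 1"
proof -
  have a: "q < p" "0 < f p" "f q \<le> 0" "\<And>r. q < r \<Longrightarrow> r < p \<Longrightarrow> f p < f r"
    using assms(1) unfolding jump_def by auto
  show "q \<noteq> j + 1" using a assms by auto
  have "j < p" using a(2) assms(3)[rule_format, of p] by linarith
  show "j \<le> q"
  proof (rule ccontr)
    assume "\<not> j \<le> q"
    then have "f p < f j" using a(4)[of j] \<open>j < p\<close> by auto
    then show False using assms(3)[rule_format, of j] a(2) by auto
  qed
qed

text \<open>The point is \<open>End k\<close>, where the order of letters turns into the order of
  right ends. Equal letters enter one after the other, the second one place further right. A letter
  entering after a jump stays to the right of it, because the jump has put a particle at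
  \<open>q\<close>; one entering before a jump is to the right of it by
  \<open>jump_hole_below\<close>.\<close>

lemma istep_order:
  assumes i: "istep f x s1 ys t1" and t: "thru (act f s1) ys s2 zs t2"
    and ok: "jump_ok f s1" "jump_ok (act f s1) s2" "item_ok f x"
    and w: "compatible x s1" "compatible x s2"
  shows "weakly_right_of t2 t1 \<longleftrightarrow> weakly_right_of s2 s1"
proof (cases x)
  case [simp]: (Cross k j)
  show ?thesis
  proof (cases s1)
    case [simp]: (Wait a)
    show ?thesis using i t by (cases s2) auto
  next
    case [simp]: (Jump p1 q1)
    show ?thesis
    proof (cases s2)
      case [simp]: (Wait b)
      show ?thesis using i t by auto
    next
      case [simp]: (Jump p2 q2)
      show ?thesis using i t ok by auto (meson cstep_order(2))+
    qed
  qed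
next
  case [simp]: (End k)
  show ?thesis
  proof (cases s1)
    case [simp]: (Wait a)
    show ?thesis
    proof (cases "a = k")
      case False
      then have "ys = [End k]" "t1 = Wait a" "k < a" using i w by auto
      then show ?thesis using t w by (cases s2) (auto split: if_splits)
    next
      case True
      then obtain j where j: "rightmost f j" "ys = [Cross k j, End k]" "t1 = Jump (j + 1) j" using i by auto
      show ?thesis
      proof (cases s2)
        case [simp]: (Wait b)
        have "k \<le> b" using w by auto
        show ?thesis
        proof (cases "b = k")
          case True
          then obtain j' where j': "rightmost (f \<circ> sw j) j'" "t2 = Jump (j' + 1) j'"
            using t j by auto
          have "j' = j - 1"
          proof (rule rightmost_unique[OF j'(1)])
            show "rightmost (f \<circ> sw j) (j - 1)" using j(1) unfolding rightmost_def by (auto simp: transpose_def)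
          qed
          then show ?thesis using j j' True \<open>a = k\<close> by auto
        next
          case False
          then show ?thesis using t j True \<open>k \<le> b\<close> by (auto split: if_splits)
        qed
      next
        case [simp]: (Jump p q)
        have J: "jump f p q" using ok by auto
        obtain j' p' q' where c: "cstep f j p q j' p' q'" "t2 = Jump p' q'" using t j by auto
        have "j \<le> q" "q \<noteq> j + 1" using jump_hole_below[OF J] j(1) unfolding rightmost_def by auto
        then have "j < q'" using c(1) unfolding cstep_def next_open_def
          by (auto simp: transpose_def split: if_splits)
        then show ?thesis using c j by auto
      qed
    qed
  next
    case [simp]: (Jump p q)
    have y: "ys = [End k]" "t1 = Jump p q" using i by auto
    show ?thesis
    proof (cases s2)
      case [simp]: (Wait b)
      show ?thesis
      proof (cases "b = k")
        case True
        then obtain j where j: "rightmost (f \<circ> transpose p q) j" "t2 = Jump (j + 1) j" using t y by auto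
        have "j < q"
        proof (rule ccontr)
          assume "\<not> j < q"
          then have "(f \<circ> transpose p q) q \<le> 0"
            using j(1)[unfolded rightmost_def, THEN conjunct2, rule_format, of q] by simp
          then show False using ok(1) unfolding jump_ok.simps jump_def Jump by auto
        qed
        then show ?thesis using j y by auto
      next
        case False
        then show ?thesis using t y by auto
      qed
    next
      case (Jump p' q')
      then show ?thesis using t y by auto
    qed
  qed
qed

lemma awaits_compatible:
  assumes "awaits (x # xs) s" "sorted_wrt (<) (ends (x # xs))" "istep f x s ys t"
  shows "compatible x s" "awaits xs t"
  using assms by (cases x; cases s; auto split: if_splits)+

lemma thru_order:
  assumes "thru f xs s1 ys t1" "thru (act f s1) ys s2 zs t2"
    "jump_ok f s1" "jump_ok (act f s1) s2" "good f xs"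
    "sorted_wrt (<) (ends xs)" "awaits xs s1" "awaits xs s2"
  shows "weakly_right_of t2 t1 \<longleftrightarrow> weakly_right_of s2 s1"
  using assms
proof (induction xs arbitrary: f s1 s2 ys zs)
  case (Cons x xs)
  from Cons.prems(1) obtain y1 y2 u1 where h: "istep f x s1 y1 u1" "thru (apply_item f x) xs u1 y2 t1" "ys = y1 @ y2"
    by auto
  have "thru (act f s1) (y1 @ y2) s2 zs t2" using Cons.prems(2) h(3) by simp
  then obtain z1 z2 u2 where k: "thru (act f s1) y1 s2 z1 u2"
    "thru (run (act f s1) y1) y2 u2 z2 t2" "zs = z1 @ z2" unfolding thru_append by blast
  have st: "run (act f s1) y1 = act (apply_item f x) u1" using istep_state[OF h(1)] .
  have a: "compatible x s1" "awaits xs u1" using awaits_compatible[OF Cons.prems(7,6) h(1)] by auto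
  have e: "ends y1 = ends [x]" using istep_ends[OF h(1)] .
  have ok1: "jump_ok (apply_item f x) u1" "good (act f s1) y1"
    using istep_ok[OF h(1)] Cons.prems by auto
  have ok2: "jump_ok (run (act f s1) y1) u2" using thru_ok[OF k(1)] ok1 Cons.prems by auto
  have b: "compatible x s2" using Cons.prems(6,8) by (cases x; cases s2; auto)
  have b2: "awaits xs u2"
  proof (cases u2)
    case (Wait c)
    have thru_wait: "\<And>f ys s zs c. thru f ys s zs (Wait c) \<Longrightarrow> s = Wait c \<and> c \<notin> set (ends ys)"
    proof -
      fix f ys s zs c
      show "thru f ys s zs (Wait c) \<Longrightarrow> s = Wait c \<and> c \<notin> set (ends ys)"
      proof (induction ys arbitrary: f s zs)
        case (Cons y ys)
        then obtain z1 z2 v where v: "istep f y s z1 v" "thru (apply_item f y) ys v z2 (Wait c)" by auto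
        then have "v = Wait c" "c \<notin> set (ends ys)" using Cons by blast+
        then show ?case using v(1) by (cases y; cases s) (auto split: if_splits)
      qed auto
    qed
    show ?thesis using thru_wait[of "act f s1" y1 s2 z1 c] k(1) Wait e Cons.prems(8)
      by (cases x) auto
  qed simp
  have "weakly_right_of t2 t1 \<longleftrightarrow> weakly_right_of u2 u1"
  proof (rule Cons.IH[OF h(2)])
    show "thru (act (apply_item f x) u1) y2 u2 z2 t2" using k(2) st by simp
    show "jump_ok (act (apply_item f x) u1) u2" using ok2 st by simp
    show "sorted_wrt (<) (ends xs)" using Cons.prems(6) by (cases x) auto
    show "good (apply_item f x) xs" using Cons.prems(5) by simp
  qed (use ok1 a b2 in auto)
  also have "\<dots> \<longleftrightarrow> weakly_right_of s2 s1"
    using istep_order[OF h(1) k(1)] Cons.prems a b by auto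
  finally show ?case .
qed auto

text \<open>A step looks only at \<open>j\<close> and the positions left of it. This makes it
  possible to change a state far on the right.\<close>

lemma cstep_cong:
  assumes "\<And>r. j \<le> r \<Longrightarrow> f r = g r"
  shows "cstep f j p q j' p' q' \<longleftrightarrow> cstep g j p q j' p' q'"
proof -
  have "next_open (f \<circ> sw j) j j' \<longleftrightarrow> next_open (g \<circ> sw j) j j'"
    by (rule next_open_cong) (use assms in \<open>simp add: transpose_def\<close>)
  then show ?thesis unfolding cstep_def by auto
qed

text \<open>
  A particle entering at the end of a row is simulated by a particle standing far to the right of
  everything and crossing a single hole.
\<close>

lemma knuth_dual_start:
  assumes g_def: "g = f \<circ> transpose p1 q1" and a: "jump f p1 q1" and c: "jump g p3 q3" and q: "q3 < q1"
    and r1: "rightmost g j1" and c1: "cstep g j1 p3 q3 j3 u3 v3"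
    and r0: "rightmost f j0" and d1: "cstep f j0 p1 q1 j2 u v" and d2: "cstep g j2 p3 q3 k3 x3 y3"
  shows "j3 = k3 \<and> knuth_dual [Jump p1 q1, Jump (j1 + 1) j1, Jump u3 v3]
    [Jump (j0 + 1) j0, Jump u v, Jump x3 y3]"
proof -
  define P where "P = min (min j0 j1) (min q1 q3) - 2"
  have P: "P < j0" "P < j1" "P < q1" "P < q3" unfolding P_def by auto
  \<comment> \<open>An extra particle in a region of holes. Bumped at the crossing
    \<open>P - 1\<close>, it runs to the first particle on its left and lands exactly where a letter
    would enter, so the situation becomes an instance of \<open>kd_first\<close> at a crossing. Its
    label may coincide with another one: states are arbitrary functions here.\<close>
  define h where "h = f (P := 1)"
  have qp: "q1 < p1" "q3 < p3" using a c unfolding jump_def by auto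
  have f0: "f r \<le> 0" if "r \<le> j0" for r using r0 that unfolding rightmost_def by auto
  have g0: "g r \<le> 0" if "r \<le> j1" for r using r1 that unfolding rightmost_def by auto
  have "j0 \<le> j2" using d1 unfolding cstep_def next_open_def by (auto split: if_splits)
  have gP: "(h \<circ> transpose p1 q1) r = g r" if "P < r" for r
    using that P qp unfolding g_def h_def by (auto simp: transpose_def)
  have hP: "(h \<circ> transpose P (P - 1)) r = f r" if "P < r" for r
    using that unfolding h_def by (auto simp: transpose_def)
  have gP': "(h \<circ> transpose p1 q1 \<circ> transpose P (P - 1)) r = g r"
    "(h \<circ> transpose P (P - 1) \<circ> transpose p1 q1) r = g r" if "P < r" for r
    using that P qp unfolding g_def h_def by (auto simp: transpose_def)
  have low: "jump h P (P - 1)" "jump (h \<circ> transpose p1 q1) P (P - 1)"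
    using f0[of "P - 1"] P qp unfolding h_def jump_def by (auto simp: transpose_def)
  have hi: "jump h p1 q1" "jump (h \<circ> transpose P (P - 1)) p1 q1"
    "jump (h \<circ> transpose p1 q1 \<circ> transpose P (P - 1)) p3 q3"
    "jump (h \<circ> transpose P (P - 1) \<circ> transpose p1 q1) p3 q3"
  proof -
    show "jump h p1 q1" by (subst jump_cong[of _ _ _ f]) (use a P in \<open>auto simp: h_def\<close>)
    show "jump (h \<circ> transpose P (P - 1)) p1 q1"
      by (subst jump_cong[of _ _ _ f]) (use a P hP in auto)
    show "jump (h \<circ> transpose p1 q1 \<circ> transpose P (P - 1)) p3 q3"
      by (subst jump_cong[of _ _ _ g]) (use c P gP' in auto)
    show "jump (h \<circ> transpose P (P - 1) \<circ> transpose p1 q1) p3 q3"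
      by (subst jump_cong[of _ _ _ g]) (use c P gP' in auto)
  qed
  have no: "next_open (e \<circ> sw (P - 1)) (P - 1) j"
    if r: "rightmost e' j" "P < j" and e: "e (P - 1) \<le> 0" "\<And>s. P < s \<Longrightarrow> e s = e' s" for e e' j
    unfolding next_open_def
  proof (intro conjI allI impI)
    show "0 < (e \<circ> sw (P - 1)) (j + 1)"
      using r e(2)[of "j + 1"] unfolding rightmost_def by (simp add: transpose_def)
    show "(e \<circ> sw (P - 1)) s \<le> 0" if "P - 1 < s" "s \<le> j" for s
    proof (cases "s = P")
      case False
      then show ?thesis using r e(2)[of s] that unfolding rightmost_def by (simp add: transpose_def)
    qed (use e(1) in \<open>simp add: transpose_def\<close>)
  qed (use r in simp)
  show ?thesis
  proof (rule knuth_dual_cstep[where f = h and j = "P - 1" and ?p1.0 = p1 and ?q1.0 = q1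
        and ?p2.0 = P and ?q2.0 = "P - 1" and ?p3.0 = p3 and ?q3.0 = q3
        and ?a1.0 = P and ?b1.0 = "P - 1" and ?a2.0 = p1 and ?b2.0 = q1 and ?a3.0 = p3 and ?b3.0 = q3])
    show "knuth_dual [Jump p1 q1, Jump P (P - 1), Jump p3 q3] [Jump P (P - 1), Jump p1 q1, Jump p3 q3]"
      by (rule knuth_dual.kd_first) (use P q in auto)
    show "ascent h (P - 1)" unfolding ascent_def h_def using f0[of "P - 1"] P by auto
    show "cstep h (P - 1) p1 q1 (P - 1) p1 q1" using P qp by (auto simp: cstep_def transpose_def)
    show "cstep (h \<circ> transpose p1 q1) (P - 1) P (P - 1) j1 (j1 + 1) j1"
      using no[OF r1 P(2), of "h \<circ> transpose p1 q1"] gP low(2) unfolding cstep_def jump_def by auto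
    show "cstep (h \<circ> transpose p1 q1 \<circ> transpose P (P - 1)) j1 p3 q3 j3 u3 v3"
      by (subst cstep_cong[of _ _ g]) (use c1 P gP' in auto)
    show "cstep h (P - 1) P (P - 1) j0 (j0 + 1) j0"
      using no[OF r0 P(1), of h] low(1) unfolding cstep_def jump_def by (auto simp: h_def)
    show "cstep (h \<circ> transpose P (P - 1)) j0 p1 q1 j2 u v"
      by (subst cstep_cong[of _ _ f]) (use d1 P hP in auto)
    show "cstep (h \<circ> transpose P (P - 1) \<circ> transpose p1 q1) j2 p3 q3 k3 x3 y3"
      by (subst cstep_cong[of _ _ g]) (use d2 P \<open>j0 \<le> j2\<close> gP' in auto)
  qed (fact low hi)+
qed

text \<open>The particle left at \<open>qb\<close> forces the letter to enter right of
  \<open>qb\<close>, hence right of the third jump. The two do not meet, in either order.\<close>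

lemma knuth_dual_start_last:
  assumes b: "jump f pb qb" and g: "g = f \<circ> transpose pb qb" and a: "jump g p q" and o: "qb < q"
    and r1: "rightmost g j1" and c: "cstep g j1 p q j3 u v" and r4: "rightmost (g \<circ> transpose p q) j4"
  shows "j3 = j4 \<and> knuth_dual [Jump pb qb, Jump (j1 + 1) j1, Jump u v] [Jump pb qb, Jump p q, Jump (j4 + 1) j4]"
proof -
  have "0 < g qb" using b g unfolding jump_def by auto
  then have j1: "j1 < qb" using r1 unfolding rightmost_def by (meson leI not_le)
  have "q < p" using a unfolding jump_def by auto
  have "rightmost (g \<circ> transpose p q) j1"
    using r1 j1 o \<open>q < p\<close> unfolding rightmost_def by (auto simp: transpose_def)
  then have "j4 = j1" using r4 rightmost_unique by blast
  have "j3 = j1" "u = p" "v = q" using c j1 o \<open>q < p\<close> unfolding cstep_def by (auto simp: transpose_def split: if_splits)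
  then show ?thesis using \<open>j4 = j1\<close> j1 o by (auto intro!: knuth_dual.kd_last)
qed

text \<open>Waiting letters pass a crossing untouched, so with one of them in the triple both sides
  make the same steps and only the order of the right ends has to be kept. The rightmost signal is
  \<open>s2\<close>; if it is a jump, so are the others, as no jump counts as right of a waiting
  letter.\<close>

lemma knuth_dual_cross:
  assumes k: "knuth_dual ss tt" and ok: "jumps_ok f ss" "jumps_ok f tt" "ascent f j"
    and m: "mthru f [Cross k j] ss ys us" "mthru f [Cross k j] tt zs vs"
  shows "ys = zs \<and> knuth_dual us vs"
proof -
  have all_jumps: ?thesis
    if e: "ss = [Jump p1 q1, Jump p2 q2, Jump p3 q3]" "tt = [Jump a1 b1, Jump a2 b2, Jump a3 b3]"
    for p1 q1 p2 q2 p3 q3 a1 b1 a2 b2 a3 b3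
  proof -
    from m(1) e(1) obtain j1 u1 v1 j2 u2 v2 j3 u3 v3 where c: "cstep f j p1 q1 j1 u1 v1"
      "cstep (f \<circ> transpose p1 q1) j1 p2 q2 j2 u2 v2"
      "cstep (f \<circ> transpose p1 q1 \<circ> transpose p2 q2) j2 p3 q3 j3 u3 v3"
      "ys = [Cross k j3]" "us = [Jump u1 v1, Jump u2 v2, Jump u3 v3]"
      by auto
    from m(2) e(2) obtain k1 x1 y1 k2 x2 y2 k3 x3 y3 where d: "cstep f j a1 b1 k1 x1 y1"
      "cstep (f \<circ> transpose a1 b1) k1 a2 b2 k2 x2 y2"
      "cstep (f \<circ> transpose a1 b1 \<circ> transpose a2 b2) k2 a3 b3 k3 x3 y3"
      "zs = [Cross k k3]" "vs = [Jump x1 y1, Jump x2 y2, Jump x3 y3]"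
      by auto
    show ?thesis
      using knuth_dual_cstep[OF k[unfolded e] _ _ _ _ _ _ ok(3) c(1-3) d(1-3)] ok(1,2) c d e by auto
  qed
  from k show ?thesis
  proof cases
    case (kd_same q2 q1 p3 p1)
    then show ?thesis by (intro all_jumps)
  next
    case (kd_first s1 s2 s3)
    show ?thesis
    proof (cases s2)
      case [simp]: (Jump p2 q2)
      with kd_first obtain p1 q1 p3 q3 where "s1 = Jump p1 q1" "s3 = Jump p3 q3"
        by (cases s1; cases s3) auto
      then show ?thesis using kd_first by (intro all_jumps) auto
    next
      case [simp]: (Wait b)
      show ?thesis
      proof (cases s3)
        case [simp]: (Jump p3 q3)
        with kd_first obtain p1 q1 where [simp]: "s1 = Jump p1 q1" by (cases s1) auto
        from m(1) kd_first(1) obtain j1 u1 v1 j3 u3 v3 where c: "cstep f j p1 q1 j1 u1 v1"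
          "cstep (f \<circ> transpose p1 q1) j1 p3 q3 j3 u3 v3"
          "ys = [Cross k j3]" "us = [Jump u1 v1, Wait b, Jump u3 v3]" by auto
        from m(2) kd_first(2) obtain k1 x1 y1 k3 x3 y3 where d: "cstep f j p1 q1 k1 x1 y1"
          "cstep (f \<circ> transpose p1 q1) k1 p3 q3 k3 x3 y3"
          "zs = [Cross k k3]" "vs = [Wait b, Jump x1 y1, Jump x3 y3]" by auto
        have "k1 = j1" "x1 = u1" "y1 = v1" using cstep_unique[OF c(1) d(1)] by auto
        moreover have "k3 = j3" "x3 = u3" "y3 = v3"
          using cstep_unique[OF c(2)] d(2) calculation by auto
        moreover have "v3 < v1"
          using cstep_order(2)[OF _ _ ok(3) c(1,2)] ok(1) kd_first by auto
        ultimately show ?thesis using c d by (auto intro!: knuth_dual.kd_first)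
      next
        case [simp]: (Wait c)
        show ?thesis
        proof (cases s1)
          case [simp]: (Jump p1 q1)
          from m(1) kd_first(1) obtain j1 u1 v1 where c: "cstep f j p1 q1 j1 u1 v1"
            "ys = [Cross k j1]" "us = [Jump u1 v1, Wait b, Wait c]" by auto
          from m(2) kd_first(2) obtain k1 x1 y1 where d: "cstep f j p1 q1 k1 x1 y1"
            "zs = [Cross k k1]" "vs = [Wait b, Jump x1 y1, Wait c]" by auto
          show ?thesis using cstep_unique[OF c(1) d(1)] c d kd_first by (auto intro!: knuth_dual.kd_first)
        next
          case [simp]: (Wait a)
          show ?thesis using m kd_first by (auto intro!: knuth_dual.kd_first)
        qed
      qed
    qed
  next
    case (kd_last s3 s2 s1)
    show ?thesis
    proof (cases s2)
      case [simp]: (Jump p2 q2)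
      with kd_last obtain p1 q1 p3 q3 where "s1 = Jump p1 q1" "s3 = Jump p3 q3"
        by (cases s1; cases s3) auto
      then show ?thesis using kd_last by (intro all_jumps) auto
    next
      case [simp]: (Wait b)
      show ?thesis
      proof (cases s1)
        case [simp]: (Jump p1 q1)
        with kd_last obtain p3 q3 where [simp]: "s3 = Jump p3 q3" by (cases s3) auto
        from m(1) kd_last(1) obtain j1 u1 v1 j3 u3 v3 where c: "cstep f j p1 q1 j1 u1 v1"
          "cstep (f \<circ> transpose p1 q1) j1 p3 q3 j3 u3 v3"
          "ys = [Cross k j3]" "us = [Jump u1 v1, Wait b, Jump u3 v3]" by auto
        from m(2) kd_last(2) obtain k1 x1 y1 k3 x3 y3 where d: "cstep f j p1 q1 k1 x1 y1"
          "cstep (f \<circ> transpose p1 q1) k1 p3 q3 k3 x3 y3"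
          "zs = [Cross k k3]" "vs = [Jump x1 y1, Jump x3 y3, Wait b]" by auto
        have "k1 = j1" "x1 = u1" "y1 = v1" using cstep_unique[OF c(1) d(1)] by auto
        moreover have "k3 = j3" "x3 = u3" "y3 = v3"
          using cstep_unique[OF c(2)] d(2) calculation by auto
        moreover have "v1 < v3"
          using cstep_order(2,3)[OF _ _ ok(3) c(1,2)] ok(1) kd_last by auto
        ultimately show ?thesis using c d by (auto intro!: knuth_dual.kd_last)
      next
        case [simp]: (Wait a)
        show ?thesis
        proof (cases s3)
          case [simp]: (Jump p3 q3)
          from m(1) kd_last(1) obtain j1 u1 v1 where c: "cstep f j p3 q3 j1 u1 v1"
            "ys = [Cross k j1]" "us = [Wait a, Wait b, Jump u1 v1]" by auto
          from m(2) kd_last(2) obtain k1 x1 y1 where d: "cstep f j p3 q3 k1 x1 y1"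
            "zs = [Cross k k1]" "vs = [Wait a, Jump x1 y1, Wait b]" by auto
          show ?thesis using cstep_unique[OF c(1) d(1)] c d kd_last by (auto intro!: knuth_dual.kd_last)
        next
          case [simp]: (Wait c)
          show ?thesis using m kd_last by (auto intro!: knuth_dual.kd_last)
        qed
      qed
    qed
  qed
qed

lemma rightmost_sw: "rightmost f j \<Longrightarrow> rightmost (f \<circ> sw j) j' \<longleftrightarrow> j' = j - 1"
proof -
  assume r: "rightmost f j"
  have "rightmost (f \<circ> sw j) (j - 1)" using r unfolding rightmost_def by (auto simp: transpose_def)
  then show ?thesis using rightmost_unique by blast
qed

lemma rightmost_after_jump:
  assumes "jump f p q" "rightmost (f \<circ> transpose p q) j" shows "j < q"
proof (rule ccontr)
  assume "\<not> j < q"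
  then have "(f \<circ> transpose p q) q \<le> 0"
    using assms(2)[unfolded rightmost_def, THEN conjunct2, rule_format, of q] by simp
  then show False using assms(1) unfolding jump_def by simp
qed

lemma start_before_jump:
  assumes "rightmost f j" "jump f p q" "cstep f j p q j' u v" shows "j < v"
proof -
  have "j \<le> q" "q \<noteq> j + 1" using jump_hole_below[OF assms(2)] assms(1) unfolding rightmost_def by auto
  then show ?thesis using assms(3) unfolding cstep_def next_open_def
    by (auto simp: transpose_def split: if_splits)
qed

text \<open>Letters start in increasing order: \<open>s1\<close>, \<open>s3\<close>,
  \<open>s2\<close> in \<open>kd_first\<close> and \<open>s3\<close>, \<open>s1\<close>,
  \<open>s2\<close> in \<open>kd_last\<close>. While \<open>s2\<close> waits, both sides leave the
  same crossings. When it starts, the other two are jumps, \<open>s1\<close> perhaps a fresh one,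
  and \<open>knuth_dual_start\<close> or \<open>knuth_dual_start_last\<close> applies.\<close>

lemma knuth_dual_end:
  assumes k: "knuth_dual ss tt" and ok: "jumps_ok f ss" "jumps_ok f tt" "\<forall>s\<in>set ss. compatible (End k) s"
    and m: "mthru f [End k] ss ys us" "mthru f [End k] tt zs vs"
  shows "ys = zs \<and> knuth_dual us vs"
  using k
proof cases
  case (kd_same q2 q1 p3 p1)
  then show ?thesis using m k by auto
next
  case (kd_first s1 s2 s3)
  show ?thesis
  proof (cases s2)
    case [simp]: (Jump p2 q2)
    with kd_first obtain p1 q1 p3 q3 where "s1 = Jump p1 q1" "s3 = Jump p3 q3"
      by (cases s1; cases s3) auto
    then show ?thesis using kd_first m k by auto
  next
    case [simp]: (Wait b)
    show ?thesis
    proof (cases s3)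
      case [simp]: (Jump p3 q3)
      with kd_first obtain p1 q1 where [simp]: "s1 = Jump p1 q1" by (cases s1) auto
      show ?thesis
      proof (cases "b = k")
        case [simp]: True
        from m(1) kd_first(1) obtain j1 j3 u3 v3 where c: "rightmost (f \<circ> transpose p1 q1) j1"
          "cstep (f \<circ> transpose p1 q1) j1 p3 q3 j3 u3 v3"
          "ys = [Cross k j3, End k]" "us = [Jump p1 q1, Jump (j1 + 1) j1, Jump u3 v3]" by auto
        from m(2) kd_first(2) obtain j0 j2 u v k3 x3 y3 where d: "rightmost f j0" "cstep f j0 p1 q1 j2 u v"
          "cstep (f \<circ> transpose p1 q1) j2 p3 q3 k3 x3 y3"
          "zs = [Cross k k3, End k]" "vs = [Jump (j0 + 1) j0, Jump u v, Jump x3 y3]" by auto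
        show ?thesis using knuth_dual_start[OF refl _ _ _ c(1,2) d(1-3)] ok kd_first c d by auto
      next
        case False
        then show ?thesis using m kd_first k by auto
      qed
    next
      case [simp]: (Wait c)
      have b: "k < b" "k \<le> c" using ok kd_first by auto
      show ?thesis
      proof (cases s1)
        case [simp]: (Jump p1 q1)
        show ?thesis
        proof (cases "c = k")
          case [simp]: True
          from m(1) kd_first(1) b obtain j1 where c: "rightmost (f \<circ> transpose p1 q1) j1"
            "ys = [Cross k j1, End k]" "us = [Jump p1 q1, Wait b, Jump (j1 + 1) j1]" by auto
          from m(2) kd_first(2) b obtain j2 where d: "rightmost (f \<circ> transpose p1 q1) j2"
            "zs = [Cross k j2, End k]" "vs = [Wait b, Jump p1 q1, Jump (j2 + 1) j2]" by auto
          have "j1 < q1" using rightmost_after_jump[OF _ c(1)] ok(1) kd_first by auto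
          then show ?thesis using rightmost_unique[OF c(1) d(1)] c d by (auto intro!: knuth_dual.kd_first)
        next
          case False
          then show ?thesis using m kd_first b by (auto intro!: knuth_dual.kd_first)
        qed
      next
        case [simp]: (Wait a)
        have a: "k \<le> a" "a \<le> c" using ok kd_first by auto
        show ?thesis
        proof (cases "a = k")
          case [simp]: True
          show ?thesis
          proof (cases "c = k")
            case [simp]: True
            from m(1) kd_first(1) b obtain j1 j2 where c: "rightmost f j1" "rightmost (f \<circ> sw j1) j2"
              "ys = [Cross k j1, Cross k j2, End k]" "us = [Jump (j1 + 1) j1, Wait b, Jump (j2 + 1) j2]" by auto
            from m(2) kd_first(2) b obtain k1 k2 where d: "rightmost f k1" "rightmost (f \<circ> sw k1) k2"
              "zs = [Cross k k1, Cross k k2, End k]" "vs = [Wait b, Jump (k1 + 1) k1, Jump (k2 + 1) k2]" by auto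
            have "k1 = j1" using rightmost_unique[OF c(1) d(1)] by simp
            then show ?thesis using c d rightmost_sw[OF c(1)] by (auto intro!: knuth_dual.kd_first)
          next
            case False
            from m(1) kd_first(1) b False obtain j1 where c: "rightmost f j1"
              "ys = [Cross k j1, End k]" "us = [Jump (j1 + 1) j1, Wait b, Wait c]" by auto
            from m(2) kd_first(2) b False obtain k1 where d: "rightmost f k1"
              "zs = [Cross k k1, End k]" "vs = [Wait b, Jump (k1 + 1) k1, Wait c]" by auto
            show ?thesis using rightmost_unique[OF c(1) d(1)] c d kd_first by (auto intro!: knuth_dual.kd_first)
          qed
        next
          case False
          then have "c \<noteq> k" using a by auto
          then show ?thesis using False m kd_first b by (auto intro!: knuth_dual.kd_first)
        qed
      qed
    qed
  qed
next
  case (kd_last s3 s2 s1)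
  show ?thesis
  proof (cases s2)
    case [simp]: (Jump p2 q2)
    with kd_last obtain p1 q1 p3 q3 where "s1 = Jump p1 q1" "s3 = Jump p3 q3"
      by (cases s1; cases s3) auto
    then show ?thesis using kd_last m k by auto
  next
    case [simp]: (Wait b)
    show ?thesis
    proof (cases s1)
      case [simp]: (Jump p1 q1)
      with kd_last obtain p3 q3 where [simp]: "s3 = Jump p3 q3" by (cases s3) auto
      show ?thesis
      proof (cases "b = k")
        case [simp]: True
        from m(1) kd_last(1) obtain j1 j3 u3 v3 where c: "rightmost (f \<circ> transpose p1 q1) j1"
          "cstep (f \<circ> transpose p1 q1) j1 p3 q3 j3 u3 v3"
          "ys = [Cross k j3, End k]" "us = [Jump p1 q1, Jump (j1 + 1) j1, Jump u3 v3]" by auto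
        from m(2) kd_last(2) obtain j4 where d: "rightmost (f \<circ> transpose p1 q1 \<circ> transpose p3 q3) j4"
          "zs = [Cross k j4, End k]" "vs = [Jump p1 q1, Jump p3 q3, Jump (j4 + 1) j4]" by auto
        show ?thesis using knuth_dual_start_last[OF _ refl _ _ c(1,2) d(1)] ok kd_last c d by auto
      next
        case False
        then show ?thesis using m kd_last k by auto
      qed
    next
      case [simp]: (Wait a)
      have a: "k \<le> a" "a \<le> b" using ok kd_last by auto
      show ?thesis
      proof (cases "a = k")
        case [simp]: True
        with kd_last obtain p q where [simp]: "s3 = Jump p q" using ok by (cases s3) auto
        show ?thesis
        proof (cases "b = k")
          case [simp]: True
          from m(1) kd_last(1) obtain j0 j1 j2 u v j3 x y where c: "rightmost f j0" "rightmost (f \<circ> sw j0) j1"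
            "cstep f j0 p q j2 u v" "cstep (f \<circ> sw j0) j1 u v j3 x y"
            "ys = [Cross k j2, Cross k j3, End k]" "us = [Jump (j0 + 1) j0, Jump (j1 + 1) j1, Jump x y]"
            by auto
          from m(2) kd_last(2) obtain i0 i2 u' v' i3 where d: "rightmost f i0" "cstep f i0 p q i2 u' v'"
            "rightmost (f \<circ> transpose p q \<circ> sw i2) i3"
            "zs = [Cross k i2, Cross k i3, End k]" "vs = [Jump (i0 + 1) i0, Jump u' v', Jump (i3 + 1) i3]"
            by auto
          have i0: "i0 = j0" using rightmost_unique[OF c(1) d(1)] by simp
          have i2: "i2 = j2" "u' = u" "v' = v" using cstep_unique[OF c(3)] d(2) i0 by auto
          have J: "jump f p q" using ok kd_last by auto
          have b: "jump f (j0 + 1) j0" and asc: "ascent f j0" using rightmost_jump[OF c(1)] by auto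
          have "f \<circ> sw j0 = f \<circ> transpose (j0 + 1) j0" by (simp add: transpose_commute)
          moreover have "jump (f \<circ> sw j0) u v" using cstep_jump[OF J asc c(3)] by simp
          moreover have "j0 < v" using start_before_jump[OF c(1) J c(3)] .
          moreover have "rightmost (f \<circ> sw j0 \<circ> transpose u v) i3"
            using d(3) cstep_state[OF c(3)] i2 by simp
          ultimately have "j3 = i3 \<and> knuth_dual [Jump (j0 + 1) j0, Jump (j1 + 1) j1, Jump x y]
              [Jump (j0 + 1) j0, Jump u v, Jump (i3 + 1) i3]"
            using knuth_dual_start_last[OF b _ _ _ c(2,4)] by blast
          then show ?thesis using c d i0 i2 by auto
        next
          case False
          from m(1) kd_last(1) False obtain j0 j2 u v where c: "rightmost f j0"
            "cstep f j0 p q j2 u v" "ys = [Cross k j2, End k]" "us = [Jump (j0 + 1) j0, Wait b, Jump u v]"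
            by auto
          from m(2) kd_last(2) False obtain i0 i2 u' v' where d: "rightmost f i0" "cstep f i0 p q i2 u' v'"
            "zs = [Cross k i2, End k]" "vs = [Jump (i0 + 1) i0, Jump u' v', Wait b]"
            by auto
          have i0: "i0 = j0" using rightmost_unique[OF c(1) d(1)] by simp
          have i2: "i2 = j2" "u' = u" "v' = v" using cstep_unique[OF c(2)] d(2) i0 by auto
          have "j0 < v" using start_before_jump[OF c(1) _ c(2)] ok kd_last by auto
          then show ?thesis using c d i0 i2 by (auto intro!: knuth_dual.kd_last)
        qed
      next
        case False
        then have ab: "a \<noteq> k" "b \<noteq> k" using a by auto
        show ?thesis
        proof (cases s3)
          case [simp]: (Jump p q)
          show ?thesis using m kd_last ab by (auto intro!: knuth_dual.kd_last)
        next
          case [simp]: (Wait c)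
          show ?thesis
          proof (cases "c = k")
            case [simp]: True
            from m(1) kd_last(1) ab obtain j1 where c: "rightmost f j1"
              "ys = [Cross k j1, End k]" "us = [Wait a, Wait b, Jump (j1 + 1) j1]" by auto
            from m(2) kd_last(2) ab obtain k1 where d: "rightmost f k1"
              "zs = [Cross k k1, End k]" "vs = [Wait a, Jump (k1 + 1) k1, Wait b]" by auto
            show ?thesis using rightmost_unique[OF c(1) d(1)] c d kd_last by (auto intro!: knuth_dual.kd_last)
          next
            case False
            then show ?thesis using m kd_last ab by (auto intro!: knuth_dual.kd_last)
          qed
        qed
      qed
    qed
  qed
qed

section \<open>Knuth equivalence\<close>

lemma thru_Wait:
  "thru f xs s ys (Wait c) \<Longrightarrow> s = Wait c \<and> c \<notin> set (ends xs) \<and> ys = xs"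
proof (induction xs arbitrary: f s ys)
  case (Cons x xs)
  then obtain z1 z2 v where v: "istep f x s z1 v" "thru (apply_item f x) xs v z2 (Wait c)" "ys = z1 @ z2" by auto
  then have "v = Wait c" "c \<notin> set (ends xs)" "z2 = xs" using Cons by blast+
  then show ?case using v(1,3) by (cases x; cases s) (auto split: if_splits)
qed auto

lemma awaits_thru:
  assumes "thru f xs s ys t" "awaits (xs @ zs) s" shows "awaits zs t"
  using assms by (cases t) (auto dest!: thru_Wait)

lemma mthru_awaits:
  assumes "mthru f xs ss ys us" "\<forall>s\<in>set ss. awaits (xs @ zs) s" shows "\<forall>u\<in>set us. awaits zs u"
  using assms
proof (induction ss arbitrary: f xs us)
  case (Cons s ss)
  then obtain ws t us' where h: "us = t # us'" "thru f xs s ws t" "mthru (act f s) ws ss ys us'" by auto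
  have "awaits (ws @ zs) s'" if "s' \<in> set ss" for s'
    using Cons.prems(2) that thru_ends[OF h(2)] by (cases s') fastforce+
  then have "\<forall>u\<in>set us'. awaits zs u" using Cons.IH[OF h(3)] by auto
  then show ?case using awaits_thru[OF h(2)] Cons.prems(2) h(1) by auto
qed auto

text \<open>Induction on the diagram rather than on the signals. All three signals pass the first
  item, which leaves the same new items on both sides and again a related pair of triples in front
  of the rest.\<close>

lemma knuth_dual_thru:
  assumes "knuth_dual ss tt" "jumps_ok f ss" "jumps_ok f tt" "good f xs"
    "sorted_wrt (<) (ends xs)" "\<forall>s\<in>set ss. awaits xs s"
    "mthru f xs ss ys us" "mthru f xs tt zs vs"
  shows "ys = zs \<and> knuth_dual us vs"
  using assms
proof (induction xs arbitrary: f ss tt ys zs)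
  case Nil
  have "mthru f [] ss ys us \<Longrightarrow> us = ss \<and> ys = []" for f ss ys us
    by (induction ss arbitrary: f us) auto
  then show ?case using Nil by blast
next
  case (Cons x xs)
  obtain y1 y2 us1 where y: "mthru f [x] ss y1 us1" "mthru (run f [x]) xs us1 y2 us" "ys = y1 @ y2"
    using mthru_append_items[of f "[x]" xs ss ys us] Cons.prems by auto
  obtain z1 z2 vs1 where z: "mthru f [x] tt z1 vs1" "mthru (run f [x]) xs vs1 z2 vs" "zs = z1 @ z2"
    using mthru_append_items[of f "[x]" xs tt zs vs] Cons.prems by auto
  have c: "\<forall>s\<in>set ss. compatible x s"
  proof
    fix s assume "s \<in> set ss"
    then have "awaits (x # xs) s" using Cons.prems by auto
    then show "compatible x s" using Cons.prems(5) by (cases x; cases s) auto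
  qed
  have 1: "y1 = z1 \<and> knuth_dual us1 vs1"
  proof (cases x)
    case (Cross k j)
    then show ?thesis using knuth_dual_cross[OF Cons.prems(1-3) _ y(1)[unfolded Cross] z(1)[unfolded Cross]]
      Cons.prems(4) by auto
  next
    case (End k)
    then show ?thesis using knuth_dual_end[OF Cons.prems(1-3) _ y(1)[unfolded End] z(1)[unfolded End]] c by auto
  qed
  have g: "good f [x]" "good (run f [x]) xs" using Cons.prems(4) by auto
  have a: "\<forall>u\<in>set us1. awaits xs u" using mthru_awaits[OF y(1), of xs] Cons.prems(6) by simp
  have s: "sorted_wrt (<) (ends xs)" using Cons.prems(5) by (cases x) auto
  have "y2 = z2 \<and> knuth_dual us vs"
    by (rule Cons.IH[OF conjunct2[OF 1] mthru_ok(1)[OF y(1) g(1) Cons.prems(2)]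
        mthru_ok(1)[OF z(1) g(1) Cons.prems(3)] g(2) s a y(2) z(2)])
  then show ?case using 1 y(3) z(3) by auto
qed

fun is_jump :: "signal \<Rightarrow> bool" where
  "is_jump (Jump p q) \<longleftrightarrow> True"
| "is_jump (Wait x) \<longleftrightarrow> False"

text \<open>For jumps the right ends tell which rule applies: \<open>q3 = q1\<close> in
  \<open>kd_same\<close>, \<open>q2 < q3 < q1\<close> in \<open>kd_first\<close>,
  \<open>q2 < q1 < q3\<close> in \<open>kd_last\<close>.\<close>

lemma knuth_dual_right_unique:
  assumes "knuth_dual us vs" "knuth_dual us vs'" "list_all is_jump us"
  shows "vs = vs'"
  using assms(1)
proof cases
  case kd_same
  from assms(2) show ?thesis by cases (use kd_same in auto)
next
  case (kd_first s1 s2 s3)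
  then obtain p1 q1 p2 q2 p3 q3 where "s1 = Jump p1 q1" "s2 = Jump p2 q2" "s3 = Jump p3 q3"
    using assms(3) by (cases s1; cases s2; cases s3) auto
  note e = kd_first this
  from assms(2) show ?thesis by cases (use e in auto)
next
  case (kd_last s3 s2 s1)
  then obtain p1 q1 p2 q2 p3 q3 where "s1 = Jump p1 q1" "s2 = Jump p2 q2" "s3 = Jump p3 q3"
    using assms(3) by (cases s1; cases s2; cases s3) auto
  note e = kd_last this
  from assms(2) show ?thesis by cases (use e in auto)
qed

text \<open>On this side the order of right ends is the same for \<open>kd_last\<close> and
  \<open>kd_same\<close>. They differ in that \<open>kd_last\<close> keeps its last two jumps apart,
  while in \<open>kd_same\<close> the last one starts where the second ends.\<close>

lemma knuth_dual_left_unique: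
  assumes "knuth_dual us vs" "knuth_dual us' vs" "list_all is_jump vs"
  shows "us = us'"
  using assms(1)
proof cases
  case kd_same
  from assms(2) show ?thesis by cases (use kd_same in auto)
next
  case (kd_first s1 s2 s3)
  then obtain p1 q1 p2 q2 p3 q3 where "s1 = Jump p1 q1" "s2 = Jump p2 q2" "s3 = Jump p3 q3"
    using assms(3) by (cases s1; cases s2; cases s3) auto
  note e = kd_first this
  from assms(2) show ?thesis by cases (use e in auto)
next
  case (kd_last s3 s2 s1)
  then obtain p1 q1 p2 q2 p3 q3 where "s1 = Jump p1 q1" "s2 = Jump p2 q2" "s3 = Jump p3 q3"
    using assms(3) by (cases s1; cases s2; cases s3) auto
  note e = kd_last this
  from assms(2) show ?thesis by cases (use e in auto)
qed

text \<open>Holes far to the right and particles far to the left: this makes every search for an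
  open space succeed.\<close>

definition tame :: "(int \<Rightarrow> int) \<Rightarrow> bool" where
  "tame f \<longleftrightarrow> (\<exists>M. (\<forall>r>M. 0 < f r) \<and> (\<forall>r< -M. f r \<le> 0))"

lemma tame_transpose: "tame f \<Longrightarrow> tame (f \<circ> transpose a b)"
proof -
  assume "tame f"
  then obtain M where "\<forall>r>M. 0 < f r" "\<forall>r< -M. f r \<le> 0" unfolding tame_def by auto
  then have "(\<forall>r>\<bar>M\<bar> + \<bar>a\<bar> + \<bar>b\<bar>. 0 < (f \<circ> transpose a b) r) \<and> (\<forall>r< -(\<bar>M\<bar> + \<bar>a\<bar> + \<bar>b\<bar>). (f \<circ> transpose a b) r \<le> 0)"
    by (auto simp: transpose_def)
  then show ?thesis unfolding tame_def by blast
qed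

lemma tame_run: "tame f \<Longrightarrow> tame (run f xs)"
proof (induction xs arbitrary: f)
  case (Cons x xs)
  then show ?case using tame_transpose by (cases x) auto
qed simp

lemma tame_act: "tame f \<Longrightarrow> tame (act f s)"
  using tame_transpose by (cases s) auto

lemma least_red:
  assumes "\<exists>r>j. 0 < (g :: int \<Rightarrow> int) r"
  obtains m where "j < m" "0 < g m" "\<And>r. j < r \<Longrightarrow> r < m \<Longrightarrow> g r \<le> 0"
proof -
  define P where "P = (\<lambda>n::nat. 0 < g (j + 1 + int n))"
  obtain r where "j < r" "0 < g r" using assms by auto
  then have "P (nat (r - j - 1))" unfolding P_def by auto
  then have 1: "P (LEAST n. P n)" by (rule LeastI)
  have 2: "g r \<le> 0" if "j < r" "r < j + 1 + int (LEAST n. P n)" for r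
  proof -
    have "nat (r - j - 1) < (LEAST n. P n)" using that by linarith
    then have "\<not> P (nat (r - j - 1))" by (rule not_less_Least)
    then show ?thesis using that unfolding P_def by auto
  qed
  show ?thesis by (rule that[of "j + 1 + int (LEAST n. P n)"]) (use 1 2 in \<open>auto simp: P_def\<close>)
qed

lemma istep_total: assumes "tame f" "jump_ok f s" "item_ok f x" shows "\<exists>ys t. istep f x s ys t"
proof (cases x)
  case [simp]: (Cross k j)
  show ?thesis
  proof (cases s)
    case [simp]: (Jump p q)
    show ?thesis
    proof (cases "p = j + 1 \<and> q = j")
      case True
      have "tame (f \<circ> sw j)" using assms tame_transpose by auto
      then obtain M where "\<forall>r>M. 0 < (f \<circ> sw j) r" unfolding tame_def by auto
      then have "\<exists>r>j. 0 < (f \<circ> sw j) r" by (intro exI[of _ "max j M + 1"]) auto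
      then obtain m where m: "j < m" "0 < (f \<circ> sw j) m" "\<And>r. j < r \<Longrightarrow> r < m \<Longrightarrow> (f \<circ> sw j) r \<le> 0"
        using least_red by blast
      have "(f \<circ> sw j) (j + 1) \<le> 0" using assms True by (auto simp: jump_def)
      then have "m \<noteq> j + 1" using m by auto
      then have "next_open (f \<circ> sw j) j (m - 1)" using m unfolding next_open_def by auto
      then show ?thesis using True by (auto simp: cstep_def)
    next
      case False
      then show ?thesis by (auto simp: cstep_def)
    qed
  qed simp
next
  case [simp]: (End k)
  show ?thesis
  proof (cases s)
    case [simp]: (Wait y)
    obtain M where M: "\<forall>r>M. 0 < f r" "\<forall>r< -M. f r \<le> 0" using assms unfolding tame_def by auto
    then have "\<exists>r>-\<bar>M\<bar>-1. 0 < f r" by (intro exI[of _ "\<bar>M\<bar> + 1"]) auto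
    then obtain m where m: "-\<bar>M\<bar>-1 < m" "0 < f m" "\<And>r. -\<bar>M\<bar>-1 < r \<Longrightarrow> r < m \<Longrightarrow> f r \<le> 0"
      using least_red by blast
    have "f r \<le> 0" if "r < m" for r using m(3)[of r] M(2) that by (cases "r < - M") auto
    then have "rightmost f (m - 1)" using m unfolding rightmost_def by auto
    then show ?thesis by (cases "y = k") auto
  qed simp
qed

lemma thru_total:
  assumes "tame f" "jump_ok f s" "good f xs" shows "\<exists>ys t. thru f xs s ys t"
  using assms
proof (induction xs arbitrary: f s)
  case (Cons x xs)
  obtain y1 s1 where h: "istep f x s y1 s1" using istep_total Cons.prems by (meson good.simps(2))
  have "tame (apply_item f x)" using tame_run[OF Cons.prems(1), of "[x]"] by simp
  moreover have "jump_ok (apply_item f x) s1" using istep_ok[OF h] Cons.prems by auto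
  ultimately obtain y2 t where "thru (apply_item f x) xs s1 y2 t" using Cons by (meson good.simps(2))
  then show ?case using h by auto
qed (use thru.simps(1) in blast)

lemma mthru_total:
  assumes "tame f" "jumps_ok f ss" "good f xs" shows "\<exists>ys ts. mthru f xs ss ys ts"
  using assms
proof (induction ss arbitrary: f xs)
  case (Cons s ss)
  obtain zs t where h: "thru f xs s zs t" using thru_total Cons.prems by (meson jumps_ok.simps(2))
  have "good (act f s) zs" using thru_ok[OF h] Cons.prems by auto
  then obtain ys ts where "mthru (act f s) zs ss ys ts" using Cons tame_act by (meson jumps_ok.simps(2))
  then show ?case using h by auto
qed (use mthru.simps(1) in blast)

section \<open>Words of letters and the chains of jumps that they cause\<close>

lemma foldl_act_Wait [simp]: "foldl act f (map Wait v) = f"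
  by (induction v) auto

lemma jumps_ok_Wait [simp]: "jumps_ok f (map Wait v)"
  by (induction v) auto

text \<open>The last conjunct gives every letter a row of its own in the diagram, so that all
  signals come out as jumps.\<close>

definition base :: "(int \<Rightarrow> int) \<Rightarrow> item list \<Rightarrow> int list \<Rightarrow> bool" where
  "base f xs v \<longleftrightarrow> tame f \<and> good f xs \<and> sorted_wrt (<) (ends xs) \<and> set v \<subseteq> set (ends xs)"

lemma base_awaits: "base f xs v \<Longrightarrow> \<forall>s\<in>set (map Wait v). awaits xs s"
  unfolding base_def by auto

lemma base_step:
  assumes "base f xs v" "mthru f xs (map Wait v) ys C" "set w \<subseteq> set (ends xs)"
  shows "base f ys w"
  using assms mthru_ok(2)[OF assms(2)] mthru_ends[OF assms(2)] unfolding base_def by auto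

lemma base_total: "base f xs v \<Longrightarrow> \<exists>ys C. mthru f xs (map Wait v) ys C"
  unfolding base_def by (intro mthru_total) auto

lemma base_jumps:
  assumes "base f xs v" "mthru f xs (map Wait v) ys C"
  shows "list_all is_jump C"
proof -
  have "\<forall>u\<in>set C. awaits [] u" using mthru_awaits[OF assms(2), of "[]"] base_awaits[OF assms(1)] by simp
  then have "is_jump u" if "u \<in> set C" for u using that by (cases u) auto
  then show ?thesis by (simp add: list_all_iff)
qed

lemma base_order:
  assumes "base f xs [x, y]" "mthru f xs [Wait x, Wait y] ys [c, d]"
  shows "weakly_right_of d c \<longleftrightarrow> x \<le> y"
  using thru_order[of f xs "Wait x" _ c "Wait y" _ d] assms unfolding base_def by auto

lemma word_split:
  assumes "base f xs (a @ b)" "mthru f xs (map Wait (a @ b)) ys C"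
  obtains zs C1 C2 where "C = C1 @ C2" "mthru f xs (map Wait a) zs C1" "mthru f zs (map Wait b) ys C2"
    "base f xs a" "base f zs b" "length C1 = length a" "length C2 = length b"
proof -
  obtain zs C1 C2 where h: "C = C1 @ C2" "mthru f xs (map Wait a) zs C1" "mthru f zs (map Wait b) ys C2"
    using assms(2) by (auto simp: mthru_append_signals)
  have "base f xs a" using assms(1) unfolding base_def by auto
  moreover have "base f zs b" using base_step[OF calculation h(2)] assms(1) unfolding base_def by auto
  ultimately show ?thesis using that h mthru_length[OF h(2)] mthru_length[OF h(3)] by auto
qed

lemma word_join:
  assumes "mthru f xs (map Wait a) zs C1" "mthru f zs (map Wait b) ys C2"
  shows "mthru f xs (map Wait (a @ b)) ys (C1 @ C2)"
  using assms by (auto simp: mthru_append_signals)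

text \<open>Neighbouring letters compare as their jumps do, so whether a segment can be a row of a
  tableau is visible in the chain alone.\<close>

lemma base_sorted:
  assumes "base f xs v" "mthru f xs (map Wait v) ys C"
  shows "sorted v \<longleftrightarrow> successively (\<lambda>c d. weakly_right_of d c) C"
  using assms
proof (induction v arbitrary: xs C)
  case Nil
  then show ?case by simp
next
  case (Cons x v)
  show ?case
  proof (cases v)
    case Nil
    then show ?thesis using Cons.prems by auto
  next
    case (Cons y w)
    obtain c C' zs where c: "C = c # C'" "thru f xs (Wait x) zs c" "mthru f zs (map Wait v) ys C'"
      using Cons.prems(2) by auto
    obtain d C'' ws where d: "C' = d # C''" "thru f zs (Wait y) ws d"
      using c(3) Cons by auto
    have b: "base f zs v" using base_step[of f xs "[x]" zs "[c]" v] c(2) Cons.prems(1) unfolding base_def by auto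
    have bxy: "base f xs [x, y]" using Cons.prems(1) Cons unfolding base_def by auto
    have "weakly_right_of d c \<longleftrightarrow> x \<le> y" using base_order[OF bxy] c(2) d(2) by auto
    moreover have "sorted (x # v) \<longleftrightarrow> x \<le> y \<and> sorted v" using Cons by auto
    ultimately show ?thesis using Cons.IH[OF b c(3)] c(1) d(1) by simp
  qed
qed

definition knuth_step :: "int list \<Rightarrow> int list \<Rightarrow> bool" where
  "knuth_step v w \<longleftrightarrow> (\<exists>a t u b. v = a @ t @ b \<and> w = a @ u @ b \<and>
     (knuth_dual (map Wait t) (map Wait u) \<or> knuth_dual (map Wait u) (map Wait t)))"

lemma knuth_dual_words:
  "knuth_dual (map Wait t) (map Wait u) \<longleftrightarrow> (\<exists>x y z. x \<le> y \<and> y < z \<and> t = [x, z, y] \<and> u = [z, x, y])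
    \<or> (\<exists>x y z. x < y \<and> y \<le> z \<and> t = [y, z, x] \<and> u = [y, x, z])"
proof
  assume "knuth_dual (map Wait t) (map Wait u)"
  then show "(\<exists>x y z. x \<le> y \<and> y < z \<and> t = [x, z, y] \<and> u = [z, x, y])
    \<or> (\<exists>x y z. x < y \<and> y \<le> z \<and> t = [y, z, x] \<and> u = [y, x, z])"
    by cases (auto simp: map_eq_Cons_conv Cons_eq_map_conv)
next
  assume "(\<exists>x y z. x \<le> y \<and> y < z \<and> t = [x, z, y] \<and> u = [z, x, y])
    \<or> (\<exists>x y z. x < y \<and> y \<le> z \<and> t = [y, z, x] \<and> u = [y, x, z])"
  then show "knuth_dual (map Wait t) (map Wait u)"
  proof (elim disjE exE conjE)
    fix x y z assume "x \<le> y" "y < z" "t = [x, z, y]" "u = [z, x, y]"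
    then show ?thesis using knuth_dual.kd_first[of "Wait x" "Wait z" "Wait y"] by simp
  next
    fix x y z assume "x < y" "y \<le> z" "t = [y, z, x]" "u = [y, x, z]"
    then show ?thesis using knuth_dual.kd_last[of "Wait x" "Wait z" "Wait y"] by simp
  qed
qed

lemma knuth_step_set: "knuth_step v w \<Longrightarrow> set w = set v"
  unfolding knuth_step_def knuth_dual_words by auto

lemma length3_order:
  assumes "base f xs t" "mthru f xs (map Wait t) ys C" "length t = 3"
    "base f' xs' t'" "mthru f' xs' (map Wait t') ys' C" "length t' = 3"
  shows "t ! 0 \<le> t ! 1 \<longleftrightarrow> t' ! 0 \<le> t' ! 1" "t ! 1 \<le> t ! 2 \<longleftrightarrow> t' ! 1 \<le> t' ! 2"
proof -
  have *: "\<exists>c1 c2 c3. C = [c1, c2, c3] \<and> (weakly_right_of c2 c1 \<longleftrightarrow> t ! 0 \<le> t ! 1) \<and>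
      (weakly_right_of c3 c2 \<longleftrightarrow> t ! 1 \<le> t ! 2)"
    if h: "base f xs t" "mthru f xs (map Wait t) ys C" "length t = 3" for f xs ys t
  proof -
    obtain x y z where t: "t = [x, y, z]" using h(3) by (auto simp: length_Suc_conv numeral_3_eq_3)
    obtain c1 c2 c3 z1 z2 where c: "C = [c1, c2, c3]" "thru f xs (Wait x) z1 c1" "thru f z1 (Wait y) z2 c2"
      "thru f z2 (Wait z) ys c3" using h(2) t by auto
    have "base f xs [x, y]" "base f xs [x]" using h(1) t unfolding base_def by auto
    moreover have "base f z1 [y, z]"
      by (rule base_step[OF calculation(2), of z1 "[c1]"]) (use c h(1) t in \<open>auto simp: base_def\<close>)
    ultimately show ?thesis
      using base_order[of f xs x y z2 c1 c2] base_order[of f z1 y z ys c2 c3] c t by auto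
  qed
  show "t ! 0 \<le> t ! 1 \<longleftrightarrow> t' ! 0 \<le> t' ! 1" "t ! 1 \<le> t ! 2 \<longleftrightarrow> t' ! 1 \<le> t' ! 2"
    using *[OF assms(1-3)] *[OF assms(4-6)] by auto
qed

text \<open>The common chain shows that \<open>t'\<close> has the same pattern of ascent and descent
  as \<open>t\<close>, hence a Knuth neighbour on the same side, though perhaps by the other of the
  two relations. The two neighbours have the same chain because each of their chains is the unique
  partner of \<open>C\<close>.\<close>

lemma knuth_transfer3:
  assumes t: "base f xs t" "mthru f xs (map Wait t) ys C"
    and t': "base f' xs' t'" "mthru f' xs' (map Wait t') ys' C"
    and k: "knuth_dual (map Wait t) (map Wait u) \<or> knuth_dual (map Wait u) (map Wait t)"
  shows "\<exists>u' D. (knuth_dual (map Wait t') (map Wait u') \<or> knuth_dual (map Wait u') (map Wait t')) \<and>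
    mthru f xs (map Wait u) ys D \<and> mthru f' xs' (map Wait u') ys' D"
proof -
  have l: "length t = 3" using k unfolding knuth_dual_words by auto
  have "length C = 3" using mthru_length[OF t(2)] l by simp
  then have l': "length t' = 3" using mthru_length[OF t'(2)] by simp
  obtain x y z where e: "t' = [x, y, z]" using l' by (auto simp: length_Suc_conv numeral_3_eq_3)
  note o = length3_order[OF t l t' l', unfolded e]
  have bu: "base f xs u" using t(1) k unfolding base_def knuth_dual_words by auto
  obtain zs D where D: "mthru f xs (map Wait u) zs D" using base_total[OF bu] by auto
  have thr: "ws = ws' \<and> knuth_dual E E'"
    if "base f xs s" "base f xs s'" "knuth_dual (map Wait s) (map Wait s')" "mthru f xs (map Wait s) ws E"
      "mthru f xs (map Wait s') ws' E'" for f xs s s' ws ws' E E'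
    by (rule knuth_dual_thru[OF that(3) _ _ _ _ base_awaits[OF that(1)] that(4,5)])
      (use that(1) in \<open>auto simp: base_def\<close>)
  note J = base_jumps[OF t]
  from k show ?thesis
  proof
    assume k: "knuth_dual (map Wait t) (map Wait u)"
    then have "x \<le> y \<and> z < y" using o unfolding knuth_dual_words e by auto
    then have "\<exists>u'. knuth_dual (map Wait t') (map Wait u')" unfolding knuth_dual_words e
      by (cases "x \<le> z") force+
    then obtain u' where u': "knuth_dual (map Wait t') (map Wait u')" by auto
    have bu': "base f' xs' u'" using t'(1) u' unfolding base_def knuth_dual_words by auto
    obtain zs' D' where D': "mthru f' xs' (map Wait u') zs' D'" using base_total[OF bu'] by auto
    have "zs = ys \<and> knuth_dual C D" using thr[OF t(1) bu k t(2) D] by auto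
    moreover have "zs' = ys' \<and> knuth_dual C D'" using thr[OF t'(1) bu' u' t'(2) D'] by auto
    ultimately show ?thesis using knuth_dual_right_unique[OF _ _ J, of D D'] D D' u' by blast
  next
    assume k: "knuth_dual (map Wait u) (map Wait t)"
    then have "y < x \<and> y \<le> z" using o unfolding knuth_dual_words e by auto
    then have "\<exists>u'. knuth_dual (map Wait u') (map Wait t')" unfolding knuth_dual_words e
      by (cases "z < x") force+
    then obtain u' where u': "knuth_dual (map Wait u') (map Wait t')" by auto
    have bu': "base f' xs' u'" using t'(1) u' unfolding base_def knuth_dual_words by auto
    obtain zs' D' where D': "mthru f' xs' (map Wait u') zs' D'" using base_total[OF bu'] by auto
    have "zs = ys \<and> knuth_dual D C" using thr[OF bu t(1) k D t(2)] by auto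
    moreover have "zs' = ys' \<and> knuth_dual D' C" using thr[OF bu' t'(1) u' D' t'(2)] by auto
    ultimately show ?thesis using knuth_dual_left_unique[OF _ _ J, of D D'] D D' u' by blast
  qed
qed

lemma knuth_transfer_step:
  assumes v: "base f xs v" "mthru f xs (map Wait v) ys C"
    and v': "base f' xs' v'" "mthru f' xs' (map Wait v') ys' C"
    and k: "knuth_step v w"
  shows "\<exists>w' D. knuth_step v' w' \<and> mthru f xs (map Wait w) ys D \<and> mthru f' xs' (map Wait w') ys' D"
proof -
  obtain a t u b where e: "v = a @ t @ b" "w = a @ u @ b"
    "knuth_dual (map Wait t) (map Wait u) \<or> knuth_dual (map Wait u) (map Wait t)"
    using k unfolding knuth_step_def by blast
  obtain xs1 C1 C23 where 1: "C = C1 @ C23" "mthru f xs (map Wait a) xs1 C1" "mthru f xs1 (map Wait (t @ b)) ys C23"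
    "base f xs1 (t @ b)" "length C1 = length a"
    using word_split[of f xs a "t @ b" ys C] v e by metis
  obtain xs2 C2 C3 where 2: "C23 = C2 @ C3" "mthru f xs1 (map Wait t) xs2 C2" "mthru f xs2 (map Wait b) ys C3"
    "base f xs1 t" "length C2 = length t" "length C3 = length b"
    using word_split[OF 1(4,3)] by metis
  have len: "length v' = length a + length t + length b"
    using mthru_length[OF v(2)] mthru_length[OF v'(2)] e by simp
  define a' where "a' = take (length a) v'"
  define t' where "t' = take (length t) (drop (length a) v')"
  define b' where "b' = drop (length a + length t) v'"
  have e': "v' = a' @ t' @ b'" unfolding a'_def t'_def b'_def
    by (metis add.commute append_take_drop_id drop_drop)
  have la: "length a' = length a" "length t' = length t" unfolding a'_def t'_def using len by auto
  obtain ys1 E1 E23 where 3: "C = E1 @ E23" "mthru f' xs' (map Wait a') ys1 E1" "mthru f' ys1 (map Wait (t' @ b')) ys' E23"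
    "base f' ys1 (t' @ b')" "length E1 = length a'"
    using word_split[of f' xs' a' "t' @ b'" ys' C] v' e' by metis
  obtain ys2 E2 E3 where 4: "E23 = E2 @ E3" "mthru f' ys1 (map Wait t') ys2 E2" "mthru f' ys2 (map Wait b') ys' E3"
    "base f' ys1 t'" "length E2 = length t'"
    using word_split[OF 3(4,3)] by metis
  have "E1 = C1" "E23 = C23" using 1 3 la by auto
  then have "E2 = C2" "E3 = C3" using 2 4 la by auto
  obtain u' D where D: "knuth_dual (map Wait t') (map Wait u') \<or> knuth_dual (map Wait u') (map Wait t')"
    "mthru f xs1 (map Wait u) xs2 D" "mthru f' ys1 (map Wait u') ys2 D"
    using knuth_transfer3[OF 2(4,2) 4(4) 4(2)[unfolded \<open>E2 = C2\<close>] e(3)] by auto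
  have "mthru f xs (map Wait w) ys (C1 @ D @ C3)"
    unfolding e using word_join[OF 1(2) word_join[OF D(2) 2(3)]] by simp
  moreover have "mthru f' xs' (map Wait (a' @ u' @ b')) ys' (C1 @ D @ C3)"
    using word_join[OF 3(2) word_join[OF D(3) 4(3)]] \<open>E1 = C1\<close> \<open>E3 = C3\<close> by simp
  moreover have "knuth_step v' (a' @ u' @ b')" unfolding knuth_step_def using e' D(1) by blast
  ultimately show ?thesis by blast
qed

lemma knuth_transfer:
  assumes "knuth_step\<^sup>*\<^sup>* v w" and v: "base f xs v" "mthru f xs (map Wait v) ys C"
    and v': "base f' xs' v'" "mthru f' xs' (map Wait v') ys' C"
  shows "\<exists>w' D. knuth_step\<^sup>*\<^sup>* v' w' \<and> base f xs w \<and> base f' xs' w' \<and>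
    mthru f xs (map Wait w) ys D \<and> mthru f' xs' (map Wait w') ys' D"
  using assms(1)
proof (induction)
  case base
  then show ?case using v v' by blast
next
  case (step w z)
  then obtain w' D where h: "knuth_step\<^sup>*\<^sup>* v' w'" "base f xs w" "base f' xs' w'"
    "mthru f xs (map Wait w) ys D" "mthru f' xs' (map Wait w') ys' D" by auto
  obtain z' E where "knuth_step w' z'" "mthru f xs (map Wait z) ys E" "mthru f' xs' (map Wait z') ys' E"
    using knuth_transfer_step[OF h(2,4,3,5) step(2)] by auto
  moreover then have "base f xs z" "base f' xs' z'"
    using h(2,3) step(2) knuth_step_set unfolding base_def by auto
  ultimately show ?case using h(1) by (meson rtranclp.rtrancl_into_rtrancl)
qed

text \<open>
  In terms of Schensted insertion: the first row of the tableau of \<open>v\<close> has length at least \<open>m\<close>.  Two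
  rows \<open>s\<close> (lower) and \<open>r\<close> (upper) are column strict iff \<open>s @ r\<close> has no first row longer than \<open>r\<close>, so
  being a tableau word of given shape is visible in the Knuth class.
\<close>

definition long_row :: "int list \<Rightarrow> nat \<Rightarrow> bool" where
  "long_row v m \<longleftrightarrow> (\<exists>a b. knuth_step\<^sup>*\<^sup>* v (a @ b) \<and> sorted b \<and> length b = m)"

text \<open>The Knuth moves are imitated one at a time on \<open>v'\<close>, the chains staying
  equal; sortedness of the last \<open>m\<close> letters is then read off from the common
  chain.\<close>

lemma long_row_transfer:
  assumes v: "base f xs v" "mthru f xs (map Wait v) ys C"
    and v': "base f' xs' v'" "mthru f' xs' (map Wait v') ys' C" and l: "long_row v m"
  shows "long_row v' m"
proof -
  obtain a b where ab: "knuth_step\<^sup>*\<^sup>* v (a @ b)" "sorted b" "length b = m" using l unfolding long_row_def by auto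
  obtain w' D where w: "knuth_step\<^sup>*\<^sup>* v' w'" "base f xs (a @ b)" "base f' xs' w'"
    "mthru f xs (map Wait (a @ b)) ys D" "mthru f' xs' (map Wait w') ys' D"
    using knuth_transfer[OF ab(1) v v'] by auto
  have len: "length w' = length a + length b"
    using mthru_length[OF w(4)] mthru_length[OF w(5)] by simp
  define a' b' where "a' = take (length a) w'" and "b' = drop (length a) w'"
  have e: "w' = a' @ b'" "length a' = length a" "length b' = length b"
    unfolding a'_def b'_def using len by auto
  obtain zs C1 C2 where 1: "D = C1 @ C2" "mthru f zs (map Wait b) ys C2" "base f zs b" "length C1 = length a"
    using word_split[OF w(2,4)] by metis
  obtain zs' E1 E2 where 2: "D = E1 @ E2" "mthru f' zs' (map Wait b') ys' E2" "base f' zs' b'" "length E1 = length a'"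
    using word_split[of f' xs' a' b' ys' D] w(3,5) e(1) by metis
  have "C2 = E2" using 1 2 e by auto
  then have "sorted b'" using base_sorted[OF 1(3,2)] base_sorted[OF 2(3,2)] ab(2) by simp
  then show ?thesis unfolding long_row_def using w(1) e ab(3) by auto
qed

section \<open>Schensted's first row and weakly increasing subwords\<close>

lemma knuth_step_context: "knuth_step v w \<Longrightarrow> knuth_step (a @ v @ b) (a @ w @ b)"
  unfolding knuth_step_def by (metis append.assoc)

lemma knuth_steps_context: "knuth_step\<^sup>*\<^sup>* v w \<Longrightarrow> knuth_step\<^sup>*\<^sup>* (a @ v @ b) (a @ w @ b)"
  by (induction rule: rtranclp_induct) (auto intro: rtranclp.rtrancl_into_rtrancl knuth_step_context)

lemma knuth_step_xzy: "x \<le> y \<Longrightarrow> y < z \<Longrightarrow> knuth_step [x, z, y] [z, x, y]"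
  unfolding knuth_step_def knuth_dual_words
  by (rule exI[of _ "[]"], rule exI[of _ "[x, z, y]"], rule exI[of _ "[z, x, y]"]) auto

lemma knuth_step_yzx: "x < y \<Longrightarrow> y \<le> z \<Longrightarrow> knuth_step [y, z, x] [y, x, z]"
  unfolding knuth_step_def knuth_dual_words
  by (rule exI[of _ "[]"], rule exI[of _ "[y, z, x]"], rule exI[of _ "[y, x, z]"]) auto

lemma subseq_Cons_right: "subseq u (y # ys) \<longleftrightarrow> subseq u ys \<or> (\<exists>u'. u = y # u' \<and> subseq u' ys)"
  by (subst list_emb.simps) auto

lemma subseq_append_split:
  "subseq u (xs @ ys) \<Longrightarrow> \<exists>u1 u2. u = u1 @ u2 \<and> subseq u1 xs \<and> subseq u2 ys"
proof (induction xs arbitrary: u)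
  case (Cons x xs)
  then consider "subseq u (xs @ ys)" | u' where "u = x # u'" "subseq u' (xs @ ys)"
    by (auto simp: subseq_Cons_right)
  then show ?case
  proof cases
    case 1
    then show ?thesis using Cons.IH by blast
  next
    case 2
    then obtain u1 u2 where "u' = u1 @ u2" "subseq u1 xs" "subseq u2 ys" using Cons.IH by blast
    then have "u = (x # u1) @ u2 \<and> subseq (x # u1) (x # xs) \<and> subseq u2 ys" using 2 by simp
    then show ?thesis by blast
  qed
qed auto

text \<open>Only the order of \<open>x\<close> and \<open>z\<close> changes. A subword that used
  both of them takes \<open>y\<close> in place of one, which is possible because \<open>y\<close>
  lies between them in value. The bounds allow the exchange inside a longer sorted subword.\<close>

lemma subseq_triple_exchange:
  assumes "knuth_dual (map Wait t) (map Wait t') \<or> knuth_dual (map Wait t') (map Wait t)"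
    and "subseq u t" "sorted u"
  shows "\<exists>u'. subseq u' t' \<and> sorted u' \<and> length u' = length u \<and>
    (\<forall>e. (\<forall>i\<in>set u. e \<le> i) \<longrightarrow> (\<forall>i\<in>set u'. e \<le> i)) \<and> (\<forall>e. (\<forall>i\<in>set u. i \<le> e) \<longrightarrow> (\<forall>i\<in>set u'. i \<le> e))"
proof -
  have same: ?thesis if "subseq u t'" using that assms(3) by blast
  consider x y z where "x \<le> y" "y < z" "(t, t') = ([x, z, y], [z, x, y])"
    | x y z where "x \<le> y" "y < z" "(t', t) = ([x, z, y], [z, x, y])"
    | x y z where "x < y" "y \<le> z" "(t, t') = ([y, z, x], [y, x, z])"
    | x y z where "x < y" "y \<le> z" "(t', t) = ([y, z, x], [y, x, z])"
    using assms(1) unfolding knuth_dual_words by blast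
  then show ?thesis
  proof cases
    case 1
    have "subseq u [x, z, y]" using assms(2) 1(3) by simp
    then consider "u = [x, z]" | "subseq u t'" using assms(3) 1 by (auto simp: subseq_Cons_right)
    then show ?thesis
    proof cases
      assume "u = [x, z]"
      then show ?thesis using 1 by (intro exI[of _ "[x, y]"]) auto
    qed (rule same)
  next
    case 2
    have "subseq u [z, x, y]" using assms(2) 2(3) by simp
    then have "subseq u t'" using assms(3) 2 by (auto simp: subseq_Cons_right)
    then show ?thesis by (rule same)
  next
    case 3
    have "subseq u [y, z, x]" using assms(2) 3(3) by simp
    then have "subseq u t'" using assms(3) 3 by (auto simp: subseq_Cons_right)
    then show ?thesis by (rule same)
  next
    case 4
    have "subseq u [y, x, z]" using assms(2) 4(3) by simp
    then consider "u = [x, z]" | "subseq u t'" using assms(3) 4 by (auto simp: subseq_Cons_right)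
    then show ?thesis
    proof cases
      assume "u = [x, z]"
      then show ?thesis using 4 by (intro exI[of _ "[y, z]"]) auto
    qed (rule same)
  qed
qed

lemma increasing_subseq_step:
  assumes "knuth_step v w" "subseq u v" "sorted u"
  shows "\<exists>u'. subseq u' w \<and> sorted u' \<and> length u' = length u"
proof -
  obtain a t t' b where e: "v = a @ t @ b" "w = a @ t' @ b"
    "knuth_dual (map Wait t) (map Wait t') \<or> knuth_dual (map Wait t') (map Wait t)"
    using assms(1) unfolding knuth_step_def by blast
  obtain u1 u23 where 1: "u = u1 @ u23" "subseq u1 a" "subseq u23 (t @ b)"
    using assms(2) e(1) subseq_append_split[of u a "t @ b"] by blast
  then obtain u2 u3 where 2: "u23 = u2 @ u3" "subseq u2 t" "subseq u3 b"
    using subseq_append_split[of u23 t b] by blast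
  have s: "sorted u2" using assms(3) 1 2 by (auto simp: sorted_append)
  obtain u' where u': "subseq u' t'" "sorted u'" "length u' = length u2"
    "\<forall>e. (\<forall>i\<in>set u2. e \<le> i) \<longrightarrow> (\<forall>i\<in>set u'. e \<le> i)" "\<forall>e. (\<forall>i\<in>set u2. i \<le> e) \<longrightarrow> (\<forall>i\<in>set u'. i \<le> e)"
    using subseq_triple_exchange[OF e(3) 2(2) s] by auto
  have eu: "u = u1 @ u2 @ u3" using 1 2 by simp
  have l1: "x \<le> y" if "x \<in> set u1" "y \<in> set u'" for x y
  proof -
    have "\<forall>i\<in>set u2. x \<le> i" using assms(3) that(1) unfolding eu by (simp add: sorted_append)
    then show ?thesis using u'(4) that(2) by blast
  qed
  have l2: "x \<le> y" if "x \<in> set u'" "y \<in> set u3" for x y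
  proof -
    have "\<forall>i\<in>set u2. i \<le> y" using assms(3) that(2) unfolding eu by (simp add: sorted_append)
    then show ?thesis using u'(5) that(1) by blast
  qed
  have s3: "sorted u1" "sorted u3" "\<forall>x\<in>set u1. \<forall>y\<in>set u3. x \<le> y"
    using assms(3) unfolding eu by (simp_all add: sorted_append)
  have "sorted (u1 @ u' @ u3)"
    unfolding sorted_append using l1 l2 u'(2) s3 by (metis UnE set_append)
  moreover have "subseq (u1 @ u' @ u3) w" using e 1 2 u' by (auto intro: list_emb_append_mono)
  ultimately show ?thesis using 1 2 u' by (intro exI[of _ "u1 @ u' @ u3"]) auto
qed

lemma increasing_subseq_steps:
  assumes "knuth_step\<^sup>*\<^sup>* v w" "subseq u v" "sorted u"
  shows "\<exists>u'. subseq u' w \<and> sorted u' \<and> length u' = length u"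
  using assms(1)
proof induction
  case base
  then show ?case using assms by blast
next
  case (step y z)
  then show ?case using increasing_subseq_step by metis
qed

lemma knuth_step_sym: "knuth_step v w \<Longrightarrow> knuth_step w v"
  unfolding knuth_step_def by blast

lemma knuth_steps_sym: "knuth_step\<^sup>*\<^sup>* v w \<Longrightarrow> knuth_step\<^sup>*\<^sup>* w v"
  by (induction rule: rtranclp_induct) (auto intro: converse_rtranclp_into_rtranclp knuth_step_sym)

text \<open>First half of a row insertion: \<open>x\<close> travels left until it stands behind the
  entry \<open>y\<close> that it displaces.\<close>

lemma bump_left:
  assumes "sorted (y # r)" "x < y" shows "knuth_step\<^sup>*\<^sup>* (y # r @ [x]) (y # x # r)"
  using assms(1)
proof (induction r rule: rev_induct)
  case (snoc z r)
  define y' where "y' = last (y # r)"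
  define p where "p = butlast (y # r)"
  have e: "y # r = p @ [y']" unfolding p_def y'_def by simp
  have "y' \<in> set (y # r)" unfolding y'_def by (rule last_in_set) simp
  then have "y \<le> y'" "y' \<le> z" using snoc.prems by (auto simp: sorted_append)
  then have "knuth_step (p @ [y', z, x] @ []) (p @ [y', x, z] @ [])"
    using assms(2) by (intro knuth_step_context knuth_step_yzx) auto
  then have 1: "knuth_step (y # (r @ [z]) @ [x]) ((y # r @ [x]) @ [z])" using e by (metis Cons_eq_appendI append.assoc append_Nil append_Nil2)
  have "sorted (y # r)" using snoc.prems by (auto simp: sorted_append)
  then have "knuth_step\<^sup>*\<^sup>* ([] @ (y # r @ [x]) @ [z]) ([] @ (y # x # r) @ [z])"
    using snoc.IH knuth_steps_context by blast
  then have "knuth_step\<^sup>*\<^sup>* ((y # r @ [x]) @ [z]) (y # x # r @ [z])" by simp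
  then show ?case using 1 by (rule converse_rtranclp_into_rtranclp[rotated])
qed simp

text \<open>Second half of a row insertion: the displaced \<open>y\<close> travels to the front of
  the row, ready to enter the next one.\<close>

lemma bump_front:
  assumes "sorted r" "\<forall>e\<in>set r. e \<le> x" "x < y"
  shows "knuth_step\<^sup>*\<^sup>* (r @ y # x # s) (y # r @ x # s)"
  using assms
proof (induction r arbitrary: x s rule: rev_induct)
  case (snoc e r)
  have "knuth_step (r @ [e, y, x] @ s) (r @ [y, e, x] @ s)"
    by (intro knuth_step_context knuth_step_xzy) (use snoc.prems in auto)
  moreover have "knuth_step\<^sup>*\<^sup>* (r @ y # e # (x # s)) (y # r @ e # (x # s))"
    by (rule snoc.IH) (use snoc.prems in \<open>auto simp: sorted_append\<close>)
  ultimately show ?case by (simp add: converse_rtranclp_into_rtranclp)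
qed simp

text \<open>Row insertion, letter by letter. The bound on lengths is what is wanted; it needs
  Schensted's stronger invariant that the entry number \<open>m\<close> of the row bounds from below
  the last letter of every weakly increasing subword of length \<open>m\<close>.\<close>

lemma schensted_row:
  "\<exists>a r. knuth_step\<^sup>*\<^sup>* v (a @ r) \<and> sorted r \<and>
    (\<forall>w. w \<noteq> [] \<longrightarrow> subseq w v \<longrightarrow> sorted w \<longrightarrow> length w \<le> length r \<and> r ! (length w - 1) \<le> last w)"
proof (induction v rule: rev_induct)
  case Nil
  then show ?case by (intro exI[of _ "[]"]) auto
next
  case (snoc x v)
  obtain a r where h: "knuth_step\<^sup>*\<^sup>* v (a @ r)" "sorted r"
    and inc: "\<And>w. w \<noteq> [] \<Longrightarrow> subseq w v \<Longrightarrow> sorted w \<Longrightarrow> length w \<le> length r \<and> r ! (length w - 1) \<le> last w"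
    using snoc by blast
  have vx: "knuth_step\<^sup>*\<^sup>* (v @ [x]) (a @ r @ [x])"
    using knuth_steps_context[OF h(1), of "[]" "[x]"] by simp
  have cases_w: "subseq w v \<or> (\<exists>w'. w = w' @ [x] \<and> subseq w' v)" if ws: "subseq w (v @ [x])" for w
  proof -
    obtain w1 w2 where w: "w = w1 @ w2" "subseq w1 v" "subseq w2 [x]"
      using subseq_append_split[OF ws] by blast
    have "w2 = [] \<or> w2 = [x]" using w(3) by (auto simp: subseq_Cons_right)
    then show ?thesis using w by auto
  qed
  show ?case
  proof (cases "\<forall>e\<in>set r. e \<le> x")
    case True
    have "length w \<le> length (r @ [x]) \<and> (r @ [x]) ! (length w - 1) \<le> last w"
      if w: "w \<noteq> []" "subseq w (v @ [x])" "sorted w" for w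
    proof (cases "subseq w v")
      case True
      then have "length w \<le> length r" "r ! (length w - 1) \<le> last w" using inc w by auto
      moreover have "length w - 1 < length r" using calculation(1) w(1) by (cases w) auto
      then have "(r @ [x]) ! (length w - 1) = r ! (length w - 1)" by (simp add: nth_append)
      ultimately show ?thesis by auto
    next
      case False
      then obtain w' where w': "w = w' @ [x]" "subseq w' v" using cases_w w by blast
      have "length w' \<le> length r" using inc[of w'] w' w(3) by (cases "w' = []") (auto simp: sorted_append)
      then show ?thesis using w' True by (auto simp: nth_append)
    qed
    moreover have "sorted (r @ [x])" using h(2) True by (auto simp: sorted_append)
    ultimately show ?thesis using vx by blast
  next
    case False
    \<comment> \<open>Row insertion displaces the first entry larger than \<open>x\<close>, called
      \<open>y\<close> below; \<open>r1\<close> is what stands before it.\<close>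
    define r1 where "r1 = takeWhile (\<lambda>e. e \<le> x) r"
    have "dropWhile (\<lambda>e. e \<le> x) r \<noteq> []" using False by (simp add: dropWhile_eq_Nil_conv)
    then obtain y r2 where r2: "dropWhile (\<lambda>e. e \<le> x) r = y # r2" by (cases "dropWhile (\<lambda>e. e \<le> x) r") auto
    then have xy: "x < y" using hd_dropWhile[of "\<lambda>e. e \<le> x" r] by auto
    have r: "r = r1 @ y # r2" unfolding r1_def using r2 takeWhile_dropWhile_id[of "\<lambda>e. e \<le> x" r] by simp
    have r1: "\<forall>e\<in>set r1. e \<le> x" unfolding r1_def using set_takeWhileD by fastforce
    have srt: "sorted (y # r2)" "sorted r1" using h(2) unfolding r by (auto simp: sorted_append)
    have "knuth_step\<^sup>*\<^sup>* (r1 @ (y # r2 @ [x]) @ []) (r1 @ (y # x # r2) @ [])"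
      by (rule knuth_steps_context[OF bump_left[OF srt(1) xy]])
    then have "knuth_step\<^sup>*\<^sup>* (r @ [x]) (y # r1 @ x # r2)"
      using bump_front[OF srt(2) r1 xy, of r2] r by simp
    then have "knuth_step\<^sup>*\<^sup>* (a @ (r @ [x]) @ []) (a @ (y # r1 @ x # r2) @ [])" by (rule knuth_steps_context)
    then have 1: "knuth_step\<^sup>*\<^sup>* (v @ [x]) ((a @ [y]) @ (r1 @ x # r2))" using vx by simp
    have 2: "sorted (r1 @ x # r2)" using h(2) r1 xy unfolding r by (auto simp: sorted_append)
    have le: "(r1 @ x # r2) ! i \<le> r ! i" if "i < length r" for i
      using that xy unfolding r by (auto simp: nth_append nth_Cons split: nat.split)
    have len: "length (r1 @ x # r2) = length r" unfolding r by simp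
    have "length w \<le> length (r1 @ x # r2) \<and> (r1 @ x # r2) ! (length w - 1) \<le> last w"
      if w: "w \<noteq> []" "subseq w (v @ [x])" "sorted w" for w
    proof (cases "subseq w v")
      case True
      then have a: "length w \<le> length r" "r ! (length w - 1) \<le> last w" using inc w by auto
      moreover have "length w - 1 < length r" using a(1) w(1) by (cases w) auto
      ultimately show ?thesis using le[of "length w - 1"] len by auto
    next
      case False
      then obtain w' where w': "w = w' @ [x]" "subseq w' v" using cases_w w by blast
      \<comment> \<open>A subword that \<open>x\<close> can extend ends at or below
        \<open>x\<close>. By the invariant it is no longer than the part of the row with entries at
        most \<open>x\<close>.\<close>
      have "length w' \<le> length r1"
      proof (cases "w' = []")
        case False
        have i: "length w' \<le> length r" "r ! (length w' - 1) \<le> last w'"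
          using inc[OF False w'(2)] w(3) w'(1) by (auto simp: sorted_append)
        have "last w' \<le> x" using w(3) w'(1) False by (auto simp: sorted_append)
        show ?thesis
        proof (rule ccontr)
          assume n: "\<not> length w' \<le> length r1"
          then have ii: "length r1 \<le> length w' - 1" "length w' - 1 < length r" using i(1) False by (cases w'; auto)+
          have "y \<le> r ! (length w' - 1)"
          proof -
            have "r ! length r1 = y" unfolding r by simp
            then show ?thesis using sorted_nth_mono[OF h(2) ii] by simp
          qed
          then show False using xy i(2) \<open>last w' \<le> x\<close> by simp
        qed
      qed simp
      then show ?thesis using w' r1 by (auto simp: nth_append)
    qed
    then show ?thesis using 1 2 by blast
  qed
qed

lemma subseq_sorted_lower: "subseq w s \<Longrightarrow> sorted s \<Longrightarrow> i < length w \<Longrightarrow> s ! i \<le> (w ! i :: int)"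
proof (induction arbitrary: i rule: list_emb.induct)
  case (list_emb_Cons w s y)
  show ?case
  proof (cases i)
    case 0
    have "w ! 0 \<in> set w" using list_emb_Cons.prems 0 by simp
    then have "w ! 0 \<in> set s" using list_emb_Cons.hyps by (auto elim: list_emb_set)
    then show ?thesis using list_emb_Cons.prems 0 by simp
  next
    case (Suc j)
    have "length w \<le> length s" using list_emb_Cons.hyps by (rule list_emb_length)
    then have "s ! j \<le> s ! i" using sorted_nth_mono[of s j i] list_emb_Cons.prems Suc by simp
    also have "\<dots> \<le> w ! i" using list_emb_Cons.IH list_emb_Cons.prems by simp
    finally show ?thesis using Suc by simp
  qed
next
  case (list_emb_Cons2 x y w s)
  then show ?case by (cases i) auto
qed simp

lemma subseq_sorted_upper:
  "subseq w s \<Longrightarrow> sorted s \<Longrightarrow> i < length w \<Longrightarrow> (w ! i :: int) \<le> s ! (length s - length w + i)"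
proof (induction arbitrary: i rule: list_emb.induct)
  case (list_emb_Cons w s y)
  have "length w \<le> length s" using list_emb_Cons.hyps by (rule list_emb_length)
  then have "(y # s) ! (length (y # s) - length w + i) = s ! (length s - length w + i)"
    by (simp add: Suc_diff_le)
  then show ?case using list_emb_Cons by simp
next
  case (list_emb_Cons2 x y w s)
  have l: "length w \<le> length s" using list_emb_Cons2.hyps(2) by (rule list_emb_length)
  show ?case
  proof (cases i)
    case 0
    have "(y # s) ! 0 \<le> (y # s) ! (length s - length w)"
      by (rule sorted_nth_mono) (use list_emb_Cons2.prems in auto)
    then show ?thesis using list_emb_Cons2.hyps 0 by simp
  next
    case (Suc j)
    then show ?thesis using list_emb_Cons2 l by simp
  qed
qed simp

text \<open>If \<open>s ! c \<le> r ! c\<close>, then \<open>s\<close> up to column \<open>c\<close>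
  followed by \<open>r\<close> from column \<open>c\<close> on is a weakly increasing subword, one
  letter longer than \<open>r\<close>. Conversely, Knuth moves preserve the lengths of such
  subwords, and one of that length has to pass from \<open>s\<close> to \<open>r\<close> in a column
  that violates strictness.\<close>

lemma column_strict_iff:
  assumes "sorted s" "sorted r" "length s \<le> length r"
  shows "(\<forall>c<length s. r ! c < s ! c) \<longleftrightarrow> \<not> long_row (s @ r) (Suc (length r))"
proof
  assume strict: "\<forall>c<length s. r ! c < s ! c"
  show "\<not> long_row (s @ r) (Suc (length r))"
  proof
    assume "long_row (s @ r) (Suc (length r))"
    then obtain a b where ab: "knuth_step\<^sup>*\<^sup>* (s @ r) (a @ b)" "sorted b" "length b = Suc (length r)"
      unfolding long_row_def by auto
    have "subseq b (a @ b)" by (simp add: list_emb_append2)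
    then obtain w where w: "subseq w (s @ r)" "sorted w" "length w = Suc (length r)"
      using increasing_subseq_steps[OF knuth_steps_sym[OF ab(1)]] ab by metis
    obtain w1 w2 where e: "w = w1 @ w2" "subseq w1 s" "subseq w2 r" using subseq_append_split[OF w(1)] by blast
    have l: "length w1 \<le> length s" "length w2 \<le> length r" using e by (auto dest: list_emb_length)
    have n: "length w1 + length w2 = Suc (length r)" using w(3) e(1) by simp
    \<comment> \<open>The lengths add up to \<open>Suc (length r)\<close>, so the last letter of
      \<open>w1\<close> is at least \<open>s ! i\<close> and the first letter of \<open>w2\<close>
      at most \<open>r ! i\<close>, in the same column.\<close>
    define i where "i = length w1 - 1"
    have i: "i < length w1" "i < length s" "length r - length w2 = i" "0 < length w2"
      unfolding i_def using l n assms(3) by auto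
    have "w2 ! 0 \<le> r ! i" using subseq_sorted_upper[OF e(3) assms(2) i(4)] i(3) by simp
    also have "\<dots> < s ! i" using strict i by simp
    also have "\<dots> \<le> w1 ! i" by (rule subseq_sorted_lower[OF e(2) assms(1) i(1)])
    also have "\<dots> \<le> w2 ! 0" using w(2) i unfolding e by (auto simp: sorted_append)
    finally show False by simp
  qed
next
  assume nl: "\<not> long_row (s @ r) (Suc (length r))"
  show "\<forall>c<length s. r ! c < s ! c"
  proof (rule ccontr)
    assume "\<not> (\<forall>c<length s. r ! c < s ! c)"
    then obtain c where c: "c < length s" "s ! c \<le> r ! c" by (auto simp: not_less)
    define w where "w = take (Suc c) s @ drop c r"
    have "x \<le> y" if "x \<in> set (take (Suc c) s)" "y \<in> set (drop c r)" for x y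
    proof -
      obtain i where i: "i \<le> c" "x = s ! i" using \<open>x \<in> _\<close> c
        by (auto simp: in_set_conv_nth less_Suc_eq_le)
      obtain j where "j < length (drop c r)" "drop c r ! j = y"
        using \<open>y \<in> _\<close> by (metis in_set_conv_nth)
      then have j: "j + c < length r" "y = r ! (j + c)" by (auto simp: add.commute)
      have "s ! i \<le> s ! c" "r ! c \<le> r ! (j + c)" using assms i j c by (auto intro: sorted_nth_mono)
      then show ?thesis using i j c by simp
    qed
    then have "sorted w" unfolding w_def using assms by (auto simp: sorted_append sorted_wrt_take sorted_wrt_drop)
    moreover have "subseq w (s @ r)" unfolding w_def
      by (intro list_emb_append_mono sublist_imp_subseq) auto
    moreover have lw: "length w = Suc (length r)" "w \<noteq> []" unfolding w_def using c assms(3) by auto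
    moreover obtain a b where ab: "knuth_step\<^sup>*\<^sup>* (s @ r) (a @ b)" "sorted b"
      "\<forall>w. w \<noteq> [] \<longrightarrow> subseq w (s @ r) \<longrightarrow> sorted w \<longrightarrow> length w \<le> length b \<and> b ! (length w - 1) \<le> last w"
      using schensted_row by blast
    ultimately have "Suc (length r) \<le> length b" by metis
    define k where "k = length b - Suc (length r)"
    have "a @ b = (a @ take k b) @ drop k b" by simp
    moreover have "sorted (drop k b)" "length (drop k b) = Suc (length r)"
      using ab(2) \<open>Suc (length r) \<le> length b\<close> unfolding k_def by (auto simp: sorted_wrt_drop)
    ultimately have "long_row (s @ r) (Suc (length r))" using ab(1) unfolding long_row_def by metis
    then show False using nl by simp
  qed
qed

section \<open>Tableau words with a common chain\<close>

lemma segment_transfer: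
  assumes v: "base f xs (A @ t @ B)" "mthru f xs (map Wait (A @ t @ B)) ys C"
    and v': "base f' xs' (A' @ t' @ B')" "mthru f' xs' (map Wait (A' @ t' @ B')) ys' C"
    and l: "length A = length A'" "length t = length t'"
  shows "sorted t \<longleftrightarrow> sorted t'" "long_row t m \<longleftrightarrow> long_row t' m"
proof -
  obtain xs1 C1 C23 where 1: "C = C1 @ C23" "mthru f xs1 (map Wait (t @ B)) ys C23"
    "base f xs1 (t @ B)" "length C1 = length A"
    using word_split[OF v] by metis
  obtain xs2 C2 C3 where 2: "C23 = C2 @ C3" "mthru f xs1 (map Wait t) xs2 C2" "base f xs1 t" "length C2 = length t"
    using word_split[OF 1(3,2)] by metis
  obtain ys1 E1 E23 where 3: "C = E1 @ E23" "mthru f' ys1 (map Wait (t' @ B')) ys' E23"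
    "base f' ys1 (t' @ B')" "length E1 = length A'"
    using word_split[OF v'] by metis
  obtain ys2 E2 E3 where 4: "E23 = E2 @ E3" "mthru f' ys1 (map Wait t') ys2 E2" "base f' ys1 t'" "length E2 = length t'"
    using word_split[OF 3(3,2)] by metis
  have "E23 = C23" using 1 3 l by auto
  then have "E2 = C2" using 2 4 l by auto
  then have m: "mthru f' ys1 (map Wait t') ys2 C2" using 4(2) by simp
  show "sorted t \<longleftrightarrow> sorted t'" using base_sorted[OF 2(3,2)] base_sorted[OF 4(3) m] by simp
  show "long_row t m \<longleftrightarrow> long_row t' m"
    using long_row_transfer[OF 2(3,2) 4(3) m] long_row_transfer[OF 4(3) m 2(3,2)] by blast
qed

lemma cut_like: "length v = length (concat L) \<Longrightarrow> \<exists>L'. concat L' = v \<and> map length L' = map length L"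
proof (induction L arbitrary: v)
  case (Cons l L)
  then have "length (drop (length l) v) = length (concat L)" by simp
  then obtain L' where "concat L' = drop (length l) v" "map length L' = map length L" using Cons.IH by blast
  then have "concat (take (length l) v # L') = v \<and> map length (take (length l) v # L') = map length (l # L)"
    using Cons.prems by simp
  then show ?case by blast
qed auto

lemma rows_split:
  assumes "r < length Y"
  shows "reading_word Y = concat (rev (drop (Suc r) Y)) @ Y ! r @ concat (rev (take r Y))"
  unfolding reading_word_def by (subst id_take_nth_drop[OF assms]) simp

lemma two_rows_split:
  assumes "Suc r < length Y"
  shows "reading_word Y = concat (rev (drop (r + 2) Y)) @ (Y ! Suc r @ Y ! r) @ concat (rev (take r Y))"
proof -
  have "drop (Suc r) Y = Y ! Suc r # drop (r + 2) Y" using Cons_nth_drop_Suc[OF assms] by simp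
  then show ?thesis using rows_split[of r Y] assms by simp
qed

lemma length_concat_rev_drop: "length (concat (rev (drop k Y))) = sum_list (drop k (map length Y))"
proof -
  have "length (concat (rev X)) = sum_list (map length X)" for X :: "'a list list"
    by (induction X) auto
  then show ?thesis by (simp only: drop_map)
qed

text \<open>Every condition on a tableau concerns one row or two adjacent rows, that is, one segment
  of the reading word. Cutting \<open>v'\<close> at the same places, each condition is visible in
  the corresponding segment of the chain.\<close>

lemma ssyt_transfer:
  assumes mu: "\<mu> \<in> partitions_n n" and Y: "Y \<in> ssyt n \<mu>"
    and v: "base f xs (reading_word Y)" "mthru f xs (map Wait (reading_word Y)) ys C"
    and v': "base f' xs' v'" "mthru f' xs' (map Wait v') ys' C" "set v' \<subseteq> {1..n}"
  shows "\<exists>Y'\<in>ssyt n \<mu>. reading_word Y' = v'"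
proof -
  have lens: "map length Y = \<mu>" using Y unfolding ssyt_def by auto
  have "length v' = length (concat (rev Y))"
    using mthru_length[OF v(2)] mthru_length[OF v'(2)] by (simp add: reading_word_def)
  then obtain L' where L': "concat L' = v'" "map length L' = map length (rev Y)" using cut_like by blast
  define Y' where "Y' = rev L'"
  have r': "reading_word Y' = v'" unfolding Y'_def reading_word_def using L' by simp
  have lens': "map length Y' = \<mu>" unfolding Y'_def using L'(2) lens by (simp add: rev_map[symmetric])
  have ll: "length Y' = length Y" using lens lens' by (metis length_map)
  have row_len: "length (Y' ! r) = length (Y ! r)" if "r < length Y" for r
    using lens lens' that ll by (metis nth_map)
  have seg: "length (concat (rev (drop k Y))) = length (concat (rev (drop k Y')))" for k
    unfolding length_concat_rev_drop lens lens' ..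
  have srt: "sorted (Y' ! r)" if r: "r < length Y" for r
  proof -
    have "sorted (Y ! r)" using Y r unfolding ssyt_def by auto
    moreover have e: "v' = concat (rev (drop (Suc r) Y')) @ Y' ! r @ concat (rev (take r Y'))"
      using rows_split[of r Y'] r r' ll by simp
    ultimately show ?thesis
      using segment_transfer(1)[OF v[unfolded rows_split[OF r]] v'(1,2)[unfolded e] seg] row_len[OF r] by simp
  qed
  have strict: "Y' ! r ! c < Y' ! Suc r ! c" if r: "Suc r < length Y'" and c: "c < length (Y' ! Suc r)" for r c
  proof -
    have r2: "Suc r < length Y" using r ll by simp
    have len: "length (Y ! Suc r) \<le> length (Y ! r)"
    proof -
      have "sorted_wrt (\<ge>) \<mu>" using mu unfolding partitions_n_def by auto
      then have "\<mu> ! r \<ge> \<mu> ! Suc r" using r2 lens by (auto simp: sorted_wrt_iff_nth_less)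
      then show ?thesis using r2 lens by auto
    qed
    have s: "sorted (Y ! r)" "sorted (Y ! Suc r)" using Y r2 unfolding ssyt_def by auto
    have "\<forall>c<length (Y ! Suc r). Y ! r ! c < Y ! Suc r ! c" using Y r2 unfolding ssyt_def by auto
    then have "\<not> long_row (Y ! Suc r @ Y ! r) (Suc (length (Y ! r)))"
      using column_strict_iff[OF s(2,1) len] by simp
    moreover have e: "v' = concat (rev (drop (r + 2) Y')) @ (Y' ! Suc r @ Y' ! r) @ concat (rev (take r Y'))"
      using two_rows_split[OF r] r' by simp
    moreover have "length (Y ! Suc r @ Y ! r) = length (Y' ! Suc r @ Y' ! r)"
      using row_len r2 by simp
    ultimately have "\<not> long_row (Y' ! Suc r @ Y' ! r) (Suc (length (Y ! r)))"
      using segment_transfer(2)[OF v[unfolded two_rows_split[OF r2]] v'(1,2)[unfolded e] seg] by simp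
    then have "\<forall>c<length (Y' ! Suc r). Y' ! r ! c < Y' ! Suc r ! c"
      using column_strict_iff[OF srt[OF r2] srt[OF Suc_lessD[OF r2]]] row_len[OF r2]
        row_len[OF Suc_lessD[OF r2]] len by simp
    then show ?thesis using c by simp
  qed
  have "set row \<subseteq> {1..n} \<and> sorted row" if row: "row \<in> set Y'" for row
  proof -
    have "set (reading_word Y') = \<Union> (set ` set Y')" unfolding reading_word_def by simp
    then have "set row \<subseteq> set v'" using row unfolding r' by blast
    then have "set row \<subseteq> {1..n}" using v'(3) by (rule order_trans)
    moreover obtain r where r: "r < length Y'" "row = Y' ! r" using row unfolding in_set_conv_nth by blast
    have "sorted row" unfolding r(2) by (rule srt) (use r(1) ll in simp)
    ultimately show ?thesis by blast
  qed
  then have "Y' \<in> ssyt n \<mu>" unfolding ssyt_def using lens' strict by blast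
  then show ?thesis using r' by blast
qed

lemma reading_word_inj:
  assumes "reading_word Y = reading_word Y'" "map length Y = map length Y'" shows "Y = Y'"
proof -
  have l: "length (rev Y) = length (rev Y')" using assms(2) by (metis length_map length_rev)
  have "map length (rev Y) = map length (rev Y')" using assms(2) by (simp add: rev_map[symmetric])
  then have "\<forall>(x, y)\<in>set (zip (rev Y) (rev Y')). length x = length y"
    using l by (auto simp: set_zip list_eq_iff_nth_eq)
  then have "rev Y = rev Y'" using concat_injective[of "rev Y" "rev Y'"] assms(1) l
    unfolding reading_word_def by blast
  then show ?thesis by simp
qed

section \<open>Words of diagrams and reversal of the insertion\<close>

definition ground :: "int \<Rightarrow> int" where
  "ground r = r"

text \<open>
  \<open>row_word xs k b\<close>: the word \<open>xs\<close> lists a valid diagram row by row up to somewhere in row \<open>k\<close>, and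
  the next crossing of that row has to stand to the right of position \<open>b\<close>.
\<close>

inductive row_word :: "item list \<Rightarrow> int \<Rightarrow> int \<Rightarrow> bool" where
  rw_Nil: "row_word [] 1 1"
| rw_Cross: "row_word xs k b \<Longrightarrow> j < b \<Longrightarrow> ascent (run ground xs) j \<Longrightarrow> row_word (xs @ [Cross k j]) k j"
| rw_End: "row_word xs k b \<Longrightarrow> row_word (xs @ [End k]) (k + 1) (k + 1)"

lemma row_word_good: "row_word xs k b \<Longrightarrow> good ground xs"
  by (induction rule: row_word.induct) auto

lemma row_word_bounds: "row_word xs k b \<Longrightarrow> b \<le> k \<and> 1 \<le> k"
  by (induction rule: row_word.induct) auto

lemma row_word_ends: "row_word xs k b \<Longrightarrow> sorted_wrt (<) (ends xs) \<and> set (ends xs) = {1..<k}"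
proof (induction rule: row_word.induct)
  case (rw_End xs k b)
  have "{1..<k + 1} = insert k {1..<k}" using row_word_bounds[OF rw_End(1)] by auto
  then show ?case using rw_End(2) by (simp add: sorted_wrt_append)
qed auto

lemma row_word_fix: "row_word xs k b \<Longrightarrow> k < r \<Longrightarrow> run ground xs r = r"
proof (induction rule: row_word.induct)
  case (rw_Cross xs k b j)
  then show ?case using row_word_bounds[OF rw_Cross(1)] by (simp add: transpose_def)
qed (auto simp: ground_def)

lemma tame_ground: "tame ground"
  unfolding tame_def ground_def by (intro exI[of _ 0]) auto

text \<open>Bumped crossings move left and must not reach the crossing before them in the row. That
  one stands at \<open>b\<close>, where the new state has a particle, and no search for an open
  space passes a particle. As crossings move only left, \<open>b0 \<le> b\<close>, and a crossing
  that passes keeps its room.\<close>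

lemma row_word_thru:
  assumes "row_word xs k b0" "thru ground xs (Wait x) ys t"
  shows "\<exists>b. row_word ys k b \<and> b0 \<le> b \<and> 0 < act (run ground xs) t b \<and>
    (\<forall>p q. t = Jump p q \<longrightarrow> p \<noteq> b \<and> p \<le> k)"
  using assms
proof (induction arbitrary: ys t rule: row_word.induct)
  case rw_Nil
  then show ?case using row_word.rw_Nil by (intro exI[of _ 1]) (auto simp: ground_def)
next
  case (rw_Cross xs k b0 j)
  obtain Y s y2 where h: "thru ground xs (Wait x) Y s" "istep (run ground xs) (Cross k j) s y2 t" "ys = Y @ y2"
    using rw_Cross.prems by (auto simp: thru_append)
  obtain b where b: "row_word Y k b" "b0 \<le> b" "0 < act (run ground xs) s b"
    "\<And>p q. s = Jump p q \<Longrightarrow> p \<noteq> b \<and> p \<le> k" using rw_Cross.IH[OF h(1)] by auto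
  define f where "f = run ground xs"
  have asc: "ascent f j" using rw_Cross.hyps unfolding f_def by simp
  have g: "run ground Y = act f s" using thru_state[OF h(1)] unfolding f_def by simp
  have jb: "j < b" "b \<le> k" using b rw_Cross.hyps row_word_bounds by auto
  show ?case
  proof (cases s)
    case [simp]: (Wait y)
    have e: "y2 = [Cross k j]" "t = Wait y" using h(2) by auto
    have "row_word (Y @ [Cross k j]) k j"
      by (rule row_word.rw_Cross[OF b(1) jb(1)]) (use asc g in simp)
    moreover have "0 < (f \<circ> sw j) j" using asc unfolding ascent_def by simp
    ultimately show ?thesis using e h(3) unfolding f_def by (intro exI[of _ j]) auto
  next
    case [simp]: (Jump p q)
    obtain j' p' q' where c: "cstep f j p q j' p' q'" "y2 = [Cross k j']" "t = Jump p' q'"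
      using h(2) unfolding f_def by auto
    have J: "jump f p q" using thru_ok[OF h(1) row_word_good[OF rw_Cross.hyps(1)]] unfolding f_def by simp
    have asc': "ascent (f \<circ> transpose p q) j'" using cstep_jump[OF J asc c(1)] by simp
    have pb: "p \<noteq> b" "p \<le> k" using b(4) by auto
    have qp: "q < p" using J unfolding jump_def by auto
    have "j' < b \<and> j \<le> j' \<and> p' \<noteq> j' \<and> p' \<le> k"
    proof (cases "p = j + 1 \<and> q = j")
      case True
      then have no: "next_open (f \<circ> sw j) j j'" "p' = j' + 1" using c(1) unfolding cstep_def by auto
      have "f \<circ> transpose p q = f \<circ> sw j" using True by (simp add: transpose_adjacent)
      then have "0 < (f \<circ> sw j) b" using b(3) unfolding f_def by simp
      then have "j' < b" using no(1) jb(1) unfolding next_open_def by (meson leI not_le)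
      then show ?thesis using no jb unfolding next_open_def by auto
    next
      case False
      then have e: "j' = j" "p' = sw j p" using c(1) unfolding cstep_def by auto
      have "p \<noteq> j + 1"
      proof
        assume p: "p = j + 1"
        then have "q < j" using False qp by auto
        then show False using J asc p unfolding jump_def ascent_def by auto
      qed
      then show ?thesis using e jb pb by (auto simp: transpose_def)
    qed
    then have j': "j' < b" "j \<le> j'" "p' \<noteq> j'" "p' \<le> k" by auto
    have "row_word (Y @ [Cross k j']) k j'"
      by (rule row_word.rw_Cross[OF b(1) j'(1)]) (use asc' g in simp)
    moreover have "0 < act (f \<circ> sw j) t j'"
      using asc' fun_cong[OF cstep_state[OF c(1)], of j'] c(3) unfolding ascent_def by simp
    ultimately show ?thesis using c h(3) j' unfolding f_def by (intro exI[of _ j']) auto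
  qed
next
  case (rw_End xs k b0)
  obtain Y s y2 where h: "thru ground xs (Wait x) Y s" "istep (run ground xs) (End k) s y2 t" "ys = Y @ y2"
    using rw_End.prems by (auto simp: thru_append)
  obtain b where b: "row_word Y k b" "b0 \<le> b" "0 < act (run ground xs) s b"
    "\<And>p q. s = Jump p q \<Longrightarrow> p \<noteq> b \<and> p \<le> k" using rw_End.IH[OF h(1)] by auto
  define f where "f = run ground xs"
  have g: "run ground Y = act f s" using thru_state[OF h(1)] unfolding f_def by simp
  have fk: "0 < f (k + 1)" using row_word_fix[OF rw_End.hyps, of "k + 1"] row_word_bounds[OF rw_End.hyps]
    unfolding f_def by simp
  have bk: "b \<le> k" using row_word_bounds[OF b(1)] by simp
  show ?case
  proof (cases s)
    case [simp]: (Jump p q)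
    have J: "jump f p q" using thru_ok[OF h(1) row_word_good[OF rw_End.hyps(1)]] unfolding f_def by simp
    then have "q < p" unfolding jump_def by auto
    moreover have "p \<le> k" using b(4) by auto
    ultimately show ?thesis using h(2,3) row_word.rw_End[OF b(1)] fk unfolding f_def
      by (intro exI[of _ "k + 1"]) (auto simp: transpose_def row_word_bounds[OF rw_End.hyps])
  next
    case [simp]: (Wait y)
    show ?thesis
    proof (cases "y = k")
      case False
      then show ?thesis using h(2,3) row_word.rw_End[OF b(1)] fk row_word_bounds[OF rw_End.hyps]
        unfolding f_def by (intro exI[of _ "k + 1"]) auto
    next
      case True
      then obtain j where j: "rightmost f j" "y2 = [Cross k j, End k]" "t = Jump (j + 1) j"
        using h(2) unfolding f_def by auto
      have "0 < f b" using b(3) unfolding f_def by simp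
      then have jb: "j < b" using j(1) unfolding rightmost_def by (meson leI not_le)
      have "row_word (Y @ [Cross k j]) k j"
        by (rule row_word.rw_Cross[OF b(1) jb]) (use rightmost_jump[OF j(1)] g in simp)
      then have "row_word (Y @ [Cross k j, End k]) (k + 1) (k + 1)" using row_word.rw_End by fastforce
      then show ?thesis using j h(3) fk jb bk row_word_bounds[OF rw_End.hyps] unfolding f_def
        by (intro exI[of _ "k + 1"]) (auto simp: transpose_def)
    qed
  qed
qed

lemma thru_snoc:
  assumes "thru f xs s ys t" "istep (run f xs) x t zs u" shows "thru f (xs @ [x]) s (ys @ zs) u"
proof -
  have "thru (run f xs) [x] t zs u" using assms(2) by simp
  then show ?thesis unfolding thru_append using assms(1) by blast
qed

text \<open>Undoes a pass: the jump behind the crossing at \<open>j\<close> of the new diagram is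
  pulled back in front of it. The ascent in the new diagram excludes \<open>p = j\<close> and
  \<open>q = j\<close>, the ends at which a label could slip into the span.\<close>

lemma cstep_back:
  assumes J: "jump f' p q" and g: "g = f' \<circ> transpose p q \<circ> sw j" and asc: "ascent g j"
    and n: "\<not> (p = j + 1 \<and> q = j)"
  shows "jump (f' \<circ> sw j) (sw j p) (sw j q)" "ascent (f' \<circ> sw j) j"
proof -
  have a: "q < p" "0 < f' p" "f' q \<le> 0" and b: "\<And>r. q < r \<Longrightarrow> r < p \<Longrightarrow> f' p < f' r"
    using J unfolding jump_def by auto
  have c: "f' (transpose p q (j + 1)) < f' (transpose p q j)" "0 < f' (transpose p q j)"
    using asc unfolding ascent_def g by auto
  have p: "p \<noteq> j" using c a by auto
  have q: "q \<noteq> j"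
  proof
    assume q: "q = j"
    then have "f' (j + 1) < f' p" using c n by (simp add: transpose_def)
    moreover have "j + 1 < p" using q a n by auto
    ultimately show False using b[of "j + 1"] q by auto
  qed
  have up: "f' p < f' j" if "q = j + 1" using c p q that by (simp add: transpose_def)
  show "ascent (f' \<circ> sw j) j"
  proof -
    consider "q = j + 1" | "p = j + 1" | "q \<noteq> j + 1" "p \<noteq> j + 1" by auto
    then show ?thesis
    proof cases
      case 1
      then show ?thesis using up a unfolding ascent_def by auto
    next
      case 2
      then show ?thesis using b[of j] q a unfolding ascent_def by auto
    next
      case 3
      then show ?thesis using c p q unfolding ascent_def by (simp add: transpose_def)
    qed
  qed
  have "f' p < (f' \<circ> sw j) r" if r: "sw j q < r" "r < sw j p" for r
  proof -
    consider "r = j" | "r = j + 1" | "r \<noteq> j" "r \<noteq> j + 1" by auto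
    then show ?thesis
    proof cases
      case 1
      then have "q < j" "j + 1 < p" using r p q by (auto simp: transpose_def split: if_splits)
      then show ?thesis using 1 b[of "j + 1"] by simp
    next
      case 2
      then have "j + 1 < p" using r p by (auto simp: transpose_def split: if_splits)
      moreover have "q = j + 1 \<or> q < j" using 2 r q by (auto simp: transpose_def split: if_splits)
      ultimately show ?thesis using 2 b[of j] up by auto
    next
      case 3
      then have "q < r" "r < p" using r by (auto simp: transpose_def split: if_splits)
      then show ?thesis using 3 b[of r] by simp
    qed
  qed
  moreover have "sw j q < sw j p" using a p q n by (auto simp: transpose_def)
  ultimately show "jump (f' \<circ> sw j) (sw j p) (sw j q)" using a unfolding jump_def by simp
qed

lemma greatest_red:
  assumes "\<exists>r<j. 0 < (g :: int \<Rightarrow> int) r"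
  obtains m where "m < j" "0 < g m" "\<And>r. m < r \<Longrightarrow> r < j \<Longrightarrow> g r \<le> 0"
proof -
  define h where "h r = g (- r)" for r
  obtain r where "r < j" "0 < g r" using assms by blast
  then have "\<exists>r>- j. 0 < h r" by (intro exI[of _ "- r"]) (simp add: h_def)
  then obtain m where m: "- j < m" "0 < h m" "\<And>r. - j < r \<Longrightarrow> r < m \<Longrightarrow> h r \<le> 0"
    using least_red by blast
  show ?thesis
  proof (rule that[of "- m"])
    show "g r \<le> 0" if "- m < r" "r < j" for r using m(3)[of "- r"] that by (simp add: h_def)
  qed (use m in \<open>simp_all add: h_def\<close>)
qed

lemma row_word_last_Cross: "row_word (ys @ [Cross k' j]) k b \<Longrightarrow> k' = k \<and> b = j \<and> (\<exists>b'. row_word ys k b' \<and> j < b')"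
  by (cases "ys @ [Cross k' j]" k b rule: row_word.cases) auto

text \<open>The new word is read backwards. A last crossing different from the jump was passed. One
  that equals the jump was bumped from the nearest particle on its right, or is fresh if there is
  none. The second alternative covers a fresh crossing whose \<open>End k\<close> is still unread.
  The clause on \<open>b0\<close> describes the last crossing before its bump: the way from
  \<open>b0\<close> to \<open>b\<close> was over holes, so no later crossing has its larger label
  there.\<close>

lemma thru_surjective:
  assumes "row_word ys k b" "jump (run ground ys \<circ> transpose p q) p q"
  shows "(\<exists>xs x b0. thru ground xs (Wait x) ys (Jump p q) \<and> row_word xs k b0 \<and> x \<in> set (ends xs) \<and>
      (b0 = b \<or> p = b + 1 \<and> q = b \<and> b0 < b \<and> (\<forall>r. b0 < r \<longrightarrow> r \<le> b \<longrightarrow> run ground xs r \<le> 0)))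
    \<or> (\<exists>Y. ys = Y @ [Cross k q] \<and> p = q + 1 \<and> rightmost (run ground Y) q)"
  using assms
proof (induction arbitrary: p q rule: row_word.induct)
  case rw_Nil
  then show ?case by (auto simp: jump_def ground_def)
next
  case (rw_Cross Y k b j)
  define g where "g = run ground Y"
  define f' where "f' = g \<circ> sw j \<circ> transpose p q"
  have "run ground (Y @ [Cross k j]) = g \<circ> sw j" unfolding g_def by simp
  then have J: "jump f' p q" using rw_Cross.prems unfolding f'_def by metis
  have asc: "ascent g j" using rw_Cross.hyps unfolding g_def by simp
  show ?case
  proof (cases "p = j + 1 \<and> q = j")
    case True
    have "f' = g" unfolding f'_def using True by (simp add: transpose_adjacent comp_assoc)
    then have gj: "0 < g (j + 1)" "g j \<le> 0" using J True unfolding jump_def by auto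
    show ?thesis
    proof (cases "\<exists>r<j. 0 < g r")
      case False
      then have "g r \<le> 0" if "r \<le> j" for r using that gj(2) False by (metis leI le_less)
      then have "rightmost g j" unfolding rightmost_def using gj by blast
      then show ?thesis using True unfolding g_def by auto
    next
      case ex: True
      \<comment> \<open>The nearest particle to the right stands where the crossing was before the
        bump.\<close>
      obtain i where i: "i < j" "0 < g i" "\<And>r. i < r \<Longrightarrow> r < j \<Longrightarrow> g r \<le> 0" using greatest_red[OF ex] by blast
      have hole: "g r \<le> 0" if "i < r" "r \<le> j" for r using i(3)[of r] gj that by (cases "r = j") auto
      have J': "jump (g \<circ> transpose (i + 1) i) (i + 1) i" using hole[of "i + 1"] i unfolding jump_def by auto
      then consider xs x b0 where "thru ground xs (Wait x) Y (Jump (i + 1) i)" "row_word xs k b0" "x \<in> set (ends xs)"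
          "b0 = b \<or> i = b"
        | Y' where "Y = Y' @ [Cross k i]"
        using rw_Cross.IH[OF J'[unfolded g_def]] by blast
      then show ?thesis
      proof cases
        case 1
        have b0: "i < b0" using 1(4) i rw_Cross.hyps by auto
        define f where "f = run ground xs"
        have gf: "g = f \<circ> sw i" using thru_state[OF 1(1)] unfolding f_def g_def by (simp add: transpose_adjacent)
        have fg: "f = g \<circ> sw i" unfolding gf by (simp add: comp_assoc)
        have fi: "f i = g (i + 1)" "f (i + 1) = g i" unfolding fg by auto
        have "ascent f i" unfolding ascent_def using fi i hole[of "i + 1"] by auto
        then have "row_word (xs @ [Cross k i]) k i" using row_word.rw_Cross[OF 1(2) b0] unfolding f_def by simp
        moreover have "cstep f i (i + 1) i j (j + 1) j"
          unfolding cstep_def using gf gj i hole by (auto simp: next_open_def)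
        then have "thru ground (xs @ [Cross k i]) (Wait x) (Y @ [Cross k j]) (Jump p q)"
          using thru_snoc[OF 1(1), of "Cross k i" "[Cross k j]" "Jump p q"] True unfolding f_def by simp
        moreover have "run ground (xs @ [Cross k i]) r \<le> 0" if "i < r" "r \<le> j" for r
          using hole[OF that] gf unfolding f_def by simp
        ultimately show ?thesis using True i(1) 1(3) by fastforce
      next
        case 2
        then have "b = i" using row_word_last_Cross rw_Cross.hyps(1) by blast
        then show ?thesis using i rw_Cross.hyps by auto
      qed
    qed
  next
    case False
    have gf': "g = f' \<circ> transpose p q \<circ> sw j" unfolding f'_def by (simp add: comp_assoc)
    note bk = cstep_back[OF J gf' asc False]
    define p0 q0 where "p0 = sw j p" and "q0 = sw j q"
    have ff: "f' \<circ> sw j = g \<circ> transpose p0 q0" unfolding gf' p0_def q0_def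
      by (auto simp: fun_eq_iff transpose_def)
    have J0: "jump (g \<circ> transpose p0 q0) p0 q0" using bk(1) unfolding ff p0_def q0_def by simp
    have swsw: "sw j p0 = p" "sw j q0 = q" unfolding p0_def q0_def by auto
    have qp: "q < p" using J unfolding jump_def by auto
    consider xs x b0 where "thru ground xs (Wait x) Y (Jump p0 q0)" "row_word xs k b0" "x \<in> set (ends xs)"
        "b0 = b \<or> b0 < b \<and> (\<forall>r. b0 < r \<longrightarrow> r \<le> b \<longrightarrow> run ground xs r \<le> 0)"
      | Y' where "Y = Y' @ [Cross k q0]" "p0 = q0 + 1" "rightmost (run ground Y') q0"
      using rw_Cross.IH[OF J0[unfolded g_def]] by blast
    then show ?thesis
    proof cases
      case 1
      define f where "f = run ground xs"
      have "g = f \<circ> transpose p0 q0" using thru_state[OF 1(1)] unfolding f_def g_def by simp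
      then have fe: "f = f' \<circ> sw j" unfolding ff by (simp add: comp_assoc)
      have asf: "ascent f j" using bk(2) fe by simp
      have "j < b0"
      proof (rule ccontr)
        assume n: "\<not> j < b0"
        then have "f (j + 1) \<le> 0" using 1(4) rw_Cross.hyps unfolding f_def by auto
        then show False using asf unfolding ascent_def by auto
      qed
      then have "row_word (xs @ [Cross k j]) k j"
        using row_word.rw_Cross[OF 1(2)] asf unfolding f_def by simp
      moreover have "cstep f j p0 q0 j p q"
        using qp swsw by (subst cstep_pass) (auto simp: p0_def q0_def transpose_def split: if_splits)
      then have "thru ground (xs @ [Cross k j]) (Wait x) (Y @ [Cross k j]) (Jump p q)"
        using thru_snoc[OF 1(1), of "Cross k j" "[Cross k j]" "Jump p q"] unfolding f_def by simp
      ultimately show ?thesis using 1(3) by fastforce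
    next
      case 2
      \<comment> \<open>This cannot occur: right of a fresh crossing there are only holes, so the
        next crossing of the row would have to involve its particle, and the jump behind it would
        span a hole.\<close>
      have "b = q0" using row_word_last_Cross 2(1) rw_Cross.hyps(1) by blast
      then have jq: "j < q0" using rw_Cross.hyps by simp
      have g: "g = run ground Y' \<circ> sw q0" unfolding g_def 2(1) by simp
      have low: "g r \<le> 0" if "r < q0" for r
        using that 2(3) unfolding g rightmost_def by (simp add: transpose_def)
      have "\<not> j + 1 < q0" using low[of "j + 1"] asc unfolding ascent_def by auto
      then have q0: "q0 = j + 1" using jq by simp
      then have "q = j" "p = j + 2" using swsw 2(2) by (auto simp: transpose_def)
      then have "f' (j + 1) > 0" using J unfolding jump_def by (auto intro: less_trans)
      moreover have "f' (j + 1) = g j" unfolding f'_def using \<open>q = j\<close> \<open>p = j + 2\<close> by (simp add: transpose_def)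
      ultimately show ?thesis using low[of j] jq by simp
    qed
  qed
next
  case (rw_End Y k b)
  have "jump (run ground Y \<circ> transpose p q) p q" using rw_End.prems unfolding run_simps apply_item.simps .
  then consider xs x b0 where "thru ground xs (Wait x) Y (Jump p q)" "row_word xs k b0" "x \<in> set (ends xs)"
    | Y' where "Y = Y' @ [Cross k q]" "p = q + 1" "rightmost (run ground Y') q"
    using rw_End.IH by blast
  then show ?case
  proof cases
    case 1
    have "thru ground (xs @ [End k]) (Wait x) (Y @ [End k]) (Jump p q)"
      using thru_snoc[OF 1(1), of "End k" "[End k]" "Jump p q"] by simp
    then show ?thesis using row_word.rw_End[OF 1(2)] 1(3) by fastforce
  next
    case 2
    obtain b' where b': "row_word Y' k b'" using row_word_last_Cross 2(1) rw_End.hyps by blast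
    have nin: "k \<notin> set (ends Y')" using row_word_ends[OF b'] by auto
    have wait: "thru f zs (Wait k) zs (Wait k)" if "k \<notin> set (ends zs)" for f zs
      using that
    proof (induction zs arbitrary: f)
      case (Cons z zs)
      then show ?case by (cases z) auto
    qed simp
    have "thru ground (Y' @ [End k]) (Wait k) (Y @ [End k]) (Jump p q)"
      using thru_snoc[OF wait[OF nin, of ground], of "End k" "[Cross k q, End k]" "Jump p q"] 2 by simp
    then show ?thesis using row_word.rw_End[OF b'] by fastforce
  qed
qed

text \<open>Both histories are recovered from the end. A bump to a given place comes from the
  nearest particle on the right, and a fresh start requires that there is none, so the histories
  cannot part.\<close>

lemma thru_injective:
  assumes "row_word xs k b" "row_word xs' k' b'"
    "thru ground xs (Wait x) ys (Jump p q)" "thru ground xs' (Wait x') ys (Jump p q)"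
  shows "xs = xs' \<and> x = x'"
  using assms
proof (induction arbitrary: xs' k' b' ys p q rule: row_word.induct)
  case rw_Nil
  then show ?case by simp
next
  case (rw_Cross X k b j)
  obtain Y p0 q0 j' where 1: "thru ground X (Wait x) Y (Jump p0 q0)" "cstep (run ground X) j p0 q0 j' p q"
    "ys = Y @ [Cross k j']"
  proof -
    obtain Y s y2 where h: "thru ground X (Wait x) Y s" "istep (run ground X) (Cross k j) s y2 (Jump p q)" "ys = Y @ y2"
      using rw_Cross.prems(2) by (auto simp: thru_append)
    then show ?thesis using that by (cases s) auto
  qed
  from rw_Cross.prems(1) show ?case
  proof cases
    case rw_Nil
    then show ?thesis using rw_Cross.prems(3) 1 by auto
  next
    case (rw_End X')
    then show ?thesis using rw_Cross.prems(3) 1(3)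
      by (auto simp: thru_append) (metis istep.simps(3,4) signal.exhaust last.simps last_snoc last_appendR item.distinct(1) list.distinct(1))
  next
    case (rw_Cross X' b'')
    obtain Y' p1 q1 b'' where 2: "thru ground X' (Wait x') Y' (Jump p1 q1)" "cstep (run ground X') b' p1 q1 b'' p q"
      "ys = Y' @ [Cross k' b'']"
    proof -
      obtain Y s y2 where h: "thru ground X' (Wait x') Y s" "istep (run ground X') (Cross k' b') s y2 (Jump p q)" "ys = Y @ y2"
        using rw_Cross.prems(3) rw_Cross(1) by (auto simp: thru_append)
      then show ?thesis using that by (cases s) auto
    qed
    have e: "Y' = Y" "k' = k" "b'' = j'" using 1(3) 2(3) by auto
    define g where "g = run ground Y"
    have s1: "g = run ground X \<circ> transpose p0 q0" using thru_state[OF 1(1)] unfolding g_def by simp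
    have s2: "g = run ground X' \<circ> transpose p1 q1" using thru_state[OF 2(1)] e unfolding g_def by simp
    have J1: "jump (run ground X) p0 q0"
      using thru_ok[OF 1(1)] row_word_good rw_Cross.hyps by auto
    have J2: "jump (run ground X') p1 q1"
      using thru_ok[OF 2(1)] row_word_good rw_Cross by auto
    have "j = b' \<and> p0 = p1 \<and> q0 = q1"
    proof (cases "p = j' + 1 \<and> q = j'")
      case True
      have "p0 = j + 1 \<and> q0 = j"
      proof (rule ccontr)
        assume n: "\<not> (p0 = j + 1 \<and> q0 = j)"
        then have "j' = j" "p = sw j p0" "q = sw j q0" using 1(2) unfolding cstep_def by auto
        then show False using True J1 unfolding jump_def by (auto simp: transpose_def split: if_splits)
      qed
      then have a: "p0 = j + 1" "q0 = j" "next_open (run ground X \<circ> sw j) j j'" using 1(2) unfolding cstep_def by auto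
      have "p1 = b' + 1 \<and> q1 = b'"
      proof (rule ccontr)
        assume n: "\<not> (p1 = b' + 1 \<and> q1 = b')"
        then have "j' = b'" "p = sw b' p1" "q = sw b' q1" using 2(2) e unfolding cstep_def by auto
        then show False using True J2 unfolding jump_def by (auto simp: transpose_def split: if_splits)
      qed
      then have b: "p1 = b' + 1" "q1 = b'" "next_open (run ground X' \<circ> sw b') b' j'" using 2(2) e unfolding cstep_def by auto
      have g1: "next_open g j j'" "0 < g j"
        using s1 a J1 unfolding jump_def by (auto simp: transpose_adjacent)
      have g2: "next_open g b' j'" "0 < g b'"
        using s2 b J2 unfolding jump_def by (auto simp: transpose_adjacent)
      have "j = b'"
      proof (rule ccontr)
        assume "j \<noteq> b'"
        then consider "j < b'" | "b' < j" by linarith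
        then show False using g1 g2 unfolding next_open_def by cases (metis less_imp_le not_le)+
      qed
      then show ?thesis using a b by auto
    next
      case False
      have "\<not> (p0 = j + 1 \<and> q0 = j)" using 1(2) False unfolding cstep_def by auto
      then have a: "j' = j" "p = sw j p0" "q = sw j q0" using 1(2) unfolding cstep_def by auto
      have "\<not> (p1 = b' + 1 \<and> q1 = b')" using 2(2) e False unfolding cstep_def by auto
      then have b: "j' = b'" "p = sw b' p1" "q = sw b' q1" using 2(2) e unfolding cstep_def by auto
      then show ?thesis using a by (metis transpose_involutory)
    qed
    then show ?thesis using rw_Cross.IH[OF _ 1(1)] 2(1) e rw_Cross by blast
  qed
next
  case (rw_End X k b)
  obtain Y s y2 where h: "thru ground X (Wait x) Y s" "istep (run ground X) (End k) s y2 (Jump p q)" "ys = Y @ y2"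
    using rw_End.prems(2) by (auto simp: thru_append)
  have c1: "(\<exists>Y. thru ground X (Wait x) Y (Jump p q) \<and> ys = Y @ [End k]) \<or>
      (x = k \<and> p = q + 1 \<and> rightmost (run ground X) q \<and> ys = X @ [Cross k q, End k])"
    using h by (cases s) (auto split: if_splits dest: thru_Wait)
  \<comment> \<open>One and the same crossing cannot be bumped in one history and fresh in the
    other: a bump leaves a particle to its right.\<close>
  have no_clash: False
    if X1: "thru ground X1 (Wait x1) (X2 @ [Cross k2 q]) (Jump (q + 1) q)" "row_word X1 k1 b1"
      and r: "rightmost (run ground X2) q" for X1 x1 X2 k1 k2 b1
    using X1(2)
  proof cases
    case rw_Nil
    then show False using X1(1) by simp
  next
    case (rw_End X1')
    then show False using X1(1)
      by (auto simp: thru_append) (metis istep.simps(3,4) signal.exhaust last.simps last_snoc last_appendR item.distinct(1) list.distinct(1))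
  next
    case (rw_Cross X1' b'')
    obtain Y p0 q0 b1' where 1: "thru ground X1' (Wait x1) Y (Jump p0 q0)" "cstep (run ground X1') b1 p0 q0 b1' (q + 1) q"
      "X2 @ [Cross k2 q] = Y @ [Cross k1 b1']"
    proof -
      obtain Y s y2 where h: "thru ground X1' (Wait x1) Y s" "istep (run ground X1') (Cross k1 b1) s y2 (Jump (q + 1) q)"
        "X2 @ [Cross k2 q] = Y @ y2"
        using X1(1) rw_Cross(1) by (auto simp: thru_append)
      then show ?thesis using that by (cases s) auto
    qed
    have e: "Y = X2" "b1' = q" using 1(3) by auto
    have J: "jump (run ground X1') p0 q0" using thru_ok[OF 1(1)] row_word_good rw_Cross by auto
    have s1: "run ground X2 = run ground X1' \<circ> transpose p0 q0" using thru_state[OF 1(1)] e by simp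
    have "p0 = b1 + 1 \<and> q0 = b1"
    proof (rule ccontr)
      assume n: "\<not> (p0 = b1 + 1 \<and> q0 = b1)"
      then have "q = b1" "q + 1 = sw b1 p0" "q = sw b1 q0" using 1(2) e unfolding cstep_def by auto
      then show False using J unfolding jump_def by (auto simp: transpose_def split: if_splits)
    qed
    then have "b1 < q" "0 < run ground X2 b1" using 1(2) e J s1 unfolding cstep_def next_open_def jump_def by auto
    then show False using r unfolding rightmost_def by (metis less_imp_le not_le)
  qed
  from rw_End.prems(1) show ?case
  proof cases
    case rw_Nil
    then show ?thesis using rw_End.prems(3) c1 by auto
  next
    case (rw_Cross X' b'')
    obtain Y s y2 where h: "thru ground X' (Wait x') Y s" "istep (run ground X') (Cross k' b') s y2 (Jump p q)" "ys = Y @ y2"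
      using rw_End.prems(3) rw_Cross by (auto simp: thru_append)
    then show ?thesis using c1 by (cases s) auto
  next
    case (rw_End X' k2 b2)
    obtain Y s y2 where h: "thru ground X' (Wait x') Y s" "istep (run ground X') (End k2) s y2 (Jump p q)" "ys = Y @ y2"
      using rw_End.prems(3) rw_End(1) by (auto simp: thru_append)
    have c2: "(\<exists>Y. thru ground X' (Wait x') Y (Jump p q) \<and> ys = Y @ [End k2]) \<or>
        (x' = k2 \<and> p = q + 1 \<and> rightmost (run ground X') q \<and> ys = X' @ [Cross k2 q, End k2])"
      using h by (cases s) (auto split: if_splits dest: thru_Wait)
    from c1 c2 consider
        Y Y' where "thru ground X (Wait x) Y (Jump p q)" "ys = Y @ [End k]" "thru ground X' (Wait x') Y' (Jump p q)" "ys = Y' @ [End k2]"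
      | Y where "thru ground X (Wait x) Y (Jump p q)" "ys = Y @ [End k]" "p = q + 1" "rightmost (run ground X') q" "ys = X' @ [Cross k2 q, End k2]"
      | Y where "thru ground X' (Wait x') Y (Jump p q)" "ys = Y @ [End k2]" "p = q + 1" "rightmost (run ground X) q" "ys = X @ [Cross k q, End k]"
      | "x = k" "ys = X @ [Cross k q, End k]" "x' = k2" "ys = X' @ [Cross k2 q, End k2]"
      by blast
    then show ?thesis
    proof cases
      case 1
      then show ?thesis using rw_End.IH[OF rw_End(4) 1(1)] rw_End by auto
    next
      case 2
      then have "Y = X' @ [Cross k2 q]" by (metis append_Cons append_Nil append_assoc butlast_snoc)
      then show ?thesis using no_clash[of X x X' k2] 2 rw_End.hyps by blast
    next
      case 3
      then have "Y = X @ [Cross k q]" by (metis append_Cons append_Nil append_assoc butlast_snoc)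
      then show ?thesis using no_clash[of X' x' X k] 3 rw_End by blast
    next
      case 4
      then show ?thesis using rw_End by auto
    qed
  qed
qed

section \<open>Strands\<close>

text \<open>Columns decrease to the right, so decreasing \<open>j\<close> within a row means reading
  it from left to right.\<close>

fun before :: "item \<Rightarrow> item \<Rightarrow> bool" where
  "before (Cross k j) (Cross k' j') \<longleftrightarrow> k < k' \<or> k = k' \<and> j' < j"
| "before (Cross k j) (End k') \<longleftrightarrow> k \<le> k'"
| "before (End k) (Cross k' j') \<longleftrightarrow> k < k'"
| "before (End k) (End k') \<longleftrightarrow> k < k'"

lemma before_trans: "before x y \<Longrightarrow> before y z \<Longrightarrow> before x z"
  by (cases x; cases y; cases z) auto

lemma before_irrefl: "\<not> before x x"
  by (cases x) auto

lemma before_asym: "before x y \<Longrightarrow> \<not> before y x"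
  by (cases x; cases y) auto

lemma before_total: "x \<noteq> y \<Longrightarrow> before x y \<or> before y x"
  by (cases x; cases y) auto

lemma sorted_before_unique:
  "sorted_wrt before xs \<Longrightarrow> sorted_wrt before ys \<Longrightarrow> set xs = set ys \<Longrightarrow> xs = ys"
proof (induction xs arbitrary: ys)
  case (Cons x xs)
  then obtain y ys' where ys: "ys = y # ys'" by (cases ys) auto
  have "x = y"
  proof (rule ccontr)
    assume "x \<noteq> y"
    then have "before y x" "before x y" using Cons.prems ys by auto
    then show False using before_asym by blast
  qed
  moreover have "x \<notin> set xs" "y \<notin> set ys'" using Cons.prems ys before_irrefl by auto
  ultimately have "set xs = set ys'" using Cons.prems ys by auto
  then show ?case using Cons ys \<open>x = y\<close> by auto
qed simp

lemma sorted_before_distinct: "sorted_wrt before xs \<Longrightarrow> distinct xs"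
  using before_irrefl by (induction xs) auto

lemma sorted_before_exists: "finite S \<Longrightarrow> \<exists>xs. sorted_wrt before xs \<and> set xs = S"
proof (induction rule: finite_induct)
  case (insert x S)
  then obtain xs where xs: "sorted_wrt before xs" "set xs = S" by auto
  define ys where "ys = filter (\<lambda>y. before y x) xs @ x # filter (before x) xs"
  have "sorted_wrt before ys" unfolding ys_def
    using xs by (auto simp: sorted_wrt_append sorted_wrt_filter intro: before_trans)
  moreover have "set ys = insert x S" unfolding ys_def
    using xs insert.hyps before_total by auto
  ultimately show ?case by blast
qed auto

text \<open>The state with which the sweep arrives at the cell of \<open>Cross k j\<close>, whether
  that cell holds a crossing or not.\<close>

definition prior :: "item list \<Rightarrow> int \<Rightarrow> int \<Rightarrow> int \<Rightarrow> int" where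
  "prior L k j = run ground (filter (\<lambda>y. before y (Cross k j)) L)"

lemma prior_split:
  assumes "sorted_wrt before (A @ Cross k j # B)"
  shows "prior (A @ Cross k j # B) k j = run ground A"
proof -
  have "filter (\<lambda>y. before y (Cross k j)) A = A"
    using assms by (auto simp: filter_id_conv sorted_wrt_append)
  moreover have "filter (\<lambda>y. before y (Cross k j)) B = []"
    using assms before_asym by (auto simp: filter_empty_conv sorted_wrt_append)
  ultimately show ?thesis unfolding prior_def by (simp add: before_irrefl)
qed

lemma prior_right:
  assumes "sorted_wrt before L"
  shows "prior L k (j - 1) = (if Cross k j \<in> set L then prior L k j \<circ> sw j else prior L k j)"
proof -
  have "filter (\<lambda>y. before y (Cross k (j - 1))) L
      = filter (\<lambda>y. before y (Cross k j)) L @ (if Cross k j \<in> set L then [Cross k j] else [])"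
  proof (rule sorted_before_unique)
    have iff: "before y (Cross k (j - 1)) \<longleftrightarrow> before y (Cross k j) \<or> y = Cross k j" for y
      by (cases y) auto
    show "set (filter (\<lambda>y. before y (Cross k (j - 1))) L)
      = set (filter (\<lambda>y. before y (Cross k j)) L @ (if Cross k j \<in> set L then [Cross k j] else []))"
      using iff by auto
  qed (use assms in \<open>auto simp: sorted_wrt_filter sorted_wrt_append\<close>)
  then show ?thesis unfolding prior_def by simp
qed

lemma run_fixes:
  "(\<And>k h. Cross k h \<in> set M \<Longrightarrow> r \<noteq> h \<and> r \<noteq> h + 1) \<Longrightarrow> run f M r = f r"
proof (induction M arbitrary: f)
  case (Cons x M)
  then have "run (apply_item f x) M r = apply_item f x r" by auto
  moreover have "apply_item f x r = f r" using Cons.prems by (cases x) (fastforce simp: transpose_def)+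
  ultimately show ?case by simp
qed simp

text \<open>Between a cell and the one above it, the reading passes the rest of row \<open>k\<close>
  to the right and the beginning of row \<open>k + 1\<close> on the left. These crossings touch
  positions up to \<open>j\<close> and from \<open>j + 2\<close> on, never
  \<open>j + 1\<close>.\<close>

lemma prior_up:
  assumes "sorted_wrt before L"
  shows "prior L (k + 1) (j + 1) (j + 1) = prior L k (j - 1) (j + 1)"
proof -
  define P Q where "P y = before y (Cross k (j - 1))" and "Q y = before y (Cross (k + 1) (j + 1))" for y
  have PQ: "P y \<Longrightarrow> Q y" for y unfolding P_def Q_def by (cases y) auto
  have PnP: "before y z" if "P y" "\<not> P z" for y z
    using that unfolding P_def by (cases y; cases z) auto
  have "filter Q L = filter P L @ filter (\<lambda>y. Q y \<and> \<not> P y) L"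
  proof (rule sorted_before_unique)
    show "set (filter Q L) = set (filter P L @ filter (\<lambda>y. Q y \<and> \<not> P y) L)" using PQ by auto
    show "sorted_wrt before (filter P L @ filter (\<lambda>y. Q y \<and> \<not> P y) L)"
      using assms PnP by (auto simp: sorted_wrt_filter sorted_wrt_append)
  qed (use assms in \<open>simp add: sorted_wrt_filter\<close>)
  then have "run ground (filter Q L) (j + 1) = run (run ground (filter P L)) (filter (\<lambda>y. Q y \<and> \<not> P y) L) (j + 1)"
    by simp
  also have "\<dots> = run ground (filter P L) (j + 1)"
    by (rule run_fixes) (auto simp: P_def Q_def)
  finally show ?thesis unfolding prior_def P_def Q_def .
qed

text \<open>The crossings of lower rows stay below position \<open>k\<close>, so a strand still has
  its own label there when it enters row \<open>k\<close> from the left.\<close>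

lemma prior_border:
  assumes "\<And>k' j. Cross k' j \<in> set L \<Longrightarrow> j < k'"
  shows "prior L k (k - 1) k = k"
proof -
  have "run ground (filter (\<lambda>y. before y (Cross k (k - 1))) L) k = ground k"
    by (rule run_fixes) (use assms in force)
  then show ?thesis unfolding prior_def ground_def .
qed

text \<open>
  \<open>Cross k j\<close> stands for the cell in row \<open>k\<close> and column \<open>j + n + 1 - k\<close>, that is, for the letter \<open>s\<^sub>j\<close>.
\<close>

definition cells :: "int \<Rightarrow> item list \<Rightarrow> cell set" where
  "cells n L = {(i, k). Cross k (i + k - n - 1) \<in> set L}"

lemma cells_iff: "(i, k) \<in> cells n L \<longleftrightarrow> Cross k (i + k - n - 1) \<in> set L"
  by (simp add: cells_def)

lemma Cross_iff: "Cross k j \<in> set L \<longleftrightarrow> (j + n + 1 - k, k) \<in> cells n L"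
  by (simp add: cells_def)

text \<open>The \<open>End\<close> markers are left free: the sweep works with words that have all
  of them, the counting of rows with words that have none.\<close>

definition lists :: "int \<Rightarrow> item list \<Rightarrow> cell set \<Rightarrow> bool" where
  "lists n L R \<longleftrightarrow> sorted_wrt before L \<and> cells n L = R \<and> R \<subseteq> {..n} \<times> {..n}"

lemma listsD:
  assumes "lists n L R"
  shows "sorted_wrt before L" "\<And>i k. (i, k) \<in> R \<longleftrightarrow> Cross k (i + k - n - 1) \<in> set L"
    "\<And>k j. Cross k j \<in> set L \<Longrightarrow> j < k \<and> k \<le> n"
proof -
  show "sorted_wrt before L" "\<And>i k. (i, k) \<in> R \<longleftrightarrow> Cross k (i + k - n - 1) \<in> set L"
    using assms unfolding lists_def cells_def by auto
  fix k j assume "Cross k j \<in> set L"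
  then have "(j + n + 1 - k, k) \<in> R" using assms Cross_iff unfolding lists_def by auto
  then show "j < k \<and> k \<le> n" using assms unfolding lists_def by auto
qed

text \<open>With \<open>j = i + k - n - 1\<close> the left edge of a cell carries position
  \<open>j + 1\<close> of its state and the bottom edge position \<open>j\<close>. Each rule of
  \<open>strand\<close> is then one move of \<open>prior\<close> to the right or upwards.\<close>

lemma strand_label:
  assumes L: "lists n L R" and s: "strand n D R p e"
  shows "case e of Left_edge (i, k) \<Rightarrow> i \<le> n \<and> k \<le> n \<and> p = prior L k (i + k - n - 1) (i + k - n)
    | Bottom_edge (i, k) \<Rightarrow> i \<le> n \<and> k \<le> n + 1 \<and> p = prior L k (i + k - n - 1) (i + k - n - 1)"
  using s
proof induction
  case enter
  then show ?case using prior_border[of L p] listsD(3)[OF L] by simp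
next
  case (cross_right i k)
  then show ?case using prior_right[OF listsD(1)[OF L], of k "i + k - n - 1"] listsD(2)[OF L, of i k]
    by (simp add: algebra_simps)
next
  case (cross_up i k)
  have "prior L (k + 1) (i + k - n - 1 + 1) (i + k - n - 1 + 1) = prior L k (i + k - n - 1 - 1) (i + k - n - 1 + 1)"
    by (rule prior_up[OF listsD(1)[OF L]])
  also have "\<dots> = prior L k (i + k - n - 1) (i + k - n - 1)"
    using prior_right[OF listsD(1)[OF L], of k "i + k - n - 1"] listsD(2)[OF L, of i k] cross_up by simp
  finally show ?case using cross_up L unfolding lists_def by (auto simp: algebra_simps)
next
  case (elbow_up i k)
  have "prior L (k + 1) (i + k - n - 1 + 1) (i + k - n - 1 + 1) = prior L k (i + k - n - 1 - 1) (i + k - n - 1 + 1)"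
    by (rule prior_up[OF listsD(1)[OF L]])
  also have "\<dots> = prior L k (i + k - n - 1) (i + k - n)"
    using prior_right[OF listsD(1)[OF L], of k "i + k - n - 1"] listsD(2)[OF L, of i k] elbow_up by simp
  finally show ?case using elbow_up by (simp add: algebra_simps)
next
  case (elbow_right i k)
  then show ?case using prior_right[OF listsD(1)[OF L], of k "i + k - n - 1"] listsD(2)[OF L, of i k]
    by (simp add: algebra_simps)
qed

text \<open>Rows are filled upwards and each row from its left border, since a cell needs its left
  and its bottom edge. The induction can start at row \<open>D - n\<close>: no cell of that row lies
  strictly above the cut, so no bottom edge is required.\<close>

lemma label_strand:
  assumes L: "lists n L R" and D: "admissible_cut R D"
  shows "k \<le> n \<Longrightarrow> D - n \<le> k \<Longrightarrow> (\<forall>i\<le>n. D \<le> i + k \<longrightarrow> strand n D R (prior L k (i + k - n - 1) (i + k - n)) (Left_edge (i, k)))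
     \<and> (\<forall>i\<le>n. D < i + k + 1 \<longrightarrow> strand n D R (prior L (k + 1) (i + k - n) (i + k - n)) (Bottom_edge (i, k + 1)))"
proof -
  have D': "D < i + k" if "(i, k) \<in> R" for i k using D that unfolding admissible_cut_def by auto
  have left: "strand n D R (prior L k (i + k - n - 1) (i + k - n)) (Left_edge (i, k))"
    if B: "\<And>i. i \<le> n \<Longrightarrow> D < i + k \<Longrightarrow> strand n D R (prior L k (i + k - n - 1) (i + k - n - 1)) (Bottom_edge (i, k))"
      and k: "k \<le> n" and i: "i \<le> n" "D \<le> i + k" for k i
    using i
  proof (induction i rule: int_le_induct)
    case base
    then show ?case using strand.enter[of D n k R] k prior_border[of L k] listsD(3)[OF L] by simp
  next
    case (step i)
    have "D < i + k" using step by simp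
    then have 1: "strand n D R (prior L k (i + k - n - 1) (i + k - n)) (Left_edge (i, k))"
      and 2: "strand n D R (prior L k (i + k - n - 1) (i + k - n - 1)) (Bottom_edge (i, k))"
      using step B by auto
    note pr = prior_right[OF listsD(1)[OF L], of k "i + k - n - 1"] listsD(2)[OF L, of i k]
    show ?case
    proof (cases "(i, k) \<in> R")
      case True
      then show ?thesis using strand.cross_right[OF 1 True] pr by (simp add: algebra_simps)
    next
      case False
      then show ?thesis using strand.elbow_right[OF 2 False \<open>D < i + k\<close> k] pr by (simp add: algebra_simps)
    qed
  qed
  have up: "strand n D R (prior L (k + 1) (i + k - n) (i + k - n)) (Bottom_edge (i, k + 1))"
    if B: "\<And>i. i \<le> n \<Longrightarrow> D < i + k \<Longrightarrow> strand n D R (prior L k (i + k - n - 1) (i + k - n - 1)) (Bottom_edge (i, k))"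
      and k: "k \<le> n" and i: "i \<le> n" "D < i + k + 1" for k i
  proof -
    note pr = prior_right[OF listsD(1)[OF L], of k "i + k - n - 1"] listsD(2)[OF L, of i k]
      prior_up[OF listsD(1)[OF L], of k "i + k - n - 1"]
    show ?thesis
    proof (cases "(i, k) \<in> R")
      case True
      then show ?thesis using strand.cross_up[OF B[OF i(1) D'[OF True]] True] pr by (simp add: algebra_simps)
    next
      case False
      have "D \<le> i + k" using i by simp
      then show ?thesis using strand.elbow_up[OF left[OF B k i(1)] False] pr False by (simp add: algebra_simps)
    qed
  qed
  show "k \<le> n \<Longrightarrow> D - n \<le> k \<Longrightarrow> ?thesis"
  proof -
    assume k: "k \<le> n" "D - n \<le> k"
    have B: "k \<le> n \<longrightarrow> (\<forall>i\<le>n. D < i + k \<longrightarrow> strand n D R (prior L k (i + k - n - 1) (i + k - n - 1)) (Bottom_edge (i, k)))"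
      using k(2)
    proof (induction k rule: int_ge_induct)
      case (step k)
      show ?case
      proof (intro impI allI)
        fix i assume h: "k + 1 \<le> n" "i \<le> n" "D < i + (k + 1)"
        have "strand n D R (prior L (k + 1) (i + k - n) (i + k - n)) (Bottom_edge (i, k + 1))"
          by (rule up) (use step h in auto)
        then show "strand n D R (prior L (k + 1) (i + (k + 1) - n - 1) (i + (k + 1) - n - 1)) (Bottom_edge (i, k + 1))"
          by (simp add: algebra_simps)
      qed
    qed auto
    have B': "strand n D R (prior L k (i + k - n - 1) (i + k - n - 1)) (Bottom_edge (i, k))" if "i \<le> n" "D < i + k" for i
      using B k that by auto
    show ?thesis using left[OF B' k(1)] up[OF B' k(1)] by blast
  qed
qed

lemma admissible_cut_exists:
  assumes "finite R" shows "\<exists>D. D < m \<and> admissible_cut R D"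
proof -
  define S where "S = insert m ((\<lambda>(i, k). i + k) ` R)"
  have S: "finite S" "m \<in> S" unfolding S_def using assms by auto
  have "Min S \<le> i + k" if "(i, k) \<in> R" for i k
    by (rule Min_le[OF S(1)]) (use that in \<open>force simp: S_def\<close>)
  moreover have "Min S \<le> m" using S by simp
  ultimately show ?thesis unfolding admissible_cut_def by (intro exI[of _ "Min S - 1"]) force
qed

lemma lists_finite: "lists n L R \<Longrightarrow> finite R"
proof -
  assume L: "lists n L R"
  have "R \<subseteq> (\<lambda>x. case x of Cross k j \<Rightarrow> (j + n + 1 - k, k) | End k \<Rightarrow> (k, k)) ` set L"
    using listsD(2)[OF L] by force
  then show ?thesis using finite_subset by blast
qed

lemma enters_left_iff:
  assumes "lists n L R" "i \<le> n" "k \<le> n"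
  shows "enters_left n R p (i, k) \<longleftrightarrow> p = prior L k (i + k - n - 1) (i + k - n)"
proof
  assume "enters_left n R p (i, k)"
  then show "p = prior L k (i + k - n - 1) (i + k - n)"
    unfolding enters_left_def using strand_label[OF assms(1)] by fastforce
next
  assume p: "p = prior L k (i + k - n - 1) (i + k - n)"
  obtain D where D: "D < i + k" "admissible_cut R D" using admissible_cut_exists[OF lists_finite[OF assms(1)]] by blast
  then have "strand n D R p (Left_edge (i, k))"
    using label_strand[OF assms(1) D(2), of k] assms p by auto
  then show "enters_left n R p (i, k)" unfolding enters_left_def using D by auto
qed

lemma enters_bottom_iff:
  assumes "lists n L R" "i \<le> n" "k \<le> n"
  shows "enters_bottom n R p (i, k) \<longleftrightarrow> p = prior L k (i + k - n - 1) (i + k - n - 1)"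
proof
  assume "enters_bottom n R p (i, k)"
  then show "p = prior L k (i + k - n - 1) (i + k - n - 1)"
    unfolding enters_bottom_def using strand_label[OF assms(1)] by fastforce
next
  assume p: "p = prior L k (i + k - n - 1) (i + k - n - 1)"
  obtain D where D: "D < i + k - 1" "admissible_cut R D" using admissible_cut_exists[OF lists_finite[OF assms(1)]] by blast
  then have "strand n D R p (Bottom_edge (i, k))"
    using label_strand[OF assms(1) D(2), of "k - 1"] assms p by (auto simp: algebra_simps)
  then show "enters_bottom n R p (i, k)" unfolding enters_bottom_def using D by auto
qed

lemma run_support:
  assumes "\<And>k j. Cross k j \<in> set L \<Longrightarrow> a \<le> j \<and> j < b"
  shows "run ground L permutes {a..b}"
proof -
  have "run f L permutes {a..b}" if "f permutes {a..b}" for f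
    using that assms
  proof (induction L arbitrary: f)
    case (Cons x L)
    have "apply_item f x permutes {a..b}"
    proof (cases x)
      case (Cross k j)
      then have "a \<le> j \<and> j < b" using Cons.prems(2)[of k j] by simp
      then have "sw j permutes {a..b}" by (intro permutes_swap_id) auto
      then show ?thesis using permutes_compose[OF _ Cons.prems(1)] Cross by simp
    qed (use Cons.prems in simp)
    moreover have "\<And>k j. Cross k j \<in> set L \<Longrightarrow> a \<le> j \<and> j < b" using Cons.prems(2) by auto
    ultimately show ?case using Cons.IH by simp
  qed simp
  moreover have "ground permutes {a..b}" unfolding permutes_def ground_def by auto
  ultimately show ?thesis by blast
qed

lemma run_bij: "bij f \<Longrightarrow> bij (run f L)"
proof (induction L arbitrary: f)
  case (Cons x L)
  have "bij (apply_item f x)" using Cons.prems by (cases x) (auto intro: bij_comp)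
  then show ?case using Cons.IH by simp
qed simp

lemma bij_ground: "bij ground"
  unfolding ground_def by (rule bijI') auto

text \<open>After the last row, position \<open>i\<close> is the top edge of column
  \<open>i\<close>, and the state sends it to the label leaving there. \<open>rc_perm\<close> goes
  from labels to columns, hence the inverse.\<close>

lemma rc_perm_eq:
  assumes L: "lists n L R"
  shows "rc_perm n R = inv (run ground L)"
proof
  fix p
  define D where "D = (SOME D. admissible_cut R D)"
  have D: "admissible_cut R D" unfolding D_def
    using admissible_cut_exists[OF lists_finite[OF L]] by (metis someI_ex)
  define w where "w = run ground L"
  have w: "bij w" unfolding w_def by (rule run_bij[OF bij_ground])
  have supp: "w permutes {D - n..n}" unfolding w_def
  proof (rule run_support)
    fix k j assume c: "Cross k j \<in> set L"
    then have "(j + n + 1 - k, k) \<in> R" using Cross_iff L unfolding lists_def by auto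
    then have "D < j + n + 1" using D unfolding admissible_cut_def by auto
    then show "D - n \<le> j \<and> j < n" using listsD(3)[OF L c] by auto
  qed
  have top: "prior L (n + 1) i = w" for i
  proof -
    have "filter (\<lambda>y. before y (Cross (n + 1) i)) L = filter (\<lambda>y. case y of Cross k j \<Rightarrow> True | End k \<Rightarrow> k \<le> n) L"
      by (rule filter_cong) (use listsD(3)[OF L] in \<open>force split: item.splits\<close>)+
    moreover have "run f (filter (\<lambda>y. case y of Cross k j \<Rightarrow> True | End k \<Rightarrow> k \<le> n) M) = run f M" for f M
      by (induction M arbitrary: f) (auto split: item.splits)
    ultimately show ?thesis unfolding prior_def w_def by simp
  qed
  have strand_top: "strand n D R p (Bottom_edge (i, n + 1)) \<longleftrightarrow> p = w i" if i: "D - n \<le> p" "p \<le> n" for i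
  proof
    assume "strand n D R p (Bottom_edge (i, n + 1))"
    then show "p = w i" using strand_label[OF L] top by fastforce
  next
    assume p: "p = w i"
    then have "i \<in> {D - n..n}" using i permutes_in_image[OF supp] by (metis atLeastAtMost_iff)
    moreover then have "D - n \<le> n" by auto
    ultimately show "strand n D R p (Bottom_edge (i, n + 1))"
      using label_strand[OF L D, of n] top p by auto
  qed
  show "rc_perm n R p = inv (run ground L) p"
  proof (cases "D - n \<le> p \<and> p \<le> n")
    case True
    then have "rc_perm n R p = (THE i. p = w i)"
      unfolding rc_perm_def D_def[symmetric] Let_def using strand_top by simp
    also have "\<dots> = inv w p"
      using w by (intro the_equality) (auto simp: bij_is_surj surj_f_inv_f bij_is_inj)
    finally show ?thesis unfolding w_def .
  next
    case False
    then have "w p = p" using supp unfolding permutes_def by auto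
    then have "inv w p = p" using w by (metis bij_inv_eq_iff)
    then show ?thesis unfolding rc_perm_def D_def[symmetric] Let_def w_def using False by auto
  qed
qed

section \<open>Reduced words\<close>

fun crossings :: "(int \<Rightarrow> int) \<Rightarrow> item list \<Rightarrow> int \<Rightarrow> int \<Rightarrow> nat" where
  "crossings f [] u v = 0"
| "crossings f (Cross k j # xs) u v = (if {f j, f (j + 1)} = {u, v} then 1 else 0) + crossings (f \<circ> sw j) xs u v"
| "crossings f (End k # xs) u v = crossings f xs u v"

lemma crossings_append: "crossings f (xs @ ys) u v = crossings f xs u v + crossings (run f xs) ys u v"
  by (induction f xs u v rule: crossings.induct) (simp_all del: comp_apply)

text \<open>Exchanging two neighbours reverses the order of exactly the pair exchanged.\<close>

lemma crossings_parity:
  assumes "bij f" "u \<noteq> v"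
  shows "inv (run f xs) v < inv (run f xs) u \<longleftrightarrow> (inv f v < inv f u \<longleftrightarrow> even (crossings f xs u v))"
  using assms
proof (induction f xs u v rule: crossings.induct)
  case (2 f k j xs u v)
  have b: "bij (f \<circ> sw j)" using 2 by (auto intro: bij_comp)
  have i: "inv (f \<circ> sw j) x = sw j (inv f x)" for x
    using o_inv_distrib[of f "sw j"] 2 by simp
  define a c where "a = inv f u" and "c = inv f v"
  have f: "f a = u" "f c = v" unfolding a_def c_def using 2 by (auto simp: bij_is_surj surj_f_inv_f)
  then have "a \<noteq> c" using 2 by auto
  have "f x = f y \<longleftrightarrow> x = y" for x y using 2 by (auto dest: bij_is_inj injD)
  then have s: "{f j, f (j + 1)} = {u, v} \<longleftrightarrow> {j, j + 1} = {a, c}"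
    unfolding f[symmetric] by (auto simp: doubleton_eq_iff)
  have "sw j c < sw j a \<longleftrightarrow> (c < a \<longleftrightarrow> {j, j + 1} \<noteq> {a, c})"
    using \<open>a \<noteq> c\<close> by (auto simp: transpose_def doubleton_eq_iff)
  moreover have "inv (run (f \<circ> sw j) xs) v < inv (run (f \<circ> sw j) xs) u
      \<longleftrightarrow> (sw j c < sw j a \<longleftrightarrow> even (crossings (f \<circ> sw j) xs u v))"
    using 2(1)[OF b 2(3)] unfolding i a_def c_def .
  ultimately show ?case
    unfolding run_simps apply_item.simps crossings.simps s a_def[symmetric] c_def[symmetric]
    by (cases "{j, j + 1} = {a, c}"; cases "c < a") (simp_all del: comp_apply)
qed auto

definition reduced :: "item list \<Rightarrow> bool" where
  "reduced L \<longleftrightarrow> (\<forall>A k j B. L = A @ Cross k j # B \<longrightarrow> run ground A j < run ground A (j + 1))"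

lemma inv_ground: "inv ground x = x"
  by (rule inv_f_eq[OF bij_is_inj[OF bij_ground]]) (simp add: ground_def)

lemma inverted_iff:
  "u < v \<Longrightarrow> inv (run ground L) v < inv (run ground L) u \<longleftrightarrow> odd (crossings ground L u v)"
  using crossings_parity[OF bij_ground, of u v L] by (simp add: inv_ground)

lemma run_inv: "inv (run ground L) (run ground L i) = i"
  by (simp add: inv_f_f[OF bij_is_inj[OF run_bij[OF bij_ground]]])

lemma run_adjacent: "run ground L j \<noteq> run ground L (j + 1)"
  by (metis run_inv less_add_one less_irrefl)

lemma reduced_snoc: "reduced (L @ [x]) \<Longrightarrow> reduced L"
  unfolding reduced_def by (metis append_Cons append_assoc)

text \<open>After one crossing the pair is inverted, by parity, and a reduced word never lets an
  inverted pair meet again.\<close>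

lemma reduced_crossings: "reduced L \<Longrightarrow> u < v \<Longrightarrow> crossings ground L u v \<le> 1"
proof (induction L rule: rev_induct)
  case (snoc x L)
  have c: "crossings ground L u v \<le> 1" using snoc reduced_snoc by blast
  show ?case
  proof (cases x)
    case (Cross k j)
    define f where "f = run ground L"
    have "f j < f (j + 1)" using snoc.prems(1) unfolding reduced_def Cross f_def by blast
    show ?thesis
    proof (cases "{f j, f (j + 1)} = {u, v}")
      case True
      then have "f j = u" "f (j + 1) = v" using \<open>f j < f (j + 1)\<close> \<open>u < v\<close> by (auto simp: doubleton_eq_iff)
      then have "inv f u = j" "inv f v = j + 1" unfolding f_def using run_inv by metis+
      then have "even (crossings ground L u v)" using inverted_iff[OF \<open>u < v\<close>, of L] unfolding f_def by simp
      then have "crossings ground L u v = 0" using c by (cases "crossings ground L u v") auto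
      then show ?thesis by (simp add: crossings_append Cross)
    next
      case False
      then show ?thesis using c by (simp add: crossings_append Cross f_def)
    qed
  qed (use c in \<open>simp add: crossings_append\<close>)
qed simp

lemma crossings_pos: "0 < crossings f L u v \<Longrightarrow>
    \<exists>A k j B. L = A @ Cross k j # B \<and> {run f A j, run f A (j + 1)} = {u, v}"
proof (induction f L u v rule: crossings.induct)
  case (2 f k j xs u v)
  show ?case
  proof (cases "{f j, f (j + 1)} = {u, v}")
    case True
    then show ?thesis by (intro exI[of _ "[]"]) auto
  next
    case False
    then have "0 < crossings (f \<circ> sw j) xs u v" using 2(2) unfolding crossings.simps by simp
    from 2(1)[OF this] obtain A k' j' B where "xs = A @ Cross k' j' # B"
      "{run (f \<circ> sw j) A j', run (f \<circ> sw j) A (j' + 1)} = {u, v}" by blast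
    then have "Cross k j # xs = (Cross k j # A) @ Cross k' j' # B \<and>
      {run f (Cross k j # A) j', run f (Cross k j # A) (j' + 1)} = {u, v}"
      unfolding run_simps apply_item.simps by simp
    then show ?thesis by blast
  qed
next
  case (3 f k xs u v)
  then obtain A k' j' B where "xs = A @ Cross k' j' # B" "{run f A j', run f A (j' + 1)} = {u, v}" by auto
  then show ?case by (intro exI[of _ "End k # A"]) auto
qed simp

lemma cross_at_split:
  assumes L: "lists n L R" and e: "L = A @ Cross k j # B"
  shows "(j + n + 1 - k, k) \<in> R"
    "cross_at n R p q (j + n + 1 - k, k) \<longleftrightarrow> p \<noteq> q \<and> {p, q} = {run ground A j, run ground A (j + 1)}"
proof -
  have c: "Cross k j \<in> set L" using e by simp
  show R: "(j + n + 1 - k, k) \<in> R" using listsD(2)[OF L] c by simp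
  have b: "j + n + 1 - k \<le> n" "k \<le> n" using listsD(3)[OF L c] by auto
  have pr: "prior L k j = run ground A" using prior_split listsD(1)[OF L] e by blast
  show "cross_at n R p q (j + n + 1 - k, k) \<longleftrightarrow> p \<noteq> q \<and> {p, q} = {run ground A j, run ground A (j + 1)}"
    unfolding cross_at_def enters_left_iff[OF L b] enters_bottom_iff[OF L b] using R
    using run_adjacent[of A j] by (auto simp: pr doubleton_eq_iff)
qed

lemma crossings_split:
  "crossings f (A @ Cross k j # B) u v = crossings f A u v
    + (if {run f A j, run f A (j + 1)} = {u, v} then 1 else 0) + crossings (run f A \<circ> sw j) B u v"
  by (simp add: crossings_append)

text \<open>If a crossing meets its two labels in inverted order, parity provides an earlier
  crossing of the same pair, hence a double crossing. The converse is
  \<open>reduced_crossings\<close>.\<close>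

lemma rc_graph_iff_reduced:
  assumes L: "lists n L R"
  shows "rc_graph n R \<longleftrightarrow> reduced L"
proof
  assume rc: "rc_graph n R"
  show "reduced L" unfolding reduced_def
  proof (intro allI impI, rule ccontr)
    fix A k j B
    assume e: "L = A @ Cross k j # B" and n: "\<not> run ground A j < run ground A (j + 1)"
    define f where "f = run ground A"
    have "f j \<noteq> f (j + 1)" using run_adjacent unfolding f_def .
    then have lt: "f (j + 1) < f j" using n unfolding f_def by simp
    have "inv f (f j) < inv f (f (j + 1))" unfolding f_def run_inv by simp
    then have "odd (crossings ground A (f (j + 1)) (f j))" using inverted_iff[OF lt, of A] unfolding f_def by simp
    then have "0 < crossings ground A (f (j + 1)) (f j)" by (auto elim: oddE)
    then obtain A1 k' j' A2 where s: "A = A1 @ Cross k' j' # A2"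
      "{run ground A1 j', run ground A1 (j' + 1)} = {f (j + 1), f j}" using crossings_pos by blast
    have L': "L = A1 @ Cross k' j' # (A2 @ Cross k j # B)" using e s by simp
    have "cross_at n R (f (j + 1)) (f j) (j + n + 1 - k, k)"
      using cross_at_split(2)[OF L e] lt unfolding f_def by auto
    moreover have "cross_at n R (f (j + 1)) (f j) (j' + n + 1 - k', k')"
      using cross_at_split(2)[OF L L'] s(2) lt by auto
    ultimately have "(j + n + 1 - k, k) = (j' + n + 1 - k', k')" using rc unfolding rc_graph_def by blast
    then have "Cross k j = Cross k' j'" by simp
    then show False using sorted_before_distinct[OF listsD(1)[OF L]] L' by auto
  qed
next
  assume red: "reduced L"
  have two: False if "L = A @ Cross k j # M @ Cross k' j' # B" "p \<noteq> q"
    "{p, q} = {run ground A j, run ground A (j + 1)}"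
    "{p, q} = {run ground (A @ Cross k j # M) j', run ground (A @ Cross k j # M) (j' + 1)}" for A k j M k' j' B p q
  proof -
    have "2 \<le> crossings ground L p q" unfolding that(1) using that(3,4) by (simp add: crossings_append)
    moreover have "crossings ground L p q = crossings ground L q p"
    proof -
      have "crossings f xs p q = crossings f xs q p" for f xs
        by (induction f xs p q rule: crossings.induct) (simp_all del: comp_apply add: insert_commute)
      then show ?thesis .
    qed
    ultimately show False using reduced_crossings[OF red, of p q] reduced_crossings[OF red, of q p] that(2)
      by (cases "p < q") auto
  qed
  show "rc_graph n R" unfolding rc_graph_def
  proof (intro conjI allI impI)
    show "finite R" using lists_finite[OF L] .
    show "R \<subseteq> {..n} \<times> {..n}" using L unfolding lists_def by simp
    fix p q c d assume c: "cross_at n R p q c" and d: "cross_at n R p q d"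
    obtain i1 k1 where c': "c = (i1, k1)" by (cases c)
    obtain i2 k2 where d': "d = (i2, k2)" by (cases d)
    define j1 j2 where "j1 = i1 + k1 - n - 1" and "j2 = i2 + k2 - n - 1"
    have cc: "c = (j1 + n + 1 - k1, k1)" "d = (j2 + n + 1 - k2, k2)" unfolding c' d' j1_def j2_def by auto
    have "Cross k1 j1 \<in> set L" "Cross k2 j2 \<in> set L"
      using c d listsD(2)[OF L] unfolding cross_at_def c' d' j1_def j2_def by auto
    then obtain A B where e1: "L = A @ Cross k1 j1 # B" by (meson split_list)
    show "c = d"
    proof (rule ccontr)
      assume "c \<noteq> d"
      then have "Cross k1 j1 \<noteq> Cross k2 j2" using cc by auto
      then consider "Cross k2 j2 \<in> set B" | "Cross k2 j2 \<in> set A"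
        using e1 \<open>Cross k2 j2 \<in> set L\<close> by auto
      then show False
      proof cases
        case 1
        then obtain M B' where "B = M @ Cross k2 j2 # B'" by (meson split_list)
        then have e: "L = A @ Cross k1 j1 # M @ Cross k2 j2 # B'"
          and e2: "L = (A @ Cross k1 j1 # M) @ Cross k2 j2 # B'" using e1 by auto
        show False using two[OF e] cross_at_split(2)[OF L e1] cross_at_split(2)[OF L e2] c d unfolding cc by auto
      next
        case 2
        then obtain A' M where "A = A' @ Cross k2 j2 # M" by (meson split_list)
        then have e: "L = A' @ Cross k2 j2 # M @ Cross k1 j1 # B"
          and e2: "L = (A' @ Cross k2 j2 # M) @ Cross k1 j1 # B"
          and e3: "L = A' @ Cross k2 j2 # (M @ Cross k1 j1 # B)" using e1 by auto
        show False using two[OF e] cross_at_split(2)[OF L e2] cross_at_split(2)[OF L e3] c d unfolding cc by auto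
      qed
    qed
  qed
qed

lemma row_word_sorted:
  "row_word xs k b \<Longrightarrow> sorted_wrt before xs \<and>
    (\<forall>k' j. Cross k' j \<in> set xs \<longrightarrow> 1 \<le> k' \<and> j < k' \<and> (k' < k \<or> k' = k \<and> b \<le> j)) \<and>
    (\<forall>k'. End k' \<in> set xs \<longleftrightarrow> 1 \<le> k' \<and> k' < k)"
proof (induction rule: row_word.induct)
  case (rw_Cross xs k b j)
  have "before x (Cross k j)" if x: "x \<in> set xs" for x
  proof (cases x)
    case (Cross k' j')
    then have "k' < k \<or> k' = k \<and> b \<le> j'" using rw_Cross.IH x by blast
    then show ?thesis using Cross rw_Cross.hyps by auto
  next
    case (End k')
    then have "k' < k" using rw_Cross.IH x by blast
    then show ?thesis using End by simp
  qed
  then show ?case using rw_Cross row_word_bounds[OF rw_Cross(1)] by (fastforce simp: sorted_wrt_append)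
next
  case (rw_End xs k b)
  have "before x (End k)" if x: "x \<in> set xs" for x
  proof (cases x)
    case (Cross k' j')
    then have "k' < k \<or> k' = k \<and> b \<le> j'" using rw_End.IH x by blast
    then show ?thesis using Cross rw_End.hyps by auto
  next
    case (End k')
    then have "k' < k" using rw_End.IH x by blast
    then show ?thesis using End by simp
  qed
  then show ?case using rw_End row_word_bounds[OF rw_End(1)] by (fastforce simp: sorted_wrt_append)
qed auto

lemma good_split: "good f (A @ Cross k j # B) \<Longrightarrow> ascent (run f A) j"
  by simp

definition rc_word :: "int \<Rightarrow> item list \<Rightarrow> bool" where
  "rc_word n xs \<longleftrightarrow> row_word xs (n + 1) (n + 1)"

lemma rc_word_lists:
  assumes "rc_word n xs" shows "lists n xs (cells n xs)"
proof -
  note r = row_word_sorted[OF assms[unfolded rc_word_def]]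
  have "i \<le> n \<and> k \<le> n" if "(i, k) \<in> cells n xs" for i k
  proof -
    have "Cross k (i + k - n - 1) \<in> set xs" using that cells_iff by simp
    then have "i + k - n - 1 < k \<and> (k < n + 1 \<or> k = n + 1 \<and> n + 1 \<le> i + k - n - 1)" using r by blast
    then show ?thesis by linarith
  qed
  then show ?thesis using r unfolding lists_def by auto
qed

lemma rc_word_reduced: "rc_word n xs \<Longrightarrow> reduced xs"
  using row_word_good good_split unfolding rc_word_def reduced_def ascent_def by blast

lemma rc_word_rc_graph: "rc_word n xs \<Longrightarrow> rc_graph n (cells n xs)"
  using rc_graph_iff_reduced[OF rc_word_lists] rc_word_reduced by blast

lemma rc_word_perm: "rc_word n xs \<Longrightarrow> rc_perm n (cells n xs) = inv (run ground xs)"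
  by (rule rc_perm_eq[OF rc_word_lists])

lemma rc_word_unique:
  assumes "rc_word n xs" "rc_word n ys" "cells n xs = cells n ys" shows "xs = ys"
proof (rule sorted_before_unique)
  note r = row_word_sorted[OF assms(1)[unfolded rc_word_def]] row_word_sorted[OF assms(2)[unfolded rc_word_def]]
  show "sorted_wrt before xs" "sorted_wrt before ys" using r by auto
  have "x \<in> set xs \<longleftrightarrow> x \<in> set ys" for x
    using r assms(3) Cross_iff[of _ _ xs n] Cross_iff[of _ _ ys n] by (cases x) auto
  then show "set xs = set ys" by blast
qed

text \<open>The unread part \<open>S\<close> tells which row is current, as exactly the markers from
  \<open>End k\<close> on are left in it. This decides which rule of \<open>row_word\<close> applies
  to the last item of the prefix.\<close>

lemma row_word_intro:
  assumes s: "sorted_wrt before (P @ S)" and b: "\<And>k j. Cross k j \<in> set (P @ S) \<Longrightarrow> 1 \<le> k \<and> k \<le> n \<and> j < k"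
    and e: "\<And>k. End k \<in> set (P @ S) \<longleftrightarrow> 1 \<le> k \<and> k \<le> n" and g: "good ground (P @ S)"
  shows "\<exists>k b. row_word P k b \<and> (\<forall>k' j. Cross k' j \<in> set S \<longrightarrow> k < k' \<or> k = k' \<and> j < b) \<and>
    (\<forall>k'. End k' \<in> set S \<longleftrightarrow> k \<le> k' \<and> k' \<le> n)"
  using assms
proof (induction P arbitrary: S rule: rev_induct)
  case Nil
  have "\<forall>k' j. Cross k' j \<in> set S \<longrightarrow> 1 < k' \<or> 1 = k' \<and> j < 1" using Nil(2) by force
  moreover have "\<forall>k'. End k' \<in> set S \<longleftrightarrow> 1 \<le> k' \<and> k' \<le> n" using Nil(3) by simp
  ultimately show ?case using row_word.rw_Nil by blast
next
  case (snoc x P)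
  have "\<exists>k b. row_word P k b \<and> (\<forall>k' j. Cross k' j \<in> set (x # S) \<longrightarrow> k < k' \<or> k = k' \<and> j < b) \<and>
    (\<forall>k'. End k' \<in> set (x # S) \<longleftrightarrow> k \<le> k' \<and> k' \<le> n)"
    by (rule snoc.IH) (use snoc.prems in \<open>auto\<close>)
  then obtain k b where h: "row_word P k b" "\<And>k' j. Cross k' j \<in> set (x # S) \<Longrightarrow> k < k' \<or> k = k' \<and> j < b"
    "\<And>k'. End k' \<in> set (x # S) \<longleftrightarrow> k \<le> k' \<and> k' \<le> n" by blast
  have xS: "before x z" if "z \<in> set S" for z using snoc.prems(1) that by (auto simp: sorted_wrt_append)
  show ?case
  proof (cases x)
    case (Cross k' j)
    have kn: "k' \<le> n" using snoc.prems(2)[of k' j] Cross by simp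
    have "k = k' \<and> j < b"
    proof -
      have "\<not> k < k'"
      proof
        assume lt: "k < k'"
        then have "End k \<in> set S" using h(3)[of k] kn Cross by auto
        then show False using xS Cross lt by fastforce
      qed
      then show ?thesis using h(2)[of k' j] Cross by auto
    qed
    then have "row_word (P @ [x]) k j" using row_word.rw_Cross[OF h(1)] snoc.prems(4) Cross by simp
    moreover have "k < k'' \<or> k = k'' \<and> j'' < j" if "Cross k'' j'' \<in> set S" for k'' j''
      using xS[OF that] Cross \<open>k = k' \<and> j < b\<close> by auto
    moreover have "End k'' \<in> set S \<longleftrightarrow> k \<le> k'' \<and> k'' \<le> n" for k'' using h(3) Cross by auto
    ultimately show ?thesis by blast
  next
    case (End k')
    have k': "k \<le> k'" "k' \<le> n" using h(3)[of k'] End by auto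
    have "k' = k"
    proof (rule ccontr)
      assume "k' \<noteq> k"
      then have "End k \<in> set S" using h(3)[of k] k' End by auto
      then show False using xS End k' by fastforce
    qed
    then have "row_word (P @ [x]) (k + 1) (k + 1)" using row_word.rw_End[OF h(1)] End by simp
    moreover have "k + 1 < k'' \<or> k + 1 = k'' \<and> j'' < k + 1" if "Cross k'' j'' \<in> set S" for k'' j''
      using xS[OF that] End \<open>k' = k\<close> snoc.prems(2)[of k'' j''] that by auto
    moreover have "End k'' \<in> set S \<longleftrightarrow> k + 1 \<le> k'' \<and> k'' \<le> n" for k''
      using h(3)[of k''] End \<open>k' = k\<close> xS[of "End k''"] by auto
    ultimately show ?thesis by blast
  qed
qed

text \<open>The danger is a crossing below row 1. Then the very first crossing of the word also lies
  in a row \<open>k \<le> 0\<close>, at a position \<open>j < k\<close>, and there it would cross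
  the two nonpositive labels \<open>j\<close> and \<open>j + 1\<close>.\<close>

lemma rc_word_exists:
  assumes n: "1 \<le> n" and rc: "rc_graph n R" and nc: "\<And>p q c. p \<le> 0 \<Longrightarrow> q \<le> 0 \<Longrightarrow> \<not> cross_at n R p q c"
  shows "\<exists>xs. rc_word n xs \<and> cells n xs = R"
proof -
  have fin: "finite R" and sub: "R \<subseteq> {..n} \<times> {..n}" using rc unfolding rc_graph_def by auto
  define S where "S = (\<lambda>(i, k). Cross k (i + k - n - 1)) ` R \<union> End ` {1..n}"
  have "finite S" unfolding S_def using fin by auto
  then obtain L where L: "sorted_wrt before L" "set L = S" using sorted_before_exists by blast
  have memR: "Cross k (i + k - n - 1) \<in> S \<longleftrightarrow> (i, k) \<in> R" for i k
    unfolding S_def by force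
  then have cR: "cells n L = R" unfolding cells_def L(2) by auto
  have lists: "lists n L R" unfolding lists_def using L cR sub by auto
  have red: "reduced L" using rc_graph_iff_reduced[OF lists] rc by simp
  have asc: "ascent (run ground A) j" if e: "L = A @ Cross k j # B" for A k j B
  proof -
    have lt: "run ground A j < run ground A (j + 1)" using red e unfolding reduced_def by blast
    then have "cross_at n R (run ground A j) (run ground A (j + 1)) (j + n + 1 - k, k)"
      using cross_at_split(2)[OF lists e] by auto
    then have "\<not> run ground A (j + 1) \<le> 0" using nc lt by (meson less_imp_le order_trans)
    then show ?thesis using lt unfolding ascent_def by simp
  qed
  have good: "good ground M" if "L = M @ N" for M N
    using that
  proof (induction M arbitrary: N rule: rev_induct)
    case (snoc x M)
    then have "good ground M" by simp
    moreover have "item_ok (run ground M) x"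
    proof (cases x)
      case (Cross k j)
      then show ?thesis using asc[of M k j N] snoc.prems by simp
    qed simp
    ultimately show ?case by simp
  qed simp
  have row_pos: "1 \<le> k" if c: "Cross k j \<in> set L" for k j
  proof (rule ccontr)
    assume n1: "\<not> 1 \<le> k"
    obtain A B where e: "L = A @ Cross k j # B" using c by (meson split_list)
    have rows: "k' \<le> 0" if "Cross k' j' \<in> set (A @ [Cross k j])" for k' j'
    proof -
      have "Cross k' j' = Cross k j \<or> before (Cross k' j') (Cross k j)"
        using that L(1) unfolding e by (auto simp: sorted_wrt_append)
      then show ?thesis using n1 by auto
    qed
    have noEnd: "End k' \<notin> set A" for k'
    proof
      assume E: "End k' \<in> set A"
      have "\<forall>x\<in>set A. before x (Cross k j)" using L(1) unfolding e by (simp add: sorted_wrt_append)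
      then have "before (End k') (Cross k j)" using E by blast
      moreover have "End k' \<in> S" using E e L(2) by auto
      then have "1 \<le> k'" unfolding S_def by auto
      ultimately show False using n1 by simp
    qed
    obtain k1 j1 A' where A': "A @ [Cross k j] = Cross k1 j1 # A'"
    proof (cases A)
      case (Cons a A'')
      then obtain k1 j1 where "a = Cross k1 j1" using noEnd by (cases a) auto
      then show ?thesis using that Cons by simp
    qed (use that in simp)
    have "L = [] @ Cross k1 j1 # (A' @ B)" using e A' by (metis append_Cons append_Nil append_assoc)
    then have "ascent ground j1" using asc by fastforce
    then have "0 < j1 + 1" unfolding ascent_def ground_def by simp
    moreover have "k1 \<le> 0" using rows[of k1 j1] A' by simp
    moreover have "j1 < k1" using listsD(3)[OF lists, of k1 j1] e A'
      by (metis Un_iff append.assoc append_Cons append_Nil list.set_intros(1) set_append)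
    ultimately show False by simp
  qed
  have "End n \<in> set L" unfolding L(2) S_def using n by auto
  then obtain P Q where PQ: "L = P @ End n # Q" by (meson split_list)
  have ends: "End k \<in> set L \<longleftrightarrow> 1 \<le> k \<and> k \<le> n" for k unfolding L(2) S_def by auto
  have "Q = []"
  proof (rule ccontr)
    assume "Q \<noteq> []"
    then obtain z where z: "z \<in> set Q" by (cases Q) auto
    then have "before (End n) z" using L(1) unfolding PQ by (auto simp: sorted_wrt_append)
    moreover have "z \<in> set L" using z PQ by simp
    ultimately show False using listsD(3)[OF lists] ends by (cases z) fastforce+
  qed
  have "\<exists>k b. row_word P k b \<and> (\<forall>k' j. Cross k' j \<in> set [End n] \<longrightarrow> k < k' \<or> k = k' \<and> j < b) \<and>
    (\<forall>k'. End k' \<in> set [End n] \<longleftrightarrow> k \<le> k' \<and> k' \<le> n)"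
  proof (rule row_word_intro)
    have PL: "P @ [End n] = L" using PQ \<open>Q = []\<close> by simp
    show "sorted_wrt before (P @ [End n])" unfolding PL using L by simp
    show "1 \<le> k \<and> k \<le> n \<and> j < k" if "Cross k j \<in> set (P @ [End n])" for k j
      using that listsD(3)[OF lists, of k j] row_pos unfolding PL by auto
    show "End k \<in> set (P @ [End n]) \<longleftrightarrow> 1 \<le> k \<and> k \<le> n" for k unfolding PL by (rule ends)
    show "good ground (P @ [End n])" unfolding PL using good[of L "[]"] by simp
  qed
  then obtain k b where kb: "row_word P k b" "\<And>k'. End k' \<in> set [End n] \<longleftrightarrow> k \<le> k' \<and> k' \<le> n" by blast
  have "k \<le> n" using kb(2)[of n] by simp
  then have "k = n" using kb(2)[of k] by simp
  then have "row_word L (n + 1) (n + 1)" using row_word.rw_End[OF kb(1)] PQ \<open>Q = []\<close> by simp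
  then show ?thesis unfolding rc_word_def using cR by blast
qed

lemma rc_word_nonpos:
  assumes "rc_word n xs" "p \<le> 0" "q \<le> 0" shows "\<not> cross_at n (cells n xs) p q c"
proof
  assume a: "cross_at n (cells n xs) p q c"
  obtain i k where c: "c = (i, k)" by (cases c)
  define j where "j = i + k - n - 1"
  have cc: "c = (j + n + 1 - k, k)" unfolding c j_def by simp
  have "Cross k j \<in> set xs" using a unfolding cross_at_def c cells_def j_def by auto
  then obtain A B where e: "xs = A @ Cross k j # B" by (meson split_list)
  have "{p, q} = {run ground A j, run ground A (j + 1)}"
    using cross_at_split(2)[OF rc_word_lists[OF assms(1)] e] a unfolding cc by simp
  moreover have "0 < run ground A (j + 1)"
    using row_word_good[OF assms(1)[unfolded rc_word_def]] e unfolding ascent_def by (auto simp: ascent_def)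
  ultimately show False using assms(2,3) by (auto simp: doubleton_eq_iff)
qed

text \<open>Strands of an rc-graph that cross do so once and end up inverted, whereas
  \<open>rc_perm\<close> increases on nonpositive labels. So the condition on \<open>w\<close> makes
  every diagram of \<open>w\<close> accessible to the sweep.\<close>

lemma nonpos_uncrossed:
  assumes rc: "rc_graph n R" and w: "\<forall>i\<le>0. rc_perm n R (i - 1) < rc_perm n R i" and pq: "p \<le> 0" "q \<le> 0"
  shows "\<not> cross_at n R p q c"
proof
  assume a: "cross_at n R p q c"
  have mono: "rc_perm n R u < rc_perm n R v" if "u < v" "v \<le> 0" for u v
    using that(1,2)
  proof (induction v rule: int_gr_induct)
    case base
    then show ?case using w by (metis add_diff_cancel_right')
  next
    case (step v)
    then have "rc_perm n R u < rc_perm n R v" by simp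
    also have "\<dots> < rc_perm n R (v + 1)" using w[rule_format, of "v + 1"] step by simp
    finally show ?case .
  qed
  have fin: "finite R" using rc unfolding rc_graph_def by auto
  obtain L where L: "sorted_wrt before L" "set L = (\<lambda>(i, k). Cross k (i + k - n - 1)) ` R"
    using sorted_before_exists[of "(\<lambda>(i, k). Cross k (i + k - n - 1)) ` R"] fin by blast
  have "cells n L = R" unfolding cells_def L(2) by force
  then have lists: "lists n L R" unfolding lists_def using L rc unfolding rc_graph_def by auto
  have red: "reduced L" using rc_graph_iff_reduced[OF lists] rc by simp
  obtain i k where c: "c = (i, k)" by (cases c)
  define j where "j = i + k - n - 1"
  have cc: "c = (j + n + 1 - k, k)" unfolding c j_def by simp
  have "Cross k j \<in> set L" using a unfolding cross_at_def c L(2) j_def by auto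
  then obtain A B where e: "L = A @ Cross k j # B" by (meson split_list)
  define u v where "u = run ground A j" and "v = run ground A (j + 1)"
  have eq: "{p, q} = {u, v}" using cross_at_split(2)[OF lists e] a unfolding cc u_def v_def by simp
  have uv: "u < v" using red e unfolding reduced_def u_def v_def by blast
  have "v \<le> 0" using eq pq by (auto simp: doubleton_eq_iff)
  have "1 \<le> crossings ground L u v" unfolding e crossings_split u_def v_def by simp
  then have "crossings ground L u v = 1" using reduced_crossings[OF red uv] by simp
  then have "inv (run ground L) v < inv (run ground L) u" using inverted_iff[OF uv] by simp
  then show False using mono[OF uv \<open>v \<le> 0\<close>] unfolding rc_perm_eq[OF lists] by simp
qed

section \<open>Insertion into rc-graphs\<close>

lemma row_word_prefix: "row_word (P @ Cross k l # Q) K b \<Longrightarrow> row_word (P @ [Cross k l]) k l"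
proof (induction Q arbitrary: K b rule: rev_induct)
  case Nil
  then show ?case using row_word_last_Cross by (metis append_Nil2)
next
  case (snoc x Q)
  have "row_word ((P @ Cross k l # Q) @ [x]) K b" using snoc.prems by simp
  then obtain K' b' where "row_word (P @ Cross k l # Q) K' b'"
    by (cases rule: row_word.cases) auto
  then show ?case by (rule snoc.IH)
qed

lemma row_word_prefix_End: "row_word (P @ End k # Q) K b \<Longrightarrow> \<exists>b'. row_word P k b'"
proof (induction Q arbitrary: K b rule: rev_induct)
  case Nil
  then show ?case by (cases rule: row_word.cases) auto
next
  case (snoc x Q)
  have "row_word ((P @ End k # Q) @ [x]) K b" using snoc.prems by simp
  then obtain K' b' where "row_word (P @ End k # Q) K' b'"
    by (cases rule: row_word.cases) auto
  then show ?case by (rule snoc.IH)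
qed

lemma row_word_red: "row_word xs k b \<Longrightarrow> 0 < run ground xs b"
proof (induction rule: row_word.induct)
  case (rw_Cross xs k b j)
  then show ?case unfolding ascent_def by simp
next
  case (rw_End xs k b)
  then show ?case using row_word_fix[OF rw_End(1), of "k + 1"] row_word_bounds[OF rw_End(1)] by simp
qed (simp add: ground_def)

text \<open>The insertion sees only bumps, the sweep goes through every item. This cuts the sweep at
  its next bump: until then the word is unchanged and the jump keeps its two labels.\<close>

lemma thru_bump_split:
  "thru g B (Jump p q) B' t \<Longrightarrow> B' = B \<or> (\<exists>B1 k l l' B2 B2'. B = B1 @ Cross k l # B2 \<and>
     thru g B1 (Jump p q) B1 (Jump (l + 1) l) \<and> run g B1 (l + 1) = g p \<and> run g B1 l = g q \<and>
     next_open (run g B1 \<circ> sw l) l l' \<and> thru (run g B1 \<circ> sw l) B2 (Jump (l' + 1) l') B2' t \<and>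
     B' = B1 @ Cross k l' # B2')"
proof (induction B arbitrary: g p q B')
  case (Cons x B)
  obtain y1 y2 s where h: "istep g x (Jump p q) y1 s" "thru (apply_item g x) B s y2 t" "B' = y1 @ y2"
    using Cons.prems by auto
  have pass: ?case if y: "y1 = [x]" and s: "s = Jump p' q'" and e: "apply_item g x p' = g p" "apply_item g x q' = g q"
    for p' q'
  proof -
    from Cons.IH[OF h(2)[unfolded s]] show ?thesis
    proof (elim disjE exE conjE)
      assume "y2 = B"
      then show ?thesis using h(3) y by simp
    next
      fix B1 k l l' B2 B2'
      assume a: "B = B1 @ Cross k l # B2" "thru (apply_item g x) B1 (Jump p' q') B1 (Jump (l + 1) l)"
        "run (apply_item g x) B1 (l + 1) = apply_item g x p'" "run (apply_item g x) B1 l = apply_item g x q'"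
        "next_open (run (apply_item g x) B1 \<circ> sw l) l l'"
        "thru (run (apply_item g x) B1 \<circ> sw l) B2 (Jump (l' + 1) l') B2' t" "y2 = B1 @ Cross k l' # B2'"
      have "istep g x (Jump p q) [x] (Jump p' q')" using h(1) y s by simp
      then have "thru g (x # B1) (Jump p q) (x # B1) (Jump (l + 1) l)"
        unfolding thru.simps using a(2) by (metis append_Cons append_Nil)
      then have "x # B = (x # B1) @ Cross k l # B2 \<and> thru g (x # B1) (Jump p q) (x # B1) (Jump (l + 1) l) \<and>
          run g (x # B1) (l + 1) = g p \<and> run g (x # B1) l = g q \<and>
          next_open (run g (x # B1) \<circ> sw l) l l' \<and> thru (run g (x # B1) \<circ> sw l) B2 (Jump (l' + 1) l') B2' t \<and>
          B' = (x # B1) @ Cross k l' # B2'"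
        using a e h(3) y by (simp del: comp_apply)
      then show ?thesis by blast
    qed
  qed
  show ?case
  proof (cases x)
    case (End k)
    then show ?thesis using h(1) by (intro pass[of p q]) auto
  next
    case (Cross k j)
    show ?thesis
    proof (cases "p = j + 1 \<and> q = j")
      case False
      then show ?thesis using h(1) Cross by (intro pass[of "sw j p" "sw j q"]) (auto simp: cstep_def)
    next
      case True
      then obtain j' where j': "next_open (g \<circ> sw j) j j'" "y1 = [Cross k j']" "s = Jump (j' + 1) j'"
        using h(1) Cross by (auto simp: cstep_def)
      have "x # B = [] @ Cross k j # B \<and> thru g [] (Jump p q) [] (Jump (j + 1) j) \<and>
          run g [] (j + 1) = g p \<and> run g [] j = g q \<and>
          next_open (run g [] \<circ> sw j) j j' \<and> thru (run g [] \<circ> sw j) B (Jump (j' + 1) j') y2 t \<and>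
          B' = [] @ Cross k j' # y2"
        using h(2,3) j' Cross True by (simp del: comp_apply)
      then show ?thesis by blast
    qed
  qed
qed simp

text \<open>Crossings further right do not move the particle at \<open>p\<close>. Hence the next
  bump cannot happen in the rest of the same row.\<close>

lemma thru_unchanged_position:
  "thru g B (Jump p q) B (Jump p' q') \<Longrightarrow> (\<And>k h. Cross k h \<in> set B \<Longrightarrow> h + 1 < p) \<Longrightarrow> p' = p"
proof (induction B arbitrary: g q)
  case (Cons x B)
  obtain y1 y2 s where h: "istep g x (Jump p q) y1 s" "thru (apply_item g x) B s y2 (Jump p' q')" "x # B = y1 @ y2"
    using Cons.prems(1) by auto
  show ?case
  proof (cases x)
    case (End k)
    then have "s = Jump p q" "y2 = B" using h by auto
    then show ?thesis using Cons.IH h(2) Cons.prems(2) by auto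
  next
    case (Cross k j)
    have jp: "j + 1 < p" using Cons.prems(2)[of k j] Cross by simp
    then have "s = Jump p (sw j q)" "y2 = B" using h Cross by (auto simp: cstep_def transpose_def)
    then show ?thesis using Cons.IH h(2) Cons.prems(2) by auto
  qed
qed simp

lemma open_space_prior:
  assumes L: "lists n (P @ Q) R" and k: "k \<le> n" "j < k"
    and P: "\<And>z. z \<in> set P \<Longrightarrow> before z (Cross k j)" and Q: "\<And>z. z \<in> set Q \<Longrightarrow> \<not> before z (Cross k j) \<and> z \<noteq> Cross k j"
  shows "open_space n R (j + n + 1 - k, k) \<longleftrightarrow> 0 < run ground P (j + 1) \<and> run ground P j \<le> 0"
proof -
  have "filter (\<lambda>y. before y (Cross k j)) (P @ Q) = P"
    using P Q by (auto simp: filter_id_conv filter_empty_conv)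
  then have pr: "prior (P @ Q) k j = run ground P" unfolding prior_def by simp
  have "Cross k j \<notin> set (P @ Q)" using P Q before_irrefl by auto
  then have nR: "(j + n + 1 - k, k) \<notin> R" using listsD(2)[OF L] by simp
  have b: "j + n + 1 - k \<le> n" using k by simp
  show ?thesis unfolding open_space_def enters_left_iff[OF L b k(1)] enters_bottom_iff[OF L b k(1)]
    using nR b k pr by auto
qed

text \<open>In a fixed row \<open>c\<close> is the shift from positions to columns. Open spaces are
  described by the state \<open>g\<close> only up to \<open>b\<close>, which suffices as the search
  ends before.\<close>

lemma least_open:
  assumes "\<And>j. lo < j \<Longrightarrow> j < b \<Longrightarrow> P (j + c) \<longleftrightarrow> 0 < (g :: int \<Rightarrow> int) (j + 1) \<and> g j \<le> 0"
    and "next_open g lo m" "m < b"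
  shows "least_element {i. lo + c < i \<and> P i} i \<longleftrightarrow> i = m + c"
proof -
  have m: "lo < m" "0 < g (m + 1)" "\<And>r. lo < r \<Longrightarrow> r \<le> m \<Longrightarrow> g r \<le> 0" using assms(2) unfolding next_open_def by auto
  have 1: "P (m + c)" using assms(1)[of m] m assms(3) by simp
  have 2: "\<not> P i" if "lo + c < i" "i < m + c" for i
  proof -
    have "P ((i - c) + c) \<longleftrightarrow> 0 < g (i - c + 1) \<and> g (i - c) \<le> 0"
      by (rule assms(1)) (use that assms(3) in auto)
    moreover have "g (i - c + 1) \<le> 0" by (rule m(3)) (use that in auto)
    ultimately show ?thesis by simp
  qed
  have mem: "m + c \<in> {i. lo + c < i \<and> P i}" using 1 m by simp
  have low: "m + c \<le> i" if "i \<in> {i. lo + c < i \<and> P i}" for i using 2[of i] that by (cases "i < m + c") auto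
  show ?thesis unfolding least_element_def using mem low by (meson order_antisym)
qed

lemma sorted_sublist: "sorted_wrt before (A @ x # B) \<Longrightarrow> sorted_wrt before (A @ B)"
  by (auto simp: sorted_wrt_append)

lemma lists_remove:
  assumes L: "lists n (A @ Cross k j # B) R"
  shows "lists n (A @ B) (R - {(j + n + 1 - k, k)})"
proof -
  have d: "Cross k j \<notin> set (A @ B)" using sorted_before_distinct[OF listsD(1)[OF L]] by auto
  have "(i, k') \<in> cells n (A @ B) \<longleftrightarrow> (i, k') \<in> R - {(j + n + 1 - k, k)}" for i k'
  proof (cases "k' = k \<and> i = j + n + 1 - k")
    case True
    then show ?thesis using d by (simp add: cells_iff)
  next
    case False
    then have "Cross k' (i + k' - n - 1) \<noteq> Cross k j" by auto
    then show ?thesis using listsD(2)[OF L, of i k'] False by (auto simp: cells_iff)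
  qed
  then have "cells n (A @ B) = R - {(j + n + 1 - k, k)}" by auto
  then show ?thesis using L sorted_sublist unfolding lists_def by auto
qed

lemma lists_insert:
  assumes "lists n (A @ B) R" "sorted_wrt before (A @ Cross k j # B)" "j < k" "k \<le> n"
  shows "lists n (A @ Cross k j # B) (insert (j + n + 1 - k, k) R)"
proof -
  have "cells n (A @ Cross k j # B) = insert (j + n + 1 - k, k) R"
    using listsD(2)[OF assms(1)] by (auto simp: cells_iff)
  then show ?thesis using assms unfolding lists_def by auto
qed

lemma run_relabel: "run (\<pi> \<circ> f) L = \<pi> \<circ> run f L"
proof (induction L arbitrary: f)
  case (Cons x L)
  have "apply_item (\<pi> \<circ> f) x = \<pi> \<circ> apply_item f x" by (cases x) (auto simp: comp_assoc)
  then show ?case using Cons by (simp del: comp_apply)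
qed (simp del: comp_apply)

lemma transpose_pair: "{transpose u v x, transpose u v y} = {u, v} \<Longrightarrow> {x, y} = {u, v}"
proof -
  assume "{transpose u v x, transpose u v y} = {u, v}"
  then have "transpose u v ` {transpose u v x, transpose u v y} = transpose u v ` {u, v}" by simp
  then show ?thesis by auto
qed

text \<open>
  The state of the insertion when \<open>Cross k j\<close> has just been added between the finished part \<open>A\<close> and
  the untouched part \<open>B\<close>; \<open>ys\<close> is the word that will finally come out.
\<close>

definition stage :: "int \<Rightarrow> item list \<Rightarrow> cell set \<Rightarrow> cell \<Rightarrow> item list \<Rightarrow> int \<Rightarrow> int \<Rightarrow> item list \<Rightarrow> bool" where
  "stage n ys S c A k j B \<longleftrightarrow> lists n (A @ Cross k j # B) S \<and> c = (j + n + 1 - k, k) \<and>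
     good (run ground A) B \<and> jump (run ground A) (j + 1) j \<and>
     (\<exists>B' t. thru (run ground A) B (Jump (j + 1) j) B' t \<and> ys = A @ Cross k j # B')"

text \<open>Behind the new crossing the labels \<open>g j\<close> and \<open>g (j + 1)\<close> are
  interchanged, but as a pair they cross where they crossed before. Since \<open>A @ B\<close> is
  reduced, that is in at most one place, and if it occurs in \<open>B\<close>, it is the next bump
  of the sweep. So the cell to be removed and the next open space are forced.\<close>

lemma stage_step:
  assumes ys: "rc_word n ys" and st: "stage n ys S c A k j B"
  shows "(S = cells n ys \<and> rc_graph n S) \<or>
    (\<not> rc_graph n S \<and> (\<exists>d i B2 A2 k' l'. (\<exists>p q. cross_at n S p q c \<and> cross_at n S p q d) \<and> snd c < snd d \<and>
      (\<forall>p q d'. cross_at n S p q c \<longrightarrow> cross_at n S p q d' \<longrightarrow> snd c < snd d' \<longrightarrow> d' = d) \<and>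
      snd d = k' \<and>
      (\<forall>i'. least_element {i. fst d < i \<and> open_space n (S - {d}) (i, k')} i' \<longleftrightarrow> i' = i) \<and>
      stage n ys (insert (i, k') (S - {d})) (i, k') A2 k' l' B2 \<and> length B2 < length B))"
proof -
  define g where "g = run ground A"
  have L: "lists n (A @ Cross k j # B) S" and c: "c = (j + n + 1 - k, k)" and gB: "good g B"
    and J: "jump g (j + 1) j" using st unfolding stage_def g_def by auto
  obtain B' t where B': "thru g B (Jump (j + 1) j) B' t" "ys = A @ Cross k j # B'"
    using st unfolding stage_def g_def by auto
  note rw = ys[unfolded rc_word_def]
  have rwc: "row_word (A @ [Cross k j]) k j" using row_word_prefix rw B'(2) by blast
  have gA: "good ground A" using row_word_good[OF rwc] by simp
  from thru_bump_split[OF B'(1)] show ?thesis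
  proof (elim disjE exE conjE)
    assume "B' = B"
    then have "S = cells n ys" using B'(2) L unfolding lists_def by simp
    then show ?thesis using rc_word_rc_graph[OF ys] by simp
  next
    fix B1 k' l l' B2 B2'
    assume e: "B = B1 @ Cross k' l # B2" and t1: "thru g B1 (Jump (j + 1) j) B1 (Jump (l + 1) l)"
      and lab: "run g B1 (l + 1) = g (j + 1)" "run g B1 l = g j"
      and no: "next_open (run g B1 \<circ> sw l) l l'" and t2: "thru (run g B1 \<circ> sw l) B2 (Jump (l' + 1) l') B2' t"
      and eB': "B' = B1 @ Cross k' l' # B2'"
    define A2 where "A2 = A @ Cross k j # B1"
    define d where "d = (l + n + 1 - k', k')"
    have L2: "lists n (A2 @ Cross k' l # B2) S" using L unfolding A2_def e by simp
    have ys2: "ys = A2 @ Cross k' l' # B2'" unfolding A2_def B'(2) eB' by simp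
    have sA2: "run ground A2 = run g B1 \<circ> sw l"
      using thru_state[OF t1] unfolding A2_def g_def by (simp add: transpose_adjacent)
    have rw2: "row_word (A2 @ [Cross k' l']) k' l'" using row_word_prefix rw ys2 by blast
    then obtain b where b: "row_word A2 k' b" "l' < b" using row_word_last_Cross by blast
    note srt = row_word_sorted[OF b(1)]
    have "before (Cross k j) (Cross k' l)" using listsD(1)[OF L] unfolding e by (simp add: sorted_wrt_append)
    then have kk: "k < k' \<or> k = k' \<and> l < j" by simp
    \<comment> \<open>Crossings further right in row \<open>k\<close> leave the particle at
      \<open>j + 1\<close>, so none of them can be the one at \<open>l\<close>, where the particle
      is at \<open>l + 1\<close>.\<close>
    have lt: "k < k'"
    proof (rule ccontr)
      assume "\<not> k < k'"
      then have eq: "k = k'" "l < j" using kk by auto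
      have "h + 1 < j + 1" if h: "Cross k'' h \<in> set B1" for k'' h
      proof -
        have "before (Cross k j) (Cross k'' h)" "before (Cross k'' h) (Cross k' l)"
          using listsD(1)[OF L] h unfolding e by (auto simp: sorted_wrt_append simp del: before.simps)
        then show ?thesis using eq by auto
      qed
      then have "l + 1 = j + 1" using thru_unchanged_position[OF t1] by blast
      then show False using eq by simp
    qed
    have gj: "g j \<noteq> g (j + 1)" using run_adjacent unfolding g_def .
    have cc: "cross_at n S p q c \<longleftrightarrow> p \<noteq> q \<and> {p, q} = {g j, g (j + 1)}" for p q
      using cross_at_split(2)[OF L refl] unfolding c g_def .
    have cd: "cross_at n S (g j) (g (j + 1)) d"
      using cross_at_split(2)[OF L2 refl] gj lab unfolding d_def sA2 by auto
    have cgg: "cross_at n S (g j) (g (j + 1)) c" using cc gj by simp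
    have ne: "c \<noteq> d" using lt unfolding c d_def by auto
    have nrc: "\<not> rc_graph n S" using cd cgg ne unfolding rc_graph_def by blast
    have AB: "lists n (A @ B) (S - {c})" using lists_remove[OF L] unfolding c .
    have redAB: "reduced (A @ B)"
    proof -
      have "good ground (A @ B)" using gA gB unfolding g_def by simp
      then show ?thesis using good_split unfolding reduced_def ascent_def by metis
    qed
    have rcAB: "rc_graph n (S - {c})" using rc_graph_iff_reduced[OF AB] redAB by simp
    \<comment> \<open>Removing \<open>c\<close> relabels everything read after it by the
      transposition \<open>\<pi>\<close>, which maps the pair of labels to itself. A partner of
      \<open>c\<close> thus remains a crossing of that pair in an rc-graph.\<close>
    have partner: "cross_at n (S - {c}) (g j) (g (j + 1)) d'" "d' \<noteq> c"
      if p: "cross_at n S p q c" "cross_at n S p q d'" "snd c < snd d'" for p q d'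
    proof -
      show d'c: "d' \<noteq> c" using p(3) by auto
      obtain i0 k0 where d': "d' = (i0, k0)" by (cases d')
      define h where "h = i0 + k0 - n - 1"
      have dh: "d' = (h + n + 1 - k0, k0)" unfolding d' h_def by simp
      have "Cross k0 h \<in> set (A @ Cross k j # B)" using p(2) listsD(2)[OF L] unfolding cross_at_def d' h_def by auto
      moreover have "Cross k0 h \<noteq> Cross k j" using p(3) unfolding c d' by auto
      moreover have "Cross k0 h \<notin> set A"
      proof
        assume "Cross k0 h \<in> set A"
        then have "before (Cross k0 h) (Cross k j)"
          using listsD(1)[OF L] by (auto simp: sorted_wrt_append simp del: before.simps)
        then show False using p(3) unfolding c d' by auto
      qed
      ultimately have "Cross k0 h \<in> set B" unfolding set_append set_simps by blast
      then obtain E1 E2 where E: "B = E1 @ Cross k0 h # E2" by (meson split_list)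
      define \<pi> where "\<pi> = transpose (g j) (g (j + 1))"
      have inj: "g a = g b \<longleftrightarrow> a = b" for a b
        unfolding g_def by (metis run_inv)
      have "g \<circ> sw j = \<pi> \<circ> g" unfolding \<pi>_def using inj by (auto simp: fun_eq_iff transpose_def)
      then have r1: "run ground (A @ Cross k j # E1) = \<pi> \<circ> run ground (A @ E1)"
        using run_relabel[of \<pi> g E1] unfolding g_def by (simp del: comp_apply)
      have "{p, q} = {\<pi> (run ground (A @ E1) h), \<pi> (run ground (A @ E1) (h + 1))}" "p \<noteq> q"
        using cross_at_split(2)[of n "A @ Cross k j # B" S "A @ Cross k j # E1" k0 h E2 p q] L E p(2) r1
        unfolding dh by auto
      moreover have "{p, q} = {g j, g (j + 1)}" using cc p(1) by simp
      ultimately have "{run ground (A @ E1) h, run ground (A @ E1) (h + 1)} = {g j, g (j + 1)}"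
        unfolding \<pi>_def using transpose_pair by metis
      then show "cross_at n (S - {c}) (g j) (g (j + 1)) d'"
        using cross_at_split(2)[of n "A @ B" "S - {c}" "A @ E1" k0 h E2 "g j" "g (j + 1)"] AB E gj unfolding dh by auto
    qed
    have dpart: "cross_at n (S - {c}) (g j) (g (j + 1)) d"
      using partner(1)[OF cgg cd] lt unfolding c d_def by simp
    have uniq: "d' = d" if "cross_at n S p q c" "cross_at n S p q d'" "snd c < snd d'" for p q d'
      using partner(1)[OF that] dpart rcAB unfolding rc_graph_def by blast
    have L3: "lists n (A2 @ B2) (S - {d})" using lists_remove[OF L2] unfolding d_def .
    have k'n: "k' \<le> n" using listsD(3)[OF L2, of k' l] by simp
    have bk: "b \<le> k'" using row_word_bounds[OF b(1)] by simp
    have op: "open_space n (S - {d}) (j' + (n + 1 - k'), k') \<longleftrightarrow> 0 < run ground A2 (j' + 1) \<and> run ground A2 j' \<le> 0"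
      if j': "l < j'" "j' < b" for j'
    proof -
      have "before z (Cross k' j')" if z: "z \<in> set A2" for z
      proof (cases z)
        case (Cross k'' h)
        then have "k'' < k' \<or> k'' = k' \<and> b \<le> h" using srt z by blast
        then show ?thesis using Cross j' by auto
      next
        case (End k'')
        then have "k'' < k'" using srt z by blast
        then show ?thesis using End by simp
      qed
      moreover have "\<not> before z (Cross k' j') \<and> z \<noteq> Cross k' j'" if z: "z \<in> set B2" for z
      proof -
        have "before (Cross k' l) z" using listsD(1)[OF L2] z by (auto simp: sorted_wrt_append simp del: before.simps)
        then show ?thesis using j' by (cases z) auto
      qed
      moreover have "j' < k'" using j' bk by simp
      moreover have "j' + (n + 1 - k') = j' + n + 1 - k'" by simp
      ultimately show ?thesis using open_space_prior[OF L3 k'n] by metis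
    qed
    have least: "least_element {i. fst d < i \<and> open_space n (S - {d}) (i, k')} i' \<longleftrightarrow> i' = l' + (n + 1 - k')" for i'
      using least_open[of l b "\<lambda>i. open_space n (S - {d}) (i, k')" "n + 1 - k'" "run ground A2" l' i'] op no b(2)
      unfolding sA2 d_def by (simp add: algebra_simps)
    have ll: "l < l'" using no unfolding next_open_def by simp
    have sorted2: "sorted_wrt before (A2 @ Cross k' l' # B2)"
    proof -
      have "before (Cross k' l') z" if z: "z \<in> set B2" for z
      proof -
        have "before (Cross k' l) z" using listsD(1)[OF L2] z by (auto simp: sorted_wrt_append simp del: before.simps)
        then show ?thesis using ll by (cases z) auto
      qed
      moreover have "sorted_wrt before (A2 @ [Cross k' l'])" using row_word_sorted[OF rw2] by simp
      ultimately show ?thesis using listsD(1)[OF L3] by (auto simp: sorted_wrt_append simp del: before.simps)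
    qed
    have "lists n (A2 @ Cross k' l' # B2) (insert (l' + n + 1 - k', k') (S - {d}))"
      using lists_insert[OF L3 sorted2] b(2) bk k'n by simp
    moreover have "good (run ground A2) B2" using gB unfolding sA2 e by simp
    moreover have "jump (run ground A2) (l' + 1) l'" using no ll unfolding sA2 next_open_def jump_def by auto
    ultimately have "stage n ys (insert (l' + (n + 1 - k'), k') (S - {d})) (l' + (n + 1 - k'), k') A2 k' l' B2"
      using t2 ys2 unfolding stage_def sA2 by (auto simp: algebra_simps simp del: comp_apply)
    moreover have "\<exists>p q. cross_at n S p q c \<and> cross_at n S p q d" using cd cgg by blast
    moreover have "snd c < snd d" "snd d = k'" using lt unfolding c d_def by simp_all
    moreover have "\<forall>p q d'. cross_at n S p q c \<longrightarrow> cross_at n S p q d' \<longrightarrow> snd c < snd d' \<longrightarrow> d' = d"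
      using uniq by blast
    moreover have "\<forall>i'. least_element {i. fst d < i \<and> open_space n (S - {d}) (i, k')} i' \<longleftrightarrow> i' = l' + (n + 1 - k')"
      using least by blast
    moreover have "length B2 < length B" unfolding e by simp
    ultimately have "\<exists>d i B2 A2 k' l'. (\<exists>p q. cross_at n S p q c \<and> cross_at n S p q d) \<and> snd c < snd d \<and>
      (\<forall>p q d'. cross_at n S p q c \<longrightarrow> cross_at n S p q d' \<longrightarrow> snd c < snd d' \<longrightarrow> d' = d) \<and>
      snd d = k' \<and>
      (\<forall>i'. least_element {i. fst d < i \<and> open_space n (S - {d}) (i, k')} i' \<longleftrightarrow> i' = i) \<and>
      stage n ys (insert (i, k') (S - {d})) (i, k') A2 k' l' B2 \<and> length B2 < length B"
      by - (rule exI[of _ d], rule exI[of _ "l' + (n + 1 - k')"], rule exI[of _ B2], rule exI[of _ A2],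
          rule exI[of _ k'], rule exI[of _ l'], intro conjI, assumption+)
    then show ?thesis using nrc by blast
  qed
qed

text \<open>Right of the last crossing \<open>b\<close> of row \<open>x\<close>, every cell sees the
  state at \<open>End x\<close>. Its rightmost boundary between holes and particles lies there, and
  is therefore the smallest open column.\<close>

lemma stage_start:
  assumes xs: "rc_word n xs" and t: "thru ground xs (Wait x) ys (Jump p q)"
  shows "\<exists>i A j B. (\<forall>i'. least_element {i. open_space n (cells n xs) (i, x)} i' \<longleftrightarrow> i' = i) \<and>
    stage n ys (insert (i, x) (cells n xs)) (i, x) A x j B"
proof -
  have L: "lists n xs (cells n xs)" by (rule rc_word_lists[OF xs])
  have "\<not> x \<notin> set (ends xs)"
  proof
    assume "x \<notin> set (ends xs)"
    then have "thru f xs (Wait x) xs (Wait x)" for f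
    proof (induction xs arbitrary: f)
      case (Cons z zs)
      then show ?case by (cases z) auto
    qed simp
    then show False using thru_unique[OF t] by blast
  qed
  then have "x \<in> set (ends xs)" by simp
  then have "End x \<in> set xs" by (induction xs rule: ends.induct) auto
  then obtain A B where e: "xs = A @ End x # B" by (meson split_list)
  obtain b where b: "row_word A x b" using row_word_prefix_End xs[unfolded rc_word_def] unfolding e by blast
  define f where "f = run ground A"
  obtain y1 s1 y2 where y: "thru ground A (Wait x) y1 s1" "thru f (End x # B) s1 y2 (Jump p q)" "ys = y1 @ y2"
    using t unfolding e thru_append f_def by blast
  have nA: "x \<notin> set (ends A)" using row_word_ends[OF b] by auto
  then have "thru g A (Wait x) A (Wait x)" for g
  proof (induction A arbitrary: g)
    case (Cons z zs)
    then show ?case by (cases z) auto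
  qed simp
  then have yA: "y1 = A" "s1 = Wait x" using thru_unique[OF y(1)] by auto
  obtain j B' where j: "rightmost f j" "thru f B (Jump (j + 1) j) B' (Jump p q)" "y2 = Cross x j # End x # B'"
    using y(2) unfolding yA by auto
  have ysE: "ys = A @ Cross x j # End x # B'" using y(3) yA j by simp
  have "0 < f b" using row_word_red[OF b] unfolding f_def .
  then have jb: "j < b" using j(1) unfolding rightmost_def by (meson leI not_le)
  have bx: "b \<le> x" using row_word_bounds[OF b] by simp
  have xn: "x \<le> n"
  proof -
    have "x \<in> set (ends xs)" unfolding e by simp
    then show ?thesis using row_word_ends[OF xs[unfolded rc_word_def]] by simp
  qed
  note srt = row_word_sorted[OF b]
  have A_before: "before z (Cross x j')" if z: "z \<in> set A" and j': "j' < b" for z j'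
  proof (cases z)
    case (Cross k'' h)
    then have "k'' < x \<or> k'' = x \<and> b \<le> h" using srt z by blast
    then show ?thesis using Cross j' by auto
  next
    case (End k'')
    then have "k'' < x" using srt z by blast
    then show ?thesis using End by simp
  qed
  have B_after: "\<not> before z (Cross x j') \<and> z \<noteq> Cross x j' \<and> before (Cross x j') z"
    if z: "z \<in> set (End x # B)" for z j'
  proof -
    have "z = End x \<or> before (End x) z" using listsD(1)[OF L] z unfolding e
      by (auto simp: sorted_wrt_append simp del: before.simps)
    then show ?thesis by (cases z) auto
  qed
  have op: "open_space n (cells n xs) (j' + (n + 1 - x), x) \<longleftrightarrow> 0 < f (j' + 1) \<and> f j' \<le> 0" if j': "j' < b" for j'
  proof -
    have "j' < x" using j' bx by simp
    moreover have "j' + (n + 1 - x) = j' + n + 1 - x" by simp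
    ultimately show ?thesis
      using open_space_prior[OF L[unfolded e] xn, of j'] A_before[OF _ j'] B_after unfolding f_def e by metis
  qed
  define i where "i = j + (n + 1 - x)"
  have least: "least_element {i. open_space n (cells n xs) (i, x)} i' \<longleftrightarrow> i' = i" for i'
  proof -
    have 1: "open_space n (cells n xs) (i, x)" unfolding i_def using op[OF jb] j(1) unfolding rightmost_def by auto
    have 2: "\<not> open_space n (cells n xs) (i'', x)" if "i'' < i" for i''
    proof -
      have "open_space n (cells n xs) ((i'' - (n + 1 - x)) + (n + 1 - x), x) \<longleftrightarrow>
          0 < f (i'' - (n + 1 - x) + 1) \<and> f (i'' - (n + 1 - x)) \<le> 0"
        by (rule op) (use that jb in \<open>simp add: i_def\<close>)
      moreover have "f (i'' - (n + 1 - x) + 1) \<le> 0"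
        using j(1) that unfolding rightmost_def i_def by simp
      ultimately show ?thesis by simp
    qed
    have "i \<le> i''" if "open_space n (cells n xs) (i'', x)" for i'' using 2[of i''] that by (cases "i'' < i") auto
    then show ?thesis unfolding least_element_def using 1 by (auto intro: order_antisym)
  qed
  have srt2: "sorted_wrt before (A @ Cross x j # End x # B)"
    using listsD(1)[OF L] A_before[OF _ jb] B_after unfolding e by (auto simp: sorted_wrt_append simp del: before.simps)
  have "lists n (A @ Cross x j # End x # B) (insert (j + n + 1 - x, x) (cells n xs))"
    using lists_insert[OF L[unfolded e] srt2] jb bx xn unfolding e by simp
  moreover have "good f (End x # B)" using row_word_good[OF xs[unfolded rc_word_def]] unfolding e f_def by simp
  moreover have "jump f (j + 1) j" using rightmost_jump[OF j(1)] by simp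
  moreover have "thru f (End x # B) (Jump (j + 1) j) (End x # B') (Jump p q)" using j(2) by simp
  moreover have "i = j + n + 1 - x" unfolding i_def by simp
  ultimately have "stage n ys (insert (i, x) (cells n xs)) (i, x) A x j (End x # B)"
    unfolding stage_def f_def[symmetric] ysE by blast
  then show ?thesis using least by blast
qed

lemma rc_word_thru:
  assumes "rc_word n xs" "thru ground xs (Wait x) ys t" shows "rc_word n ys"
proof -
  obtain b where b: "row_word ys (n + 1) b" "n + 1 \<le> b"
    using row_word_thru[OF assms(1)[unfolded rc_word_def] assms(2)] by blast
  then have "b = n + 1" using row_word_bounds[OF b(1)] by simp
  then show ?thesis using b unfolding rc_word_def by simp
qed

text \<open>The rule \<open>bump\<close> leaves the strands and cells to be chosen, but
  \<open>stage_step\<close> shows that the choice of cells is forced, so no run of the insertion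
  leaves the path of the sweep.\<close>

lemma insertion_step_stage:
  assumes xs: "rc_word n xs" and t: "thru ground xs (Wait x) ys (Jump p q)"
    and s: "insertion_step n (cells n xs) x S c"
  shows "\<exists>A k j B. stage n ys S c A k j B"
  using s
proof induction
  case (first i)
  obtain i' A j B where "\<And>i''. least_element {i. open_space n (cells n xs) (i, x)} i'' \<longleftrightarrow> i'' = i'"
    "stage n ys (insert (i', x) (cells n xs)) (i', x) A x j B" using stage_start[OF xs t] by blast
  moreover then have "i = i'" using first by simp
  ultimately show ?case by blast
next
  case (bump S i k a b l k' i')
  then obtain A k0 j B where st: "stage n ys S (i, k) A k0 j B" by blast
  from stage_step[OF rc_word_thru[OF xs t] st] bump.hyps(2) obtain d i0 B2 A2 k2 l2 where
    h: "\<And>p q d'. cross_at n S p q (i, k) \<Longrightarrow> cross_at n S p q d' \<Longrightarrow> k < snd d' \<Longrightarrow> d' = d"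
      "snd d = k2" "\<And>i'. least_element {i. fst d < i \<and> open_space n (S - {d}) (i, k2)} i' \<longleftrightarrow> i' = i0"
      "stage n ys (insert (i0, k2) (S - {d})) (i0, k2) A2 k2 l2 B2"
    unfolding snd_conv by blast
  have d: "(l, k') = d" using h(1)[OF bump.hyps(3,4)] bump.hyps(5) by simp
  then have "k2 = k'" "fst d = l" using h(2) by auto
  then have "i' = i0" using h(3) bump.hyps(6) d by simp
  then show ?case using h(4) \<open>k2 = k'\<close> d by blast
qed

text \<open>Every bump shortens the untouched part \<open>B\<close>: this is the termination of the
  insertion.\<close>

lemma stage_reaches:
  assumes ys: "rc_word n ys" and st: "stage n ys S c A k j B" and s: "insertion_step n R x S c"
  shows "\<exists>c'. insertion_step n R x (cells n ys) c'"
  using st s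
proof (induction "length B" arbitrary: S c A k j B rule: less_induct)
  case less
  obtain i0 k0 where c: "c = (i0, k0)" by (cases c)
  from stage_step[OF ys less.prems(1)] show ?case
  proof (elim disjE exE conjE)
    assume "S = cells n ys"
    then show ?thesis using less.prems(2) by blast
  next
    fix d i B2 A2 k' l' p q
    assume nrc: "\<not> rc_graph n S" and x: "cross_at n S p q c" "cross_at n S p q d" and lt: "snd c < snd d" "snd d = k'"
      and le: "\<forall>i'. least_element {i. fst d < i \<and> open_space n (S - {d}) (i, k')} i' \<longleftrightarrow> i' = i"
      and st: "stage n ys (insert (i, k') (S - {d})) (i, k') A2 k' l' B2" and len: "length B2 < length B"
    obtain l where d: "d = (l, k')" using lt by (cases d) auto
    have "insertion_step n R x (insert (i, k') (S - {(l, k')})) (i, k')"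
      by (rule insertion_step.bump[of n R x S i0 k0 p q]) (use less.prems(2) nrc x lt le in \<open>auto simp: c d\<close>)
    then show ?thesis using less.hyps[OF len st] d by blast
  qed
qed

lemma insert_letter_iff:
  assumes xs: "rc_word n xs" and x: "x \<in> {1..n}"
  shows "insert_letter n (cells n xs) x S \<longleftrightarrow> (\<exists>ys p q. thru ground xs (Wait x) ys (Jump p q) \<and> S = cells n ys)"
proof -
  note g = row_word_good[OF xs[unfolded rc_word_def]]
  obtain ys t where t: "thru ground xs (Wait x) ys t" using thru_total[OF tame_ground _ g, of "Wait x"] by auto
  have "x \<in> set (ends xs)" using row_word_ends[OF xs[unfolded rc_word_def]] x by simp
  then obtain p q where [simp]: "t = Jump p q" using thru_Wait[of ground xs "Wait x" ys] t by (cases t) auto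
  have t': "thru ground xs (Wait x) ys (Jump p q)" using t by simp
  have ys: "rc_word n ys" by (rule rc_word_thru[OF xs t])
  have reach: "\<exists>c. insertion_step n (cells n xs) x (cells n ys) c"
  proof -
    obtain i A j B where s: "\<And>i'. least_element {i. open_space n (cells n xs) (i, x)} i' \<longleftrightarrow> i' = i"
      "stage n ys (insert (i, x) (cells n xs)) (i, x) A x j B" using stage_start[OF xs t'] by blast
    have "insertion_step n (cells n xs) x (insert (i, x) (cells n xs)) (i, x)"
      by (rule insertion_step.first) (use s(1) in blast)
    then show ?thesis using stage_reaches[OF ys s(2)] by blast
  qed
  show ?thesis
  proof
    assume a: "insert_letter n (cells n xs) x S"
    then obtain c where c: "insertion_step n (cells n xs) x S c" "rc_graph n S" unfolding insert_letter_def by blast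
    obtain A k j B where "stage n ys S c A k j B" using insertion_step_stage[OF xs t' c(1)] by blast
    then have "S = cells n ys" using stage_step[OF ys] c(2) by blast
    then show "\<exists>ys p q. thru ground xs (Wait x) ys (Jump p q) \<and> S = cells n ys" using t' by blast
  next
    assume "\<exists>ys p q. thru ground xs (Wait x) ys (Jump p q) \<and> S = cells n ys"
    then have "S = cells n ys" using thru_unique[OF t] by blast
    then show "insert_letter n (cells n xs) x S"
      unfolding insert_letter_def using reach rc_word_rc_graph[OF ys] by blast
  qed
qed

lemma insert_word_iff:
  assumes "rc_word n xs" "set v \<subseteq> {1..n}"
  shows "insert_word n (cells n xs) v S \<longleftrightarrow>
    (\<exists>ys C. mthru ground xs (map Wait v) ys C \<and> rc_word n ys \<and> S = cells n ys)"
  using assms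
proof (induction v arbitrary: xs)
  case Nil
  then show ?case by auto
next
  case (Cons x v)
  have x: "x \<in> {1..n}" "set v \<subseteq> {1..n}" using Cons.prems by auto
  show ?case
  proof
    assume "insert_word n (cells n xs) (x # v) S"
    then obtain T where T: "insert_letter n (cells n xs) x T" "insert_word n T v S" by auto
    then obtain zs p q where z: "thru ground xs (Wait x) zs (Jump p q)" "T = cells n zs"
      using insert_letter_iff[OF Cons.prems(1) x(1)] by blast
    have "rc_word n zs" by (rule rc_word_thru[OF Cons.prems(1) z(1)])
    then obtain ys C where "mthru ground zs (map Wait v) ys C" "rc_word n ys" "S = cells n ys"
      using Cons.IH[OF _ x(2)] T(2) z(2) by blast
    then have "mthru ground xs (map Wait (x # v)) ys (Jump p q # C) \<and> rc_word n ys \<and> S = cells n ys"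
      using z by auto
    then show "\<exists>ys C. mthru ground xs (map Wait (x # v)) ys C \<and> rc_word n ys \<and> S = cells n ys" by blast
  next
    assume "\<exists>ys C. mthru ground xs (map Wait (x # v)) ys C \<and> rc_word n ys \<and> S = cells n ys"
    then obtain ys zs t C where z: "thru ground xs (Wait x) zs t" "mthru ground zs (map Wait v) ys C"
      "rc_word n ys" "S = cells n ys" by auto
    have "x \<in> set (ends xs)" using row_word_ends[OF Cons.prems(1)[unfolded rc_word_def]] x by simp
    then obtain p q where t: "t = Jump p q" using thru_Wait[of ground xs "Wait x" zs] z(1) by (cases t) auto
    have rz: "rc_word n zs" by (rule rc_word_thru[OF Cons.prems(1) z(1)])
    have "insert_letter n (cells n xs) x (cells n zs)" using insert_letter_iff[OF Cons.prems(1) x(1)] z(1) t by blast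
    moreover have "insert_word n (cells n zs) v S" using Cons.IH[OF rz x(2)] z by blast
    ultimately show "insert_word n (cells n xs) (x # v) S" by auto
  qed
qed

section \<open>Counting the insertions with a given result\<close>

lemma rc_word_base:
  assumes "rc_word n xs" "set v \<subseteq> {1..n}" shows "base ground xs v"
  using tame_ground row_word_good row_word_ends assms unfolding base_def rc_word_def by auto

lemma rc_word_mthru:
  assumes "rc_word n xs" "mthru ground xs (map Wait v) ys C" shows "rc_word n ys"
  using assms
proof (induction v arbitrary: xs C)
  case (Cons x v)
  then obtain zs t C' where "thru ground xs (Wait x) zs t" "mthru ground zs (map Wait v) ys C'" by auto
  then show ?case using Cons.IH rc_word_thru[OF Cons.prems(1)] by blast
qed simp

lemma mthru_injective:
  assumes "rc_word n xs" "rc_word n xs'" "mthru ground xs (map Wait v) ys C" "mthru ground xs' (map Wait v') ys C"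
    "list_all is_jump C"
  shows "xs = xs' \<and> v = v'"
  using assms
proof (induction v arbitrary: v' ys C rule: rev_induct)
  case Nil
  then have "v' = []" using mthru_length[OF Nil(3)] mthru_length[OF Nil(4)] by simp
  then show ?case using Nil by simp
next
  case (snoc x v)
  have "length v' = Suc (length v)" using mthru_length[OF snoc.prems(3)] mthru_length[OF snoc.prems(4)] by simp
  then obtain w x' where w: "v' = w @ [x']" "length w = length v" by (cases v' rule: rev_cases) auto
  obtain zs C1 c where 1: "C = C1 @ [c]" "mthru ground xs (map Wait v) zs C1" "thru ground zs (Wait x) ys c"
    using snoc.prems(3) by (auto simp: mthru_append_signals)
  obtain zs' D1 d where 2: "C = D1 @ [d]" "mthru ground xs' (map Wait w) zs' D1" "thru ground zs' (Wait x') ys d"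
    using snoc.prems(4) unfolding w(1) by (auto simp: mthru_append_signals)
  have e: "D1 = C1" "d = c" using 1(1) 2(1) by auto
  obtain p q where c: "c = Jump p q" using snoc.prems(5) 1(1) by (cases c) auto
  have "rc_word n zs" "rc_word n zs'"
    using rc_word_mthru[OF snoc.prems(1) 1(2)] rc_word_mthru[OF snoc.prems(2) 2(2)] by auto
  then have "zs = zs' \<and> x = x'"
    using thru_injective[OF _ _ 1(3)[unfolded c] 2(3)[unfolded e c]] unfolding rc_word_def by blast
  then show ?case using snoc.IH[OF snoc.prems(1,2) 1(2), of w] 2(2) e snoc.prems(5) 1(1) w by auto
qed

text \<open>The letters are recovered from the last jump backwards. The exceptional alternatives of
  \<open>thru_surjective\<close> would require a jump beyond position \<open>n\<close> or a crossing
  in row \<open>n + 1\<close>, and a complete word has neither.\<close>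

lemma mthru_surjective:
  assumes "rc_word n ys" "list_all is_jump C" "jumps_ok f C" "run ground ys = foldl act f C"
  shows "\<exists>xs v. rc_word n xs \<and> set v \<subseteq> {1..n} \<and> mthru ground xs (map Wait v) ys C \<and> run ground xs = f"
  using assms
proof (induction C arbitrary: ys rule: rev_induct)
  case Nil
  then show ?case by (intro exI[of _ ys] exI[of _ "[]"]) auto
next
  case (snoc c C)
  obtain p q where c: "c = Jump p q" using snoc.prems(2) by (cases c) auto
  define g where "g = foldl act f C"
  have "jumps_ok f (C @ D) \<longleftrightarrow> jumps_ok f C \<and> jumps_ok (foldl act f C) D" for f C D
    by (induction C arbitrary: f) auto
  then have J: "jumps_ok f C" "jump g p q" using snoc.prems(3) c unfolding g_def by auto
  have ysg: "run ground ys = g \<circ> transpose p q" using snoc.prems(4) unfolding g_def c foldl_append foldl_Cons foldl_Nil act.simps .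
  then have gy: "g = run ground ys \<circ> transpose p q" by (simp add: comp_assoc)
  note rw = snoc.prems(1)[unfolded rc_word_def]
  have "jump (run ground ys \<circ> transpose p q) p q" using J(2) gy by simp
  from thru_surjective[OF rw this] obtain xs x where x: "thru ground xs (Wait x) ys (Jump p q)"
    "rc_word n xs" "x \<in> set (ends xs)"
  proof (elim disjE exE conjE)
    fix xs x b0
    assume a: "thru ground xs (Wait x) ys (Jump p q)" "row_word xs (n + 1) b0" "x \<in> set (ends xs)" "b0 = n + 1"
    then show thesis using that unfolding rc_word_def by blast
  next
    fix xs x b0
    assume a: "p = n + 1 + 1" "q = n + 1"
    have "0 < g q" unfolding gy a
      using row_word_fix[OF rw, of "n + 1 + 1"] row_word_bounds[OF rw] by (simp add: transpose_def)
    then show thesis using J(2) unfolding jump_def by simp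
  next
    fix Y assume "ys = Y @ [Cross (n + 1) q]"
    then have "n + 1 = q \<and> (\<exists>b'. row_word Y (n + 1) b' \<and> q < b')" using row_word_last_Cross rw by blast
    then show thesis using row_word_bounds by force
  qed
  have "run ground ys = act (run ground xs) (Jump p q)" using thru_state[OF x(1)] by simp
  then have xsg: "run ground xs = g" using ysg by (metis act.simps(2) comp_assoc comp_id transpose_comp_involutory)
  obtain ws v where w: "rc_word n ws" "set v \<subseteq> {1..n}" "mthru ground ws (map Wait v) xs C" "run ground ws = f"
    using snoc.IH[OF x(2) _ J(1)] snoc.prems(2) xsg unfolding g_def by auto
  have "mthru ground xs (map Wait [x]) ys [c]" using x(1) c by simp
  then have "mthru ground ws (map Wait (v @ [x])) ys (C @ [c])" by (rule word_join[OF w(3)])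
  moreover have "x \<in> {1..n}" using x(2,3) row_word_ends unfolding rc_word_def by fastforce
  ultimately show ?case using w by (intro exI[of _ ws] exI[of _ "v @ [x]"]) auto
qed

definition insertion_pairs :: "int \<Rightarrow> (int \<Rightarrow> int) \<Rightarrow> nat list \<Rightarrow> cell set \<Rightarrow> (cell set \<times> int list list) set" where
  "insertion_pairs n w \<mu> U =
     {(R, Y). rc_graph n R \<and> rc_perm n R = w \<and> Y \<in> ssyt n \<mu> \<and> insert_tableau n R Y U}"

lemma ssyt_letters: "Y \<in> ssyt n \<mu> \<Longrightarrow> set (reading_word Y) \<subseteq> {1..n}"
  unfolding ssyt_def reading_word_def by auto

lemma dominant_rc_word:
  assumes "1 \<le> n" "\<forall>i\<le>0. w (i - 1) < w i" "rc_graph n R" "rc_perm n R = w"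
  shows "\<exists>xs. rc_word n xs \<and> cells n xs = R"
  using rc_word_exists[OF assms(1,3)] nonpos_uncrossed[OF assms(3)] assms(2,4) by blast

lemma insertion_pairs_iff:
  assumes n: "1 \<le> n" and w: "\<forall>i\<le>0. w (i - 1) < w i" and ys: "rc_word n ys"
  shows "(R, Y) \<in> insertion_pairs n w \<mu> (cells n ys) \<longleftrightarrow>
    (\<exists>xs C. rc_word n xs \<and> cells n xs = R \<and> rc_perm n R = w \<and> Y \<in> ssyt n \<mu> \<and>
      mthru ground xs (map Wait (reading_word Y)) ys C)"
proof
  assume "(R, Y) \<in> insertion_pairs n w \<mu> (cells n ys)"
  then have h: "rc_graph n R" "rc_perm n R = w" "Y \<in> ssyt n \<mu>" "insert_word n R (reading_word Y) (cells n ys)"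
    unfolding insertion_pairs_def insert_tableau_def by auto
  obtain xs where xs: "rc_word n xs" "cells n xs = R" using dominant_rc_word[OF n w h(1,2)] by blast
  obtain zs C where "mthru ground xs (map Wait (reading_word Y)) zs C" "rc_word n zs" "cells n ys = cells n zs"
    using insert_word_iff[OF xs(1) ssyt_letters[OF h(3)]] h(4) xs(2) by blast
  then have "mthru ground xs (map Wait (reading_word Y)) ys C" using rc_word_unique[OF ys] by blast
  then show "\<exists>xs C. rc_word n xs \<and> cells n xs = R \<and> rc_perm n R = w \<and> Y \<in> ssyt n \<mu> \<and>
      mthru ground xs (map Wait (reading_word Y)) ys C" using xs h by blast
next
  assume "\<exists>xs C. rc_word n xs \<and> cells n xs = R \<and> rc_perm n R = w \<and> Y \<in> ssyt n \<mu> \<and>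
      mthru ground xs (map Wait (reading_word Y)) ys C"
  then obtain xs C where h: "rc_word n xs" "cells n xs = R" "rc_perm n R = w" "Y \<in> ssyt n \<mu>"
    "mthru ground xs (map Wait (reading_word Y)) ys C" by blast
  then have "insert_word n R (reading_word Y) (cells n ys)"
    using insert_word_iff[OF h(1) ssyt_letters[OF h(4)]] ys by blast
  then show "(R, Y) \<in> insertion_pairs n w \<mu> (cells n ys)"
    unfolding insertion_pairs_def insert_tableau_def using h rc_word_rc_graph by blast
qed

text \<open>Pairs \<open>(R, Y)\<close> for different results cannot be compared directly; their
  chains can, since these no longer mention any diagram.\<close>

definition chains :: "int \<Rightarrow> (int \<Rightarrow> int) \<Rightarrow> nat list \<Rightarrow> item list \<Rightarrow> signal list set" where
  "chains n w \<mu> ys = {C. \<exists>xs Y. rc_word n xs \<and> rc_perm n (cells n xs) = w \<and> Y \<in> ssyt n \<mu> \<and>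
     mthru ground xs (map Wait (reading_word Y)) ys C}"

text \<open>The sweep is deterministic, so a pair has one chain, and it is reversible from
  \<open>ys\<close>, so the chain gives back the diagram and the word; the shape then gives back the
  tableau.\<close>

lemma card_insertion_pairs:
  assumes n: "1 \<le> n" and w: "\<forall>i\<le>0. w (i - 1) < w i" and ys: "rc_word n ys"
  shows "card (insertion_pairs n w \<mu> (cells n ys)) = card (chains n w \<mu> ys)"
proof -
  define rel where "rel = (\<lambda>(R, Y) C. \<exists>xs. rc_word n xs \<and> cells n xs = R \<and>
    mthru ground xs (map Wait (reading_word Y)) ys C)"
  define F where "F z = (SOME C. rel z C)" for z
  have ex: "rel z (F z)" if "z \<in> insertion_pairs n w \<mu> (cells n ys)" for z
  proof -
    obtain R Y where z: "z = (R, Y)" by (cases z)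
    have "\<exists>C. rel z C" using that insertion_pairs_iff[OF n w ys] unfolding z rel_def by auto
    then show ?thesis unfolding F_def by (rule someI_ex)
  qed
  have Y: "Y \<in> ssyt n \<mu>" "rc_perm n R = w" if "(R, Y) \<in> insertion_pairs n w \<mu> (cells n ys)" for R Y
    using that unfolding insertion_pairs_def by auto
  have "bij_betw F (insertion_pairs n w \<mu> (cells n ys)) (chains n w \<mu> ys)"
  proof (rule bij_betw_imageI)
    show "inj_on F (insertion_pairs n w \<mu> (cells n ys))"
    proof (rule inj_onI)
      fix z z' assume a: "z \<in> insertion_pairs n w \<mu> (cells n ys)" "z' \<in> insertion_pairs n w \<mu> (cells n ys)" "F z = F z'"
      obtain R Y1 where z: "z = (R, Y1)" by (cases z)
      obtain R' Y1' where z': "z' = (R', Y1')" by (cases z')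
      note m = Y(1)[OF a(1)[unfolded z]] Y(1)[OF a(2)[unfolded z']]
      obtain xs where xs: "rc_word n xs" "cells n xs = R" "mthru ground xs (map Wait (reading_word Y1)) ys (F z)"
        using ex[OF a(1)] unfolding rel_def z by auto
      obtain xs' where xs': "rc_word n xs'" "cells n xs' = R'" "mthru ground xs' (map Wait (reading_word Y1')) ys (F z)"
        using ex[OF a(2)] unfolding rel_def a(3) z' by auto
      have "list_all is_jump (F z)"
        by (rule base_jumps[OF rc_word_base[OF xs(1) ssyt_letters[OF m(1)]] xs(3)])
      then have e: "xs = xs' \<and> reading_word Y1 = reading_word Y1'"
        using mthru_injective[OF xs(1) xs'(1) xs(3) xs'(3)] by blast
      moreover have "map length Y1 = map length Y1'" using m unfolding ssyt_def by simp
      ultimately show "z = z'" using reading_word_inj xs(2) xs'(2) unfolding z z' by blast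
    qed
    show "F ` insertion_pairs n w \<mu> (cells n ys) = chains n w \<mu> ys"
    proof
      show "F ` insertion_pairs n w \<mu> (cells n ys) \<subseteq> chains n w \<mu> ys"
      proof
        fix C assume "C \<in> F ` insertion_pairs n w \<mu> (cells n ys)"
        then obtain R Y1 where z: "(R, Y1) \<in> insertion_pairs n w \<mu> (cells n ys)" "C = F (R, Y1)" by auto
        obtain xs where "rc_word n xs" "cells n xs = R" "mthru ground xs (map Wait (reading_word Y1)) ys C"
          using ex[OF z(1)] unfolding rel_def z(2) by auto
        then show "C \<in> chains n w \<mu> ys" unfolding chains_def using Y[OF z(1)] by blast
      qed
      show "chains n w \<mu> ys \<subseteq> F ` insertion_pairs n w \<mu> (cells n ys)"
      proof
        fix C assume "C \<in> chains n w \<mu> ys"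
        then obtain xs Y1 where h: "rc_word n xs" "rc_perm n (cells n xs) = w" "Y1 \<in> ssyt n \<mu>"
          "mthru ground xs (map Wait (reading_word Y1)) ys C" unfolding chains_def by blast
        then have i: "(cells n xs, Y1) \<in> insertion_pairs n w \<mu> (cells n ys)"
          using insertion_pairs_iff[OF n w ys] by blast
        obtain xs' where x': "rc_word n xs'" "cells n xs' = cells n xs"
          "mthru ground xs' (map Wait (reading_word Y1)) ys (F (cells n xs, Y1))"
          using ex[OF i] unfolding rel_def by auto
        have "xs' = xs" by (rule rc_word_unique[OF x'(1) h(1) x'(2)])
        then have "C = F (cells n xs, Y1)" using mthru_unique[OF h(4)] x'(3) by blast
        then show "C \<in> F ` insertion_pairs n w \<mu> (cells n ys)" using i by blast
      qed
    qed
  qed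
  then show ?thesis by (rule bij_betw_same_card)
qed

text \<open>Reversal looks only at the final state, so a chain ending at \<open>ys\<close> can be
  run backwards through \<open>ys'\<close> too. The word found there has the same chain and is a
  tableau word of the same shape by \<open>ssyt_transfer\<close>.\<close>

lemma chains_perm:
  assumes mu: "\<mu> \<in> partitions_n n" and ys: "rc_word n ys" "rc_word n ys'" and e: "run ground ys = run ground ys'"
  shows "chains n w \<mu> ys \<subseteq> chains n w \<mu> ys'"
proof
  fix C assume "C \<in> chains n w \<mu> ys"
  then obtain xs Y where h: "rc_word n xs" "rc_perm n (cells n xs) = w" "Y \<in> ssyt n \<mu>"
    "mthru ground xs (map Wait (reading_word Y)) ys C" unfolding chains_def by blast
  have b: "base ground xs (reading_word Y)" by (rule rc_word_base[OF h(1) ssyt_letters[OF h(3)]])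
  have g: "good ground xs" using row_word_good h(1) unfolding rc_word_def by blast
  have m: "jumps_ok (run ground xs) C" "run ground ys = foldl act (run ground xs) C"
    using mthru_ok[OF h(4) g] by auto
  obtain xs' v' where x': "rc_word n xs'" "set v' \<subseteq> {1..n}" "mthru ground xs' (map Wait v') ys' C"
    "run ground xs' = run ground xs"
    using mthru_surjective[OF ys(2) base_jumps[OF b h(4)] m(1)] m(2) e by auto
  obtain Y' where Y': "Y' \<in> ssyt n \<mu>" "reading_word Y' = v'"
    using ssyt_transfer[OF mu h(3) b h(4) rc_word_base[OF x'(1,2)] x'(3,2)] by blast
  have "rc_perm n (cells n xs') = w" using h(2) x'(4) rc_word_perm h(1) x'(1) by metis
  then show "C \<in> chains n w \<mu> ys'" unfolding chains_def using x' Y' by blast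
qed

lemma insertion_pairs_perm:
  assumes n: "1 \<le> n" and w: "\<forall>i\<le>0. w (i - 1) < w i" and mu: "\<mu> \<in> partitions_n n"
    and ys: "rc_word n ys" "rc_word n ys'" and e: "rc_perm n (cells n ys) = rc_perm n (cells n ys')"
  shows "card (insertion_pairs n w \<mu> (cells n ys)) = card (insertion_pairs n w \<mu> (cells n ys'))"
proof -
  have "inv (run ground ys) = inv (run ground ys')" using e rc_word_perm ys by metis
  then have "run ground ys = run ground ys'" using run_bij[OF bij_ground] by (metis inv_inv_eq)
  then have "chains n w \<mu> ys = chains n w \<mu> ys'" using chains_perm[OF mu] ys by (metis subset_antisym)
  then show ?thesis using card_insertion_pairs[OF n w] ys by metis
qed

section \<open>Weights\<close>

fun rows :: "item list \<Rightarrow> int list" where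
  "rows [] = []"
| "rows (Cross k j # xs) = k # rows xs"
| "rows (End k # xs) = rows xs"

lemma rows_append [simp]: "rows (xs @ ys) = rows xs @ rows ys"
  by (induction xs rule: rows.induct) auto

fun started :: "signal \<Rightarrow> signal \<Rightarrow> int multiset" where
  "started (Wait x) (Jump p q) = {#x#}"
| "started _ _ = {#}"

lemma istep_rows: "istep f x s ys t \<Longrightarrow> mset (rows ys) = mset (rows [x]) + started s t"
  by (cases "(f, x, s, ys, t)" rule: istep.cases) (auto split: if_splits)

lemma istep_Wait: "istep f x s ys (Wait c) \<Longrightarrow> s = Wait c"
  by (cases x; cases s) (auto split: if_splits)

lemma thru_rows: "thru f xs s ys t \<Longrightarrow> mset (rows ys) = mset (rows xs) + started s t"
proof (induction xs arbitrary: f s ys)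
  case Nil
  then show ?case by (cases s) auto
next
  case (Cons x xs)
  then obtain y1 y2 u where h: "istep f x s y1 u" "thru (apply_item f x) xs u y2 t" "ys = y1 @ y2" by auto
  have "started s u + started u t = started s t"
  proof (cases u)
    case (Wait c)
    then show ?thesis using istep_Wait h(1) by (cases s) fastforce+
  next
    case (Jump p q)
    then obtain p' q' where "t = Jump p' q'" using thru_Wait[of "apply_item f x" xs u y2] h(2) by (cases t) auto
    then show ?thesis using Jump by (cases s) auto
  qed
  moreover have "rows (x # xs) = rows [x] @ rows xs" by (cases x) auto
  ultimately show ?case using istep_rows[OF h(1)] Cons.IH[OF h(2)] h(3) by (simp add: ac_simps)
qed

text \<open>A bump keeps its crossing in its row, so a row gains one crossing for each letter that
  starts in it and nothing else. This is the identity of monomials behind the expansion.\<close>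

lemma mthru_rows:
  assumes "base ground xs v" "mthru ground xs (map Wait v) ys C"
  shows "mset (rows ys) = mset (rows xs) + mset v"
  using assms
proof (induction v arbitrary: xs C)
  case (Cons x v)
  then obtain zs c C' where h: "thru ground xs (Wait x) zs c" "mthru ground zs (map Wait v) ys C'" by auto
  have b: "base ground zs v"
    using base_step[of ground xs "[x]" zs "[c]" v] h(1) Cons.prems(1) unfolding base_def by auto
  have "x \<in> set (ends xs)" using Cons.prems(1) unfolding base_def by auto
  then obtain p q where "c = Jump p q" using thru_Wait[of ground xs "Wait x" zs] h(1) by (cases c) auto
  then show ?case using Cons.IH[OF b h(2)] thru_rows[OF h(1)] by simp
qed simp

section \<open>Schubert polynomials\<close>

text \<open>The left-justified diagram with \<open>e k\<close> crossings in row \<open>k\<close>.\<close>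

definition code_row :: "int \<Rightarrow> nat \<Rightarrow> item list" where
  "code_row k m = map (\<lambda>t. Cross k (k - 1 - int t)) [0..<m]"

definition code_word :: "(int \<Rightarrow> nat) \<Rightarrow> int \<Rightarrow> int \<Rightarrow> item list" where
  "code_word e a N = concat (map (\<lambda>k. code_row k (e k)) [a..N])"

lemma code_row_Suc: "code_row k (Suc m) = code_row k m @ [Cross k (k - 1 - int m)]"
  unfolding code_row_def by simp

text \<open>The whole row moves a single strand, the one that enters it on the left,
  \<open>m\<close> places to the right.\<close>

lemma run_code_row: "run f (code_row k m) (k - int m) = f k"
proof (induction m)
  case (Suc m)
  have e: "k - int (Suc m) = k - 1 - int m" "k - 1 - int m + 1 = k - int m" by auto
  show ?case unfolding code_row_Suc run_simps apply_item.simps comp_apply e(1) transpose_apply_first e(2)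
    by (rule Suc)
qed (simp add: code_row_def)

text \<open>A crossing moves a strand by at most one place. To get \<open>length X\<close> places to
  the right, every crossing has to move it, and this fixes their positions one after the
  other.\<close>

lemma run_moves:
  assumes "inj f" "run f X r = f k"
  shows "k - int (length X) \<le> r"
    "r = k - int (length X) \<Longrightarrow> (\<And>x. x \<in> set X \<Longrightarrow> \<exists>j. x = Cross \<kappa> j) \<Longrightarrow> t < length X \<Longrightarrow> X ! t = Cross \<kappa> (k - 1 - int t)"
proof -
  have both: "k - int (length X) \<le> r \<and> (r = k - int (length X) \<longrightarrow> (\<forall>x\<in>set X. \<exists>j. x = Cross \<kappa> j) \<longrightarrow>
      (\<forall>t<length X. X ! t = Cross \<kappa> (k - 1 - int t)))"
    if "inj f" "run f X r = f k" for f X r k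
    using that
  proof (induction X arbitrary: f k)
    case Nil
    then show ?case by (auto dest: injD)
  next
    case (Cons x X)
    show ?case
    proof (cases x)
      case (End m)
      then have "k - int (length X) \<le> r" using Cons.IH[of f k] Cons.prems by simp
      then show ?thesis using End by auto
    next
      case (Cross m j)
      have "inj (f \<circ> sw j)" using Cons.prems by (auto intro: inj_compose)
      moreover have "run (f \<circ> sw j) X r = (f \<circ> sw j) (sw j k)" using Cons.prems Cross by simp
      ultimately have ih: "sw j k - int (length X) \<le> r" "r = sw j k - int (length X) \<Longrightarrow> (\<forall>x\<in>set X. \<exists>j. x = Cross \<kappa> j) \<Longrightarrow>
        (\<forall>t<length X. X ! t = Cross \<kappa> (sw j k - 1 - int t))" using Cons.IH by blast+
      have s: "k - 1 \<le> sw j k" by (simp add: transpose_def)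
      show ?thesis
      proof (intro conjI impI allI)
        show "k - int (length (x # X)) \<le> r" using ih(1) s by simp
        fix t assume r: "r = k - int (length (x # X))" and all: "\<forall>x\<in>set (x # X). \<exists>j. x = Cross \<kappa> j"
          and t: "t < length (x # X)"
        have e: "sw j k = k - 1" using ih(1) s r by simp
        have j: "j = k - 1"
        proof (rule ccontr)
          assume "j \<noteq> k - 1"
          then have "k \<le> sw j k" unfolding transpose_def by (simp split: if_split)
          then show False using e by simp
        qed
        have m: "m = \<kappa>" using all Cross by auto
        have "\<forall>t<length X. X ! t = Cross \<kappa> (k - 1 - 1 - int t)" using ih(2) r all e by simp
        then show "(x # X) ! t = Cross \<kappa> (k - 1 - int t)" using t Cross j m by (cases t) auto
      qed
    qed
  qed
  show "k - int (length X) \<le> r"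
    "r = k - int (length X) \<Longrightarrow> (\<And>x. x \<in> set X \<Longrightarrow> \<exists>j. x = Cross \<kappa> j) \<Longrightarrow> t < length X \<Longrightarrow> X ! t = Cross \<kappa> (k - 1 - int t)"
    using both[OF assms] by simp_all
qed

lemma reduced_snocI:
  assumes "reduced L" "\<And>k j. x = Cross k j \<Longrightarrow> run ground L j < run ground L (j + 1)"
  shows "reduced (L @ [x])"
  unfolding reduced_def
proof (intro allI impI)
  fix A k j B assume e: "L @ [x] = A @ Cross k j # B"
  show "run ground A j < run ground A (j + 1)"
  proof (cases B rule: rev_cases)
    case Nil
    then show ?thesis using e assms(2) by simp
  next
    case (snoc B' y)
    then have "L = A @ Cross k j # B'" using e by simp
    then show ?thesis using assms(1) unfolding reduced_def by blast
  qed
qed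

lemma code_word_step: "a \<le> N + 1 \<Longrightarrow> code_word e a (N + 1) = code_word e a N @ code_row (N + 1) (e (N + 1))"
  unfolding code_word_def by (simp add: upto_rec2)

lemma code_word_empty: "N < a \<Longrightarrow> code_word e a N = []"
  unfolding code_word_def by simp

lemma code_word_mem: "x \<in> set (code_word e a N) \<Longrightarrow> \<exists>k t. a \<le> k \<and> k \<le> N \<and> t < e k \<and> x = Cross k (k - 1 - int t)"
  unfolding code_word_def code_row_def by auto

lemma ground_permutes: "ground permutes S"
  unfolding permutes_def ground_def by auto

lemma run_permutes_atMost:
  assumes "f permutes {..N}" "\<And>k j. Cross k j \<in> set L \<Longrightarrow> j < N" shows "run f L permutes {..N}"
  using assms
proof (induction L arbitrary: f)
  case (Cons x L)
  have "apply_item f x permutes {..N}"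
  proof (cases x)
    case (Cross k j)
    then have "j < N" using Cons.prems(2)[of k j] by simp
    then have "sw j permutes {..N}" by (intro permutes_swap_id) auto
    then show ?thesis using permutes_compose[OF _ Cons.prems(1)] Cross by simp
  qed (use Cons.prems in simp)
  moreover have "\<And>k j. Cross k j \<in> set L \<Longrightarrow> j < N" using Cons.prems(2) by auto
  ultimately show ?case using Cons.IH[of "apply_item f x"] by simp
qed simp

text \<open>In row \<open>N + 1\<close> every crossing moves the label \<open>N + 1\<close> to the
  right, past labels that are all smaller.\<close>

lemma code_word_reduced: "a - 1 \<le> N \<Longrightarrow> reduced (code_word e a N)"
proof (induction N rule: int_ge_induct)
  case base
  then show ?case by (simp add: code_word_empty reduced_def)
next
  case (step N)
  define W where "W = code_word e a N"
  have "reduced (W @ code_row (N + 1) m)" for m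
  proof (induction m)
    case 0
    then show ?case using step unfolding W_def code_row_def by simp
  next
    case (Suc m)
    define g where "g = run ground (W @ code_row (N + 1) m)"
    have W: "run ground W permutes {..N}" unfolding W_def
      by (rule run_permutes_atMost[OF ground_permutes]) (use code_word_mem in fastforce)
    have "run ground W permutes {..N + 1}" by (rule permutes_subset[OF W]) auto
    then have g: "g permutes {..N + 1}" unfolding g_def run_simps
      by (rule run_permutes_atMost) (auto simp: code_row_def)
    have top: "g (N + 1 - int m) = N + 1"
      using run_code_row[of "run ground W" "N + 1" m] W unfolding g_def by (simp add: permutes_def)
    have "g (N + 1 - 1 - int m) \<noteq> g (N + 1 - 1 - int m + 1)" unfolding g_def by (rule run_adjacent)
    moreover have "g (N + 1 - 1 - int m) \<in> {..N + 1}" using permutes_in_image[OF g] by simp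
    ultimately have "g (N + 1 - 1 - int m) < g (N + 1 - 1 - int m + 1)" using top by (simp add: algebra_simps)
    then have "reduced ((W @ code_row (N + 1) m) @ [Cross (N + 1) (N + 1 - 1 - int m)])"
      by (intro reduced_snocI[OF Suc]) (auto simp only: g_def item.inject)
    then show ?case unfolding code_row_Suc by (simp only: append_assoc)
  qed
  then show ?case using code_word_step[of a N e] step W_def by simp
qed

text \<open>The exponents form a Lehmer code. Label \<open>N + 1\<close> is moved only in the top
  row, so that row has as many crossings as this label has to travel; splitting the row off leaves a
  permutation of \<open>{a..N}\<close>.\<close>

lemma code_word_exists:
  assumes "a - 1 \<le> N" "\<pi> permutes {a..N}"
  shows "\<exists>e. (\<forall>k. e k \<noteq> 0 \<longrightarrow> a \<le> k \<and> k \<le> N) \<and> run ground (code_word e a N) = \<pi>"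
  using assms
proof (induction N arbitrary: \<pi> rule: int_ge_induct)
  case base
  then have "\<pi> = id" by simp
  then show ?case by (intro exI[of _ "\<lambda>_. 0"]) (auto simp: code_word_empty fun_eq_iff ground_def)
next
  case (step N)
  define r where "r = inv \<pi> (N + 1)"
  have \<pi>r: "\<pi> r = N + 1" unfolding r_def using step.prems by (simp add: permutes_inverses)
  have r: "a \<le> r" "r \<le> N + 1" using permutes_in_image[OF step.prems, of r] \<pi>r step.hyps by auto
  define m where "m = nat (N + 1 - r)"
  define h where "h = run ground (code_row (N + 1) m)"
  have h: "h permutes {a..N + 1}" unfolding h_def
    by (rule run_support) (use r in \<open>auto simp: code_row_def m_def\<close>)
  have hr: "h r = N + 1" using run_code_row[of ground "N + 1" m] r unfolding h_def m_def ground_def by simp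
  define \<pi>' where "\<pi>' = \<pi> \<circ> inv h"
  have p': "\<pi>' permutes {a..N + 1}" unfolding \<pi>'_def using permutes_compose[OF permutes_inv[OF h] step.prems] .
  have "inv h (N + 1) = r" using hr h by (metis permutes_inverses(2))
  then have "\<pi>' (N + 1) = N + 1" unfolding \<pi>'_def using \<pi>r by simp
  then have "\<pi>' permutes {a..N}" using p' unfolding permutes_def by (metis atLeastAtMost_iff zle_add1_eq_le order_le_less)
  then obtain e' where e': "\<forall>k. e' k \<noteq> 0 \<longrightarrow> a \<le> k \<and> k \<le> N" "run ground (code_word e' a N) = \<pi>'" using step.IH by blast
  define e where "e = e'(N + 1 := m)"
  have "code_word e a N = code_word e' a N" unfolding code_word_def e_def
    by (intro arg_cong[of _ _ concat] map_cong) auto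
  then have "run ground (code_word e a (N + 1)) = run \<pi>' (code_row (N + 1) m)"
    using code_word_step[of a N e] step.hyps e'(2) unfolding e_def by simp
  also have "\<dots> = \<pi>' \<circ> h"
  proof -
    have "\<pi>' \<circ> ground = \<pi>'" by (auto simp: ground_def)
    then show ?thesis using run_relabel[of \<pi>' ground] unfolding h_def by metis
  qed
  also have "\<dots> = \<pi>" unfolding \<pi>'_def using h by (simp add: comp_assoc permutes_inv_o(2))
  finally have "run ground (code_word e a (N + 1)) = \<pi>" .
  moreover have "a \<le> k \<and> k \<le> N + 1" if "e k \<noteq> 0" for k
    using e'(1)[rule_format, of k] step.hyps that unfolding e_def by (cases "k = N + 1") auto
  ultimately show ?case by blast
qed

fun row :: "item \<Rightarrow> int" where
  "row (Cross k j) = k"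
| "row (End k) = k"

lemma sorted_code_row: "sorted_wrt before (code_row k m)"
  by (induction m) (auto simp: code_row_Suc sorted_wrt_append, auto simp: code_row_def)

lemma code_word_sorted: "a - 1 \<le> N \<Longrightarrow> sorted_wrt before (code_word e a N)"
proof (induction N rule: int_ge_induct)
  case base
  then show ?case by (simp add: code_word_empty)
next
  case (step N)
  have "before x y" if x: "x \<in> set (code_word e a N)" and y: "y \<in> set (code_row (N + 1) (e (N + 1)))" for x y
  proof -
    obtain k t where "k \<le> N" "x = Cross k (k - 1 - int t)" using code_word_mem[OF x] by blast
    then show ?thesis using y unfolding code_row_def by auto
  qed
  then show ?case using step code_word_step[of a N e] sorted_code_row by (simp add: sorted_wrt_append)
qed

lemma code_word_row:
  assumes "\<And>k. e k \<noteq> 0 \<Longrightarrow> a \<le> k \<and> k \<le> N" "a - 1 \<le> N"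
  shows "filter (\<lambda>x. row x = k) (code_word e a N) = code_row k (e k)"
proof (rule sorted_before_unique)
  show "sorted_wrt before (filter (\<lambda>x. row x = k) (code_word e a N))"
    using code_word_sorted[OF assms(2)] by (rule sorted_wrt_filter)
  show "sorted_wrt before (code_row k (e k))" by (rule sorted_code_row)
  show "set (filter (\<lambda>x. row x = k) (code_word e a N)) = set (code_row k (e k))"
    using assms(1)[of k] unfolding code_word_def code_row_def by (cases "e k = 0") auto
qed

lemma code_word_lists: "a - 1 \<le> n \<Longrightarrow> lists n (code_word e a n) (cells n (code_word e a n))"
proof -
  assume a: "a - 1 \<le> n"
  have "i \<le> n \<and> k \<le> n" if c: "(i, k) \<in> cells n (code_word e a n)" for i k
  proof -
    obtain k' t where "k' \<le> n" "Cross k (i + k - n - 1) = Cross k' (k' - 1 - int t)"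
      using code_word_mem[of _ e a n] c unfolding cells_iff by blast
    then show ?thesis by auto
  qed
  then show ?thesis unfolding lists_def using code_word_sorted[OF a] by auto
qed

text \<open>Above the highest row \<open>k\<close> in which the two diagrams differ, their common
  crossings cancel. Lower rows do not reach position \<open>k\<close>, so in both diagrams strand
  \<open>k\<close> enters row \<open>k\<close> there and must be moved \<open>e k\<close> places
  within this row. That takes at least \<open>e k\<close> crossings, and exactly \<open>e k\<close>
  only if they are left-justified.\<close>

lemma code_minimal:
  assumes L: "lists n L R" and noEnd: "\<And>k. End k \<notin> set L"
    and e: "\<And>k. e k \<noteq> 0 \<Longrightarrow> a \<le> k \<and> k \<le> n" "a - 1 \<le> n"
    and run: "run ground L = run ground (code_word e a n)" and ne: "R \<noteq> cells n (code_word e a n)"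
  shows "\<exists>k. e k < length (filter (\<lambda>x. row x = k) L) \<and> (\<forall>l>k. e l = length (filter (\<lambda>x. row x = l) L))"
proof -
  define M where "M = code_word e a n"
  have rowM: "filter (\<lambda>x. row x = l) M = code_row l (e l)" for l
    unfolding M_def by (rule code_word_row) (use e in auto)
  have sL: "sorted_wrt before L" and sM: "sorted_wrt before M"
    using listsD(1)[OF L] code_word_sorted[OF e(2)] unfolding M_def by auto
  have listsM: "lists n M (cells n M)" unfolding M_def by (rule code_word_lists[OF e(2)])
  define K where "K = {k. filter (\<lambda>x. row x = k) L \<noteq> filter (\<lambda>x. row x = k) M}"
  have Ksub: "K \<subseteq> row ` (set L \<union> set M)"
  proof
    fix k assume "k \<in> K"
    then have "filter (\<lambda>x. row x = k) L \<noteq> [] \<or> filter (\<lambda>x. row x = k) M \<noteq> []" unfolding K_def by auto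
    then show "k \<in> row ` (set L \<union> set M)" by (auto simp: filter_empty_conv)
  qed
  then have finK: "finite K" using finite_subset by blast
  have "K \<noteq> {}"
  proof
    assume "K = {}"
    then have "filter (\<lambda>y. row y = row x) L = filter (\<lambda>y. row y = row x) M" for x unfolding K_def by blast
    then have "x \<in> set (filter (\<lambda>y. row y = row x) L) \<longleftrightarrow> x \<in> set (filter (\<lambda>y. row y = row x) M)" for x by simp
    then have "x \<in> set L \<longleftrightarrow> x \<in> set M" for x by simp
    then have "set L = set M" by blast
    then show False using ne L unfolding lists_def cells_def M_def by simp
  qed
  define k where "k = Max K"
  have kK: "k \<in> K" unfolding k_def using finK \<open>K \<noteq> {}\<close> by simp
  have above: "filter (\<lambda>x. row x = l) L = filter (\<lambda>x. row x = l) M" if "k < l" for l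
  proof -
    have "l \<notin> K" using that Max_ge[OF finK, of l] unfolding k_def by auto
    then show ?thesis unfolding K_def by simp
  qed
  define hi where "hi = filter (\<lambda>x. k < row x) L"
  have hiM: "hi = filter (\<lambda>x. k < row x) M"
  proof (rule sorted_before_unique)
    have "x \<in> set L \<longleftrightarrow> x \<in> set M" if "k < row x" for x
    proof -
      have "x \<in> set (filter (\<lambda>y. row y = row x) L) \<longleftrightarrow> x \<in> set (filter (\<lambda>y. row y = row x) M)"
        using above[OF that] by simp
      then show ?thesis by simp
    qed
    then show "set hi = set (filter (\<lambda>x. k < row x) M)" unfolding hi_def by auto
  qed (use sL sM in \<open>auto simp: hi_def sorted_wrt_filter\<close>)
  have dec: "X = filter (\<lambda>x. row x < k) X @ filter (\<lambda>x. row x = k) X @ filter (\<lambda>x. k < row x) X"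
    if X: "sorted_wrt before X" for X
  proof (rule sorted_before_unique[OF X])
    have lt: "before x y" if "row x < row y" for x y using that by (cases x; cases y) auto
    show "sorted_wrt before (filter (\<lambda>x. row x < k) X @ filter (\<lambda>x. row x = k) X @ filter (\<lambda>x. k < row x) X)"
      using X lt by (auto simp: sorted_wrt_append sorted_wrt_filter)
    show "set X = set (filter (\<lambda>x. row x < k) X @ filter (\<lambda>x. row x = k) X @ filter (\<lambda>x. k < row x) X)"
      by auto
  qed
  define f g where "f = run ground (filter (\<lambda>x. row x < k) L)" and "g = run ground (filter (\<lambda>x. row x < k) M)"
  define X where "X = filter (\<lambda>x. row x = k) L"
  have "run (run f X) hi = run (run g (filter (\<lambda>x. row x = k) M)) hi"
  proof -
    have "run ground L = run (run f X) hi"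
      by (subst dec[OF sL]) (simp add: f_def X_def hi_def)
    moreover have "run ground M = run (run g (filter (\<lambda>x. row x = k) M)) hi"
      by (subst dec[OF sM]) (simp add: g_def hiM)
    ultimately show ?thesis using run unfolding M_def by simp
  qed
  moreover have "run F hi = F \<circ> run ground hi" for F
    using run_relabel[of F ground hi] by (simp add: comp_def ground_def)
  moreover have "surj (run ground hi)" using run_bij[OF bij_ground] by (rule bij_is_surj)
  ultimately have "run f X = run g (filter (\<lambda>x. row x = k) M)"
    by (metis (no_types, lifting) comp_apply ext surj_f_inv_f)
  then have eq: "run f X = run g (code_row k (e k))" using rowM by simp
  have fix1: "f k = k"
  proof -
    have "f k = ground k" unfolding f_def
      by (rule run_fixes) (use listsD(3)[OF L] in force)
    then show ?thesis by (simp add: ground_def)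
  qed
  have fix2: "g k = k"
  proof -
    have "g k = ground k" unfolding g_def
      by (rule run_fixes) (use listsD(3)[OF listsM] in force)
    then show ?thesis by (simp add: ground_def)
  qed
  have "run f X (k - int (e k)) = f k" using eq run_code_row[of g k "e k"] fix1 fix2 by simp
  moreover have "inj f" unfolding f_def using run_bij[OF bij_ground] by (rule bij_is_inj)
  ultimately have mv: "k - int (length X) \<le> k - int (e k)"
    "k - int (e k) = k - int (length X) \<Longrightarrow> (\<And>x. x \<in> set X \<Longrightarrow> \<exists>j. x = Cross k j) \<Longrightarrow> t < length X \<Longrightarrow> X ! t = Cross k (k - 1 - int t)" for t
    using run_moves[of f X "k - int (e k)" k] by blast+
  have "length X \<noteq> e k"
  proof
    assume l: "length X = e k"
    have allk: "\<exists>j. x = Cross k j" if "x \<in> set X" for x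
    proof (cases x)
      case (End m)
      then show ?thesis using that noEnd[of m] unfolding X_def by simp
    qed (use that in \<open>simp add: X_def\<close>)
    have "X = code_row k (e k)"
    proof (rule nth_equalityI)
      show "length X = length (code_row k (e k))" using l by (simp add: code_row_def)
      show "X ! t = code_row k (e k) ! t" if "t < length X" for t
        using mv(2)[OF _ allk that] l that by (simp add: code_row_def)
    qed
    then show False using kK rowM unfolding K_def X_def by simp
  qed
  then have "e k < length X" using mv(1) by simp
  moreover have "e l = length (filter (\<lambda>x. row x = l) L)" if "k < l" for l
    using above[OF that] rowM[of l] by (simp add: code_row_def)
  ultimately show ?thesis unfolding X_def by blast
qed

section \<open>Exponents, finiteness and leading monomials\<close>

definition expo :: "int list \<Rightarrow> int \<Rightarrow>\<^sub>0 nat" where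
  "expo ks = (\<Sum>k\<leftarrow>ks. Poly_Mapping.single k 1)"

lemma lookup_expo: "Poly_Mapping.lookup (expo ks) k = count_list ks k"
  unfolding expo_def by (induction ks) (auto simp: lookup_add lookup_single when_def)

lemma expo_mset: "mset ks = mset ls \<Longrightarrow> expo ks = expo ls"
  unfolding expo_def by (metis mset_map sum_mset_sum_list)

lemma prod_list_Var: "prod_list (map Var ks) = Poly_Mapping.single (expo ks) 1"
proof (induction ks)
  case Nil
  then show ?case by (simp add: expo_def)
next
  case (Cons k ks)
  then show ?case unfolding expo_def by (simp add: Var_def mult_single)
qed

lemma finite_cells: "finite (cells n L)"
proof -
  have "cells n L \<subseteq> (\<lambda>x. case x of Cross k j \<Rightarrow> (j + n + 1 - k, k) | End k \<Rightarrow> (k, k)) ` set L"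
    unfolding cells_def by force
  then show ?thesis using finite_subset by blast
qed

lemma prod_cells: "distinct L \<Longrightarrow> (\<Prod>(i, k)\<in>cells n L. Var k) = prod_list (map Var (rows L))"
proof (induction L)
  case Nil
  then show ?case by (simp add: cells_def)
next
  case (Cons x L)
  show ?case
  proof (cases x)
    case (Cross k j)
    have "cells n (x # L) = insert (j + n + 1 - k, k) (cells n L)" unfolding Cross cells_def by auto
    moreover have "(j + n + 1 - k, k) \<notin> cells n L" using Cons.prems Cross by (simp add: cells_iff)
    ultimately show ?thesis using Cons finite_cells[of n L] Cross by simp
  next
    case (End k)
    then have "cells n (x # L) = cells n L" unfolding cells_def by simp
    then show ?thesis using Cons End by simp
  qed
qed

lemma weight_lists: "lists n L R \<Longrightarrow> (\<Prod>(i, k)\<in>R. Var k) = Poly_Mapping.single (expo (rows L)) 1"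
  using prod_cells[OF sorted_before_distinct] prod_list_Var unfolding lists_def by metis

lemma count_rows: "(\<And>k. End k \<notin> set L) \<Longrightarrow> count_list (rows L) k = length (filter (\<lambda>x. row x = k) L)"
proof (induction L rule: rows.induct)
  case (2 k j xs)
  then show ?case by simp
next
  case (3 k xs)
  then have False by (metis list.set_intros(1))
  then show ?case ..
qed simp

lemma plain_word_exists:
  assumes "finite R" "R \<subseteq> {..n} \<times> {..n}"
  shows "\<exists>L. lists n L R \<and> (\<forall>k. End k \<notin> set L)"
proof -
  obtain L where L: "sorted_wrt before L" "set L = (\<lambda>(i, k). Cross k (i + k - n - 1)) ` R"
    using sorted_before_exists[of "(\<lambda>(i, k). Cross k (i + k - n - 1)) ` R"] assms(1) by blast
  have "cells n L = R" unfolding cells_def L(2) by force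
  then show ?thesis using L assms(2) unfolding lists_def by (intro exI[of _ L]) auto
qed

definition rc_graphs :: "int \<Rightarrow> (int \<Rightarrow> int) \<Rightarrow> cell set set" where
  "rc_graphs n u = {R. rc_graph n R \<and> rc_perm n R = u}"

lemma rc_graph_word:
  assumes "rc_graph n R"
  obtains L where "lists n L R" "reduced L" "\<And>k. End k \<notin> set L" "rc_perm n R = inv (run ground L)"
proof -
  obtain L where L: "lists n L R" "\<And>k. End k \<notin> set L"
    using plain_word_exists[of R n] assms unfolding rc_graph_def by blast
  then show ?thesis using that rc_graph_iff_reduced[OF L(1)] assms rc_perm_eq[OF L(1)] by blast
qed

text \<open>Only crossings at \<open>j0\<close> itself change the label at the lowest position, and
  in a reduced word each of them makes it larger. So the lowest crossing leaves a trace in the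
  permutation.\<close>

lemma reduced_lowest:
  assumes "reduced L" "\<And>k j. Cross k j \<in> set L \<Longrightarrow> j0 \<le> j"
  shows "j0 \<le> run ground L j0 \<and> (\<forall>k. Cross k j0 \<in> set L \<longrightarrow> j0 < run ground L j0)"
  using assms
proof (induction L rule: rev_induct)
  case Nil
  then show ?case by (simp add: ground_def)
next
  case (snoc x L)
  have ih: "j0 \<le> run ground L j0 \<and> (\<forall>k. Cross k j0 \<in> set L \<longrightarrow> j0 < run ground L j0)"
  proof (rule snoc.IH[OF reduced_snoc[OF snoc.prems(1)]])
    fix k j assume "Cross k j \<in> set L"
    then show "j0 \<le> j" using snoc.prems(2)[of k j] by simp
  qed
  show ?case
  proof (cases x)
    case (Cross k j)
    have lt: "run ground L j < run ground L (j + 1)" using snoc.prems(1) unfolding reduced_def Cross by blast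
    have "j0 \<le> j" using snoc.prems(2)[of k j] Cross by simp
    then show ?thesis using ih lt Cross by (cases "j = j0") (auto simp: transpose_def)
  next
    case (End k)
    then show ?thesis using ih by simp
  qed
qed

text \<open>The lowest crossed position is not fixed by \<open>u\<close>, hence lies above
  \<open>m\<close>. This bounds \<open>i + k\<close> from below on all of \<open>R\<close>, and with
  \<open>i, k \<le> n\<close> the cells stay in a finite square.\<close>

lemma finite_rc_graphs:
  assumes "u \<in> fin_perms n" shows "finite (rc_graphs n u)"
proof -
  obtain m where m: "\<And>i. i \<le> m \<Longrightarrow> u i = i" using assms unfolding fin_perms_def by auto
  have "R \<subseteq> {m..n} \<times> {m..n}" if hR: "R \<in> rc_graphs n u" for R
  proof
    fix c assume cR: "c \<in> R"
    obtain L where L: "lists n L R" "reduced L" "u = inv (run ground L)"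
      using rc_graph_word[of n R] hR unfolding rc_graphs_def by blast
    obtain i k where c: "c = (i, k)" by (cases c)
    define J where "J = {j. \<exists>k. Cross k j \<in> set L}"
    have "J \<subseteq> (\<lambda>x. case x of Cross k j \<Rightarrow> j | End k \<Rightarrow> k) ` set L" unfolding J_def by force
    then have "finite J" using finite_subset by blast
    have iJ: "i + k - n - 1 \<in> J" using listsD(2)[OF L(1)] cR unfolding J_def c by blast
    define j0 where "j0 = Min J"
    have j0: "j0 \<in> J" "j0 \<le> i + k - n - 1" "\<And>j. j \<in> J \<Longrightarrow> j0 \<le> j"
      unfolding j0_def using \<open>finite J\<close> iJ Min_in[of J] Min_le[of J] by blast+
    have "j0 < run ground L j0" using reduced_lowest[OF L(2), of j0] j0(1,3) unfolding J_def by blast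
    moreover have "u (run ground L j0) = j0" unfolding L(3) run_inv ..
    ultimately have "m < j0" using m[of j0] L(3) run_inv by (metis bij_ground bij_inv_eq_iff less_irrefl not_le run_bij)
    moreover have "i \<le> n" "k \<le> n" using L(1) cR unfolding lists_def c by auto
    ultimately show "c \<in> {m..n} \<times> {m..n}" using j0(2) unfolding c by auto
  qed
  then have "rc_graphs n u \<subseteq> Pow ({m..n} \<times> {m..n})" by blast
  then show ?thesis using finite_subset by blast
qed

lemma rc_perm_fin_perms:
  assumes "rc_graph n R" shows "rc_perm n R \<in> fin_perms n"
proof -
  obtain L where L: "lists n L R" "rc_perm n R = inv (run ground L)" using rc_graph_word[OF assms] by blast
  obtain D where D: "admissible_cut R D" using admissible_cut_exists[OF lists_finite[OF L(1)]] by blast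
  have "run ground L permutes {D - n..n}"
  proof (rule run_support)
    fix k j assume c: "Cross k j \<in> set L"
    then have "(j + n + 1 - k, k) \<in> R" using Cross_iff L(1) unfolding lists_def by auto
    then have "D < j + n + 1" using D unfolding admissible_cut_def by auto
    then show "D - n \<le> j \<and> j < n" using listsD(3)[OF L(1) c] by auto
  qed
  then have p: "rc_perm n R permutes {D - n..n}" unfolding L(2) by (rule permutes_inv)
  then have "rc_perm n R permutes {..n}" by (rule permutes_subset) auto
  moreover have "\<forall>i\<le>D - n - 1. rc_perm n R i = i" using p unfolding permutes_def by auto
  ultimately show ?thesis unfolding fin_perms_def by blast
qed

lemma schubert_monomials: "schubert n u = (\<Sum>R\<in>rc_graphs n u. \<Prod>(i, k)\<in>R. Var k)"
  unfolding schubert_def rc_graphs_def ..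

lemma lookup_of_int_mult: "Poly_Mapping.lookup (of_int c * p) m = c * Poly_Mapping.lookup (p :: zpoly) m"
proof -
  have n: "Poly_Mapping.lookup (of_nat k * p) m = int k * Poly_Mapping.lookup p m" for k
    by (induction k) (auto simp: algebra_simps lookup_add)
  show ?thesis
  proof (cases "0 \<le> c")
    case True
    then show ?thesis using n[of "nat c"] by simp
  next
    case False
    then have "c = - int (nat (- c))" by simp
    then obtain k where "c = - int k" by blast
    then show ?thesis using n[of k] by simp
  qed
qed

lemma fin_perm_code:
  assumes "u \<in> fin_perms n"
  shows "\<exists>e a. a - 1 \<le> n \<and> (\<forall>k. e k \<noteq> 0 \<longrightarrow> a \<le> k \<and> k \<le> n) \<and> cells n (code_word e a n) \<in> rc_graphs n u \<and>
    inv (run ground (code_word e a n)) = u"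
proof -
  obtain m where m: "\<And>i. i \<le> m \<Longrightarrow> u i = i" and u: "u permutes {..n}" using assms unfolding fin_perms_def by auto
  define a where "a = min m n + 1"
  have ex: "\<exists>!i. u i = y" for y using u unfolding permutes_def by blast
  have "u permutes {a..n}" unfolding permutes_def
  proof (intro conjI allI impI)
    fix x assume x: "x \<notin> {a..n}"
    show "u x = x"
    proof (cases "n < x")
      case True
      then show ?thesis using u unfolding permutes_def by auto
    next
      case False
      then have "x \<le> m" using x unfolding a_def by auto
      then show ?thesis using m by simp
    qed
  qed (rule ex)
  then have "inv u permutes {a..n}" by (rule permutes_inv)
  moreover have a: "a - 1 \<le> n" unfolding a_def by simp
  ultimately obtain e where e: "\<forall>k. e k \<noteq> 0 \<longrightarrow> a \<le> k \<and> k \<le> n" "run ground (code_word e a n) = inv u"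
    using code_word_exists by blast
  have i: "inv (run ground (code_word e a n)) = u" unfolding e(2) using u by (simp add: inv_inv_eq permutes_bij)
  have "rc_graph n (cells n (code_word e a n))"
    using rc_graph_iff_reduced[OF code_word_lists[OF a]] code_word_reduced[OF a] by simp
  moreover have "rc_perm n (cells n (code_word e a n)) = u" using rc_perm_eq[OF code_word_lists[OF a]] i by simp
  ultimately show ?thesis using a e(1) i unfolding rc_graphs_def by blast
qed

lemma single_one_eq: "Poly_Mapping.single a (1::int) = Poly_Mapping.single b 1 \<longleftrightarrow> a = b"
proof
  assume "Poly_Mapping.single a (1::int) = Poly_Mapping.single b 1"
  then have "Poly_Mapping.lookup (Poly_Mapping.single a (1::int)) b = 1" by simp
  then show "a = b" by (cases "a = b") (simp_all add: lookup_single)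
qed simp

definition exps :: "cell set \<Rightarrow> int \<Rightarrow>\<^sub>0 nat" where
  "exps R = (\<Sum>(i, k)\<in>R. Poly_Mapping.single k 1)"

lemma prod_Var: "finite R \<Longrightarrow> (\<Prod>(i, k)\<in>R. Var k) = Poly_Mapping.single (exps R) 1"
proof (induction rule: finite_induct)
  case empty
  then show ?case by (simp add: exps_def)
next
  case (insert c R)
  then show ?case unfolding exps_def by (cases c) (simp add: Var_def mult_single)
qed

lemma exps_lists: "lists n L R \<Longrightarrow> exps R = expo (rows L)"
  using weight_lists prod_Var lists_finite single_one_eq by metis

lemma schubert_exps: "schubert n u = (\<Sum>R\<in>rc_graphs n u. Poly_Mapping.single (exps R) 1)"
  unfolding schubert_monomials by (rule sum.cong) (auto simp: rc_graphs_def rc_graph_def prod_Var)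

lemma lookup_schubert:
  "Poly_Mapping.lookup (schubert n u) m = (\<Sum>R\<in>rc_graphs n u. if exps R = m then 1 else 0)"
  unfolding schubert_exps by (auto simp: lookup_sum lookup_single when_def intro!: sum.cong)

lemma code_word_set:
  "(\<And>k. e k \<noteq> 0 \<Longrightarrow> a \<le> k \<and> k \<le> N) \<Longrightarrow> set (code_word e a N) = {Cross k (k - 1 - int t) | k t. t < e k}"
  unfolding code_word_def code_row_def by force

text \<open>The highest row decides, because \<open>code_minimal\<close> compares diagrams from the
  top.\<close>

definition lex_less :: "(int \<Rightarrow> nat) \<Rightarrow> (int \<Rightarrow> nat) \<Rightarrow> bool" where
  "lex_less e d \<longleftrightarrow> (\<exists>k. e k < d k \<and> (\<forall>l>k. e l = d l))"

lemma lex_less_irrefl: "\<not> lex_less e e"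
  unfolding lex_less_def by simp

lemma lex_less_trans: "lex_less a b \<Longrightarrow> lex_less b c \<Longrightarrow> lex_less a c"
  unfolding lex_less_def
proof (elim exE conjE)
  fix k l assume h: "a k < b k" "\<forall>l>k. a l = b l" "b l < c l" "\<forall>j>l. b j = c j"
  show "\<exists>k. a k < c k \<and> (\<forall>l>k. a l = c l)"
    using h by (intro exI[of _ "max k l"]) (cases k l rule: linorder_cases; force simp: max_def)
qed

text \<open>The last clause reconstructs the diagram from its exponents; through it different
  permutations have different leading monomials.\<close>

definition leading :: "int \<Rightarrow> (int \<Rightarrow> int) \<Rightarrow> cell set \<Rightarrow> bool" where
  "leading n u R \<longleftrightarrow> R \<in> rc_graphs n u \<and>
    (\<forall>S\<in>rc_graphs n u. S \<noteq> R \<longrightarrow> lex_less (Poly_Mapping.lookup (exps R)) (Poly_Mapping.lookup (exps S))) \<and>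
    R = {(n - int t, k) | k t. t < Poly_Mapping.lookup (exps R) k}"

lemma leading_exists:
  assumes "u \<in> fin_perms n" shows "\<exists>R. leading n u R"
proof -
  obtain e a where a: "a - 1 \<le> n" and e: "\<And>k. e k \<noteq> 0 \<Longrightarrow> a \<le> k \<and> k \<le> n"
    and R: "cells n (code_word e a n) \<in> rc_graphs n u" and u: "inv (run ground (code_word e a n)) = u"
    using fin_perm_code[OF assms] by blast
  define L where "L = code_word e a n"
  have setL: "set L = {Cross k (k - 1 - int t) | k t. t < e k}" unfolding L_def by (rule code_word_set[OF e])
  then have noEnd: "End k \<notin> set L" for k by auto
  have counts: "Poly_Mapping.lookup (exps (cells n L)) k = e k" for k
  proof -
    have "Poly_Mapping.lookup (exps (cells n L)) k = count_list (rows L) k"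
      using exps_lists[OF code_word_lists[OF a]] lookup_expo unfolding L_def by simp
    also have "\<dots> = length (filter (\<lambda>x. row x = k) L)" by (rule count_rows) (rule noEnd)
    also have "filter (\<lambda>x. row x = k) L = code_row k (e k)"
      unfolding L_def by (rule code_word_row) (use e a in auto)
    finally show ?thesis by (simp add: code_row_def)
  qed
  have "leading n u (cells n L)" unfolding leading_def
  proof (intro conjI ballI impI)
    show "cells n L \<in> rc_graphs n u" using R unfolding L_def .
    show "lex_less (Poly_Mapping.lookup (exps (cells n L))) (Poly_Mapping.lookup (exps S))"
      if S: "S \<in> rc_graphs n u" "S \<noteq> cells n L" for S
    proof -
      have "rc_graph n S" using S(1) unfolding rc_graphs_def by simp
      then obtain K where K: "lists n K S" "reduced K" "\<And>k. End k \<notin> set K" "rc_perm n S = inv (run ground K)"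
        by (rule rc_graph_word) blast
      have "inv (run ground K) = inv (run ground L)" using K(4) S(1) u unfolding rc_graphs_def L_def by simp
      then have "run ground K = run ground L" using run_bij[OF bij_ground] by (metis inv_inv_eq)
      then have "\<exists>k. e k < length (filter (\<lambda>x. row x = k) K) \<and> (\<forall>l>k. e l = length (filter (\<lambda>x. row x = l) K))"
        using S(2) e a K(3) unfolding L_def by (intro code_minimal[OF K(1)]) auto
      moreover have "length (filter (\<lambda>x. row x = k) K) = Poly_Mapping.lookup (exps S) k" for k
        using exps_lists[OF K(1)] lookup_expo count_rows[OF K(3)] by simp
      ultimately show ?thesis unfolding lex_less_def counts by simp
    qed
    show "cells n L = {(n - int t, k) | k t. t < Poly_Mapping.lookup (exps (cells n L)) k}"
      unfolding counts unfolding cells_def setL by (auto simp: algebra_simps)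
  qed
  then show ?thesis by blast
qed

text \<open>Leading means smallest here. The least of all leading monomials occurs in no other
  polynomial of the sum, whose monomials are at least its own, different leading one. In its own
  polynomial it has a positive coefficient.\<close>

lemma schubert_independent:
  assumes V: "finite V" "V \<subseteq> fin_perms n" and z: "(\<Sum>u\<in>V. of_int (a u) * schubert n u) = 0" and "u \<in> V"
  shows "a u = 0"
proof (rule ccontr)
  assume "a u \<noteq> 0"
  define W where "W = {u \<in> V. a u \<noteq> 0}"
  have W: "finite W" "W \<noteq> {}" "W \<subseteq> fin_perms n" using V \<open>u \<in> V\<close> \<open>a u \<noteq> 0\<close> unfolding W_def by auto
  have "\<forall>u\<in>W. \<exists>R. leading n u R" using leading_exists W(3) by blast
  then obtain T where T: "\<forall>u\<in>W. leading n u (T u)" using bchoice by blast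
  define less where "less u v = lex_less (Poly_Mapping.lookup (exps (T u))) (Poly_Mapping.lookup (exps (T v)))" for u v
  have "asymp_on W less" "transp_on W less"
    unfolding less_def asymp_on_def transp_on_def using lex_less_trans lex_less_irrefl by blast+
  then obtain u0 where u0: "u0 \<in> W" "\<And>x. x \<in> W \<Longrightarrow> \<not> less x u0"
    using Finite_Set.bex_min_element[OF W(1) _ _ W(2), of less] lex_less_irrefl unfolding less_def by metis
  define m where "m = exps (T u0)"
  have off: "Poly_Mapping.lookup (schubert n v) m = 0" if v: "v \<in> W" "v \<noteq> u0" for v
  proof -
    have "exps S \<noteq> m" if S: "S \<in> rc_graphs n v" for S
    proof
      assume m: "exps S = m"
      note Tv = T[rule_format, OF v(1), unfolded leading_def] and T0 = T[rule_format, OF u0(1), unfolded leading_def]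
      have "S = T v" using Tv S u0(2)[OF v(1)] m unfolding less_def m_def by metis
      then have "exps (T v) = exps (T u0)" using m unfolding m_def by simp
      then have "T v = T u0" using Tv T0 by metis
      then show False using Tv T0 v(2) unfolding rc_graphs_def by auto
    qed
    then show ?thesis unfolding lookup_schubert by simp
  qed
  have on: "0 < Poly_Mapping.lookup (schubert n u0) m"
  proof -
    have "finite (rc_graphs n u0)" using finite_rc_graphs u0(1) W(3) by blast
    then have "(\<Sum>R\<in>{T u0}. if exps R = m then 1 else 0) \<le> (\<Sum>R\<in>rc_graphs n u0. if exps R = m then (1::int) else 0)"
      using T u0(1) unfolding leading_def by (intro sum_mono2) auto
    then show ?thesis unfolding lookup_schubert m_def by simp
  qed
  have "0 = Poly_Mapping.lookup (\<Sum>u\<in>V. of_int (a u) * schubert n u) m" using z by simp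
  also have "\<dots> = (\<Sum>u\<in>V. a u * Poly_Mapping.lookup (schubert n u) m)"
    by (simp add: lookup_sum lookup_of_int_mult)
  also have "\<dots> = (\<Sum>u\<in>{u0}. a u * Poly_Mapping.lookup (schubert n u) m)"
    using V(1) u0(1) off by (intro sum.mono_neutral_right) (auto simp: W_def)
  finally show False using on u0(1) unfolding W_def by simp
qed

lemma expansion_unique:
  assumes "schubert_schur_expansion n w \<mu> c" "schubert_schur_expansion n w \<mu> d"
  shows "c = d"
proof
  fix u
  define V where "V = {u. c u \<noteq> 0} \<union> {u. d u \<noteq> 0}"
  have V: "finite V" "V \<subseteq> fin_perms n" using assms unfolding schubert_schur_expansion_def V_def by auto
  have s: "schubert n w * schur n \<mu> = (\<Sum>u\<in>V. of_int (x u) * schubert n u)"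
    if "schubert_schur_expansion n w \<mu> x" "{u. x u \<noteq> 0} \<subseteq> V" for x
  proof -
    have "schubert n w * schur n \<mu> = (\<Sum>u | x u \<noteq> 0. of_int (x u) * schubert n u)"
      using that(1) unfolding schubert_schur_expansion_def by blast
    also have "\<dots> = (\<Sum>u\<in>V. of_int (x u) * schubert n u)"
      by (rule sum.mono_neutral_left) (use V(1) that(2) in auto)
    finally show ?thesis .
  qed
  have "(\<Sum>u\<in>V. of_int (c u - d u) * schubert n u) = 0"
    using s[OF assms(1)] s[OF assms(2)] unfolding V_def by (simp add: left_diff_distrib sum_subtractf)
  then have "c u - d u = 0" if "u \<in> V" using schubert_independent[OF V, of "\<lambda>u. c u - d u"] that by blast
  then show "c u = d u" unfolding V_def by fastforce
qed

section \<open>The product and its expansion\<close>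

lemma finite_ssyt: "finite (ssyt n \<mu>)"
proof -
  define A where "A = {r::int list. set r \<subseteq> {1..n} \<and> length r \<le> sum_list \<mu>}"
  have "finite A" unfolding A_def by (rule finite_lists_length_le) simp
  then have "finite {Y. set Y \<subseteq> A \<and> length Y = length \<mu>}" by (rule finite_lists_length_eq)
  moreover have "Y \<in> {Y. set Y \<subseteq> A \<and> length Y = length \<mu>}" if Y: "Y \<in> ssyt n \<mu>" for Y
  proof -
    have l: "map length Y = \<mu>" and s: "\<forall>r\<in>set Y. set r \<subseteq> {1..n}" using Y unfolding ssyt_def by auto
    have "length r \<le> sum_list \<mu>" if "r \<in> set Y" for r
      using member_le_sum_list[of "length r" \<mu>] that unfolding l[symmetric] by simp
    moreover have "length Y = length \<mu>" unfolding l[symmetric] by simp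
    ultimately show ?thesis using s unfolding A_def by auto
  qed
  ultimately show ?thesis by (meson finite_subset subsetI)
qed

lemma expo_append: "expo (ks @ ls) = expo ks + expo ls"
  unfolding expo_def by simp

lemma schur_exps: "schur n \<mu> = (\<Sum>Y\<in>ssyt n \<mu>. Poly_Mapping.single (expo (reading_word Y)) 1)"
proof -
  have "mset (concat Y) = mset (reading_word Y)" for Y :: "int list list"
    unfolding reading_word_def by (induction Y) auto
  then have "expo (concat Y) = expo (reading_word Y)" for Y by (rule expo_mset)
  then show ?thesis unfolding schur_def prod_list_Var by simp
qed

text \<open>For \<open>n \<ge> 1\<close> these are, by \<open>rc_word_exists\<close> and
  \<open>rc_word_nonpos\<close>, the rc-graphs in which no two nonpositive labels cross: the
  possible results \<open>U\<close>.\<close>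

definition rc_word_graphs :: "int \<Rightarrow> cell set set" where
  "rc_word_graphs n = cells n ` Collect (rc_word n)"

lemma rc_word_ascends:
  assumes "rc_word n ys" "i \<le> 0"
  shows "rc_perm n (cells n ys) (i - 1) < rc_perm n (cells n ys) i"
proof -
  have "crossings ground ys (i - 1) i = 0"
  proof (rule ccontr)
    assume "crossings ground ys (i - 1) i \<noteq> 0"
    then obtain A k j B where h: "ys = A @ Cross k j # B" "{run ground A j, run ground A (j + 1)} = {i - 1, i}"
      using crossings_pos by blast
    then have "cross_at n (cells n ys) (i - 1) i (j + n + 1 - k, k)"
      using cross_at_split(2)[OF rc_word_lists[OF assms(1)] h(1)] by auto
    then show False using rc_word_nonpos[OF assms(1)] assms(2) by auto
  qed
  then have "\<not> inv (run ground ys) i < inv (run ground ys) (i - 1)" using inverted_iff[of "i - 1" i ys] by simp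
  moreover have "inv (run ground ys) i \<noteq> inv (run ground ys) (i - 1)"
    using run_bij[OF bij_ground, of ys] by (metis bij_inv_eq_iff less_irrefl diff_less_eq less_add_one)
  ultimately show ?thesis unfolding rc_word_perm[OF assms(1)] by simp
qed

text \<open>Whether nonpositive labels cross is visible in the permutation. So together with one
  diagram all diagrams of its permutation are possible results, and complete Schubert polynomials
  can arise.\<close>

lemma rc_word_graphs_perm:
  assumes n: "1 \<le> n" and "U \<in> rc_word_graphs n" "S \<in> rc_graphs n (rc_perm n U)"
  shows "S \<in> rc_word_graphs n"
  using assms dominant_rc_word[OF n, of "rc_perm n U" S] rc_word_ascends
  unfolding rc_word_graphs_def rc_graphs_def by auto

lemma insertion_total:
  assumes n: "1 \<le> n" and w: "\<forall>i\<le>0. w (i - 1) < w i" and R: "R \<in> rc_graphs n w" and Y: "Y \<in> ssyt n \<mu>"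
  shows "\<exists>U. U \<in> rc_word_graphs n \<and> exps U = exps R + expo (reading_word Y) \<and>
    (\<forall>S\<in>rc_word_graphs n. (R, Y) \<in> insertion_pairs n w \<mu> S \<longleftrightarrow> S = U)"
proof -
  have R': "rc_graph n R" "rc_perm n R = w" using R unfolding rc_graphs_def by auto
  obtain xs where xs: "rc_word n xs" "cells n xs = R" using dominant_rc_word[OF n w R'] by blast
  have b: "base ground xs (reading_word Y)" by (rule rc_word_base[OF xs(1) ssyt_letters[OF Y]])
  obtain ys C where m: "mthru ground xs (map Wait (reading_word Y)) ys C" using base_total[OF b] by blast
  have ys: "rc_word n ys" by (rule rc_word_mthru[OF xs(1) m])
  have "exps (cells n ys) = expo (rows ys)" by (rule exps_lists[OF rc_word_lists[OF ys]])
  also have "\<dots> = expo (rows xs @ reading_word Y)" by (rule expo_mset) (simp add: mthru_rows[OF b m])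
  also have "\<dots> = exps R + expo (reading_word Y)"
    using exps_lists[OF rc_word_lists[OF xs(1)]] xs(2) by (simp add: expo_append)
  finally have e: "exps (cells n ys) = exps R + expo (reading_word Y)" .
  have "(R, Y) \<in> insertion_pairs n w \<mu> S \<longleftrightarrow> S = cells n ys" if S: "S \<in> rc_word_graphs n" for S
  proof -
    obtain zs where zs: "rc_word n zs" "S = cells n zs" using S unfolding rc_word_graphs_def by blast
    show ?thesis
    proof
      assume "(R, Y) \<in> insertion_pairs n w \<mu> S"
      then obtain xs' C' where h: "rc_word n xs'" "cells n xs' = R" "mthru ground xs' (map Wait (reading_word Y)) zs C'"
        unfolding zs(2) insertion_pairs_iff[OF n w zs(1)] by blast
      have "xs' = xs" using rc_word_unique[OF h(1) xs(1)] h(2) xs(2) by simp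
      then have "zs = ys" using mthru_unique h(3) m by blast
      then show "S = cells n ys" using zs(2) by simp
    next
      assume "S = cells n ys"
      then show "(R, Y) \<in> insertion_pairs n w \<mu> S" using insertion_pairs_iff[OF n w ys] xs R' Y m by blast
    qed
  qed
  then show ?thesis using e ys unfolding rc_word_graphs_def by blast
qed

text \<open>The terms of the product are grouped by the result \<open>U\<close> and then by its
  permutation. By \<open>insertion_pairs_perm\<close> all results with the same permutation occur
  equally often, so each group is a multiple of a Schubert polynomial.\<close>

lemma schubert_schur_insertion:
  assumes n: "1 \<le> n" and w: "w \<in> fin_perms n" "\<forall>i\<le>0. w (i - 1) < w i" and mu: "\<mu> \<in> partitions_n n"
  shows "\<exists>c. schubert_schur_expansion n w \<mu> c \<and>
    (\<forall>U\<in>rc_word_graphs n. c (rc_perm n U) = int (card (insertion_pairs n w \<mu> U)))"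
proof -
  define Z where "Z = rc_graphs n w \<times> ssyt n \<mu>"
  have finZ: "finite Z" unfolding Z_def using finite_rc_graphs[OF w(1)] finite_ssyt by blast
  define P where "P z U \<longleftrightarrow> U \<in> rc_word_graphs n \<and> exps U = exps (fst z) + expo (reading_word (snd z)) \<and>
    (\<forall>S\<in>rc_word_graphs n. z \<in> insertion_pairs n w \<mu> S \<longleftrightarrow> S = U)" for z U
  have "\<forall>z\<in>Z. \<exists>U. P z U"
    unfolding P_def Z_def using insertion_total[OF n w(2)] by auto
  then obtain T where "\<forall>z\<in>Z. P z (T z)" using bchoice[of Z P] by blast
  then have T: "\<forall>z\<in>Z. T z \<in> rc_word_graphs n \<and> exps (T z) = exps (fst z) + expo (reading_word (snd z)) \<and>
    (\<forall>S\<in>rc_word_graphs n. z \<in> insertion_pairs n w \<mu> S \<longleftrightarrow> S = T z)"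
    unfolding P_def .
  have sub: "insertion_pairs n w \<mu> U \<subseteq> Z" for U unfolding insertion_pairs_def Z_def rc_graphs_def by auto
  have fibre: "insertion_pairs n w \<mu> U = {z \<in> Z. T z = U}" if U: "U \<in> rc_word_graphs n" for U
  proof -
    have "z \<in> insertion_pairs n w \<mu> U \<longleftrightarrow> U = T z" if "z \<in> Z" for z using T that U by simp
    then show ?thesis using sub[of U] by auto
  qed
  \<comment> \<open>The chosen diagram does not matter, by \<open>insertion_pairs_perm\<close>;
    permutations that no possible result has get 0.\<close>
  define c where "c u = (if \<exists>U\<in>rc_word_graphs n. rc_perm n U = u
    then int (card (insertion_pairs n w \<mu> (SOME U. U \<in> rc_word_graphs n \<and> rc_perm n U = u))) else 0)" for u
  have c: "c (rc_perm n U) = int (card (insertion_pairs n w \<mu> U))" if U: "U \<in> rc_word_graphs n" for U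
  proof -
    define U' where "U' = (SOME U'. U' \<in> rc_word_graphs n \<and> rc_perm n U' = rc_perm n U)"
    have U': "U' \<in> rc_word_graphs n \<and> rc_perm n U' = rc_perm n U"
      unfolding U'_def by (rule someI[of _ U]) (use U in simp)
    obtain ys where ys: "rc_word n ys" "U = cells n ys" using U unfolding rc_word_graphs_def by blast
    obtain ys' where ys': "rc_word n ys'" "U' = cells n ys'" using U' unfolding rc_word_graphs_def by blast
    have "card (insertion_pairs n w \<mu> U') = card (insertion_pairs n w \<mu> U)"
      unfolding ys(2) ys'(2) by (rule insertion_pairs_perm[OF n w(2) mu ys'(1) ys(1)]) (use U' ys(2) ys'(2) in simp)
    moreover have "c (rc_perm n U) = int (card (insertion_pairs n w \<mu> U'))" unfolding c_def U'_def using U by auto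
    ultimately show ?thesis by simp
  qed
  have c_T: "c (rc_perm n U) \<noteq> 0 \<longleftrightarrow> U \<in> T ` Z" if U: "U \<in> rc_word_graphs n" for U
    unfolding c[OF U] fibre[OF U] using finZ by auto
  have supp: "{u. c u \<noteq> 0} = rc_perm n ` T ` Z"
  proof (intro set_eqI iffI)
    fix u assume "u \<in> {u. c u \<noteq> 0}"
    then have "c u \<noteq> 0" by simp
    then obtain U where U: "U \<in> rc_word_graphs n" "rc_perm n U = u" unfolding c_def by (auto split: if_splits)
    then show "u \<in> rc_perm n ` T ` Z" using c_T[OF U(1)] \<open>c u \<noteq> 0\<close> by blast
  next
    fix u assume "u \<in> rc_perm n ` T ` Z"
    then obtain U where U: "U \<in> T ` Z" "u = rc_perm n U" by blast
    moreover have "U \<in> rc_word_graphs n" using U(1) T by auto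
    ultimately show "u \<in> {u. c u \<noteq> 0}" using c_T by blast
  qed
  \<comment> \<open>A nonzero count is shared by all diagrams of \<open>u\<close>, so if one of them
    is reached, all are.\<close>
  have orbit: "{U \<in> T ` Z. rc_perm n U = u} = rc_graphs n u" if u: "c u \<noteq> 0" for u
  proof (intro set_eqI iffI)
    fix S assume S: "S \<in> {U \<in> T ` Z. rc_perm n U = u}"
    then have "S \<in> rc_word_graphs n" using T by auto
    then show "S \<in> rc_graphs n u" using S rc_word_rc_graph unfolding rc_word_graphs_def rc_graphs_def by auto
  next
    fix S assume S: "S \<in> rc_graphs n u"
    have "u \<in> rc_perm n ` T ` Z" using u supp by blast
    then obtain z where z: "z \<in> Z" "u = rc_perm n (T z)" by blast
    have "T z \<in> rc_word_graphs n" using T z(1) by blast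
    then have "S \<in> rc_word_graphs n" using rc_word_graphs_perm[OF n] S unfolding z(2) by blast
    moreover have "rc_perm n S = u" using S unfolding rc_graphs_def by simp
    ultimately show "S \<in> {U \<in> T ` Z. rc_perm n U = u}" using c_T u by auto
  qed
  have "schubert n w * schur n \<mu> = (\<Sum>z\<in>Z. Poly_Mapping.single (exps (T z)) 1)"
  proof -
    have "schubert n w * schur n \<mu> =
      (\<Sum>(R, Y)\<in>Z. Poly_Mapping.single (exps R) 1 * Poly_Mapping.single (expo (reading_word Y)) 1)"
      unfolding schubert_exps schur_exps Z_def sum_product sum.cartesian_product ..
    also have "\<dots> = (\<Sum>z\<in>Z. Poly_Mapping.single (exps (T z)) 1)"
      by (rule sum.cong) (use T in \<open>auto simp: mult_single\<close>)
    finally show ?thesis .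
  qed
  also have "\<dots> = (\<Sum>U\<in>T ` Z. \<Sum>z\<in>{z \<in> Z. T z = U}. Poly_Mapping.single (exps (T z)) 1)"
    by (rule sum.image_gen[OF finZ])
  also have "\<dots> = (\<Sum>U\<in>T ` Z. of_int (c (rc_perm n U)) * Poly_Mapping.single (exps U) 1)"
  proof (rule sum.cong[OF refl])
    fix U assume "U \<in> T ` Z"
    then have U: "U \<in> rc_word_graphs n" using T by auto
    have "(\<Sum>z\<in>{z \<in> Z. T z = U}. Poly_Mapping.single (exps (T z)) (1::int)) =
      (\<Sum>z\<in>{z \<in> Z. T z = U}. Poly_Mapping.single (exps U) 1)" by (rule sum.cong) auto
    also have "\<dots> = of_nat (card {z \<in> Z. T z = U}) * Poly_Mapping.single (exps U) 1" by simp
    also have "\<dots> = of_int (c (rc_perm n U)) * Poly_Mapping.single (exps U) 1"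
      unfolding c[OF U] fibre[OF U] by simp
    finally show "(\<Sum>z\<in>{z \<in> Z. T z = U}. Poly_Mapping.single (exps (T z)) (1::int)) =
      of_int (c (rc_perm n U)) * Poly_Mapping.single (exps U) 1" .
  qed
  also have "\<dots> = (\<Sum>u\<in>rc_perm n ` T ` Z. \<Sum>U\<in>{U \<in> T ` Z. rc_perm n U = u}.
      of_int (c (rc_perm n U)) * Poly_Mapping.single (exps U) 1)"
    by (rule sum.image_gen) (use finZ in blast)
  also have "\<dots> = (\<Sum>u | c u \<noteq> 0. of_int (c u) * schubert n u)"
    unfolding supp[symmetric]
  proof (rule sum.cong[OF refl])
    fix u assume "u \<in> {u. c u \<noteq> 0}"
    then have o: "{U \<in> T ` Z. rc_perm n U = u} = rc_graphs n u" using orbit by simp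
    show "(\<Sum>U\<in>{U \<in> T ` Z. rc_perm n U = u}. of_int (c (rc_perm n U)) * Poly_Mapping.single (exps U) 1)
      = of_int (c u) * schubert n u"
      unfolding o schubert_exps sum_distrib_left by (rule sum.cong) (auto simp: rc_graphs_def)
  qed
  finally have "schubert n w * schur n \<mu> = (\<Sum>u | c u \<noteq> 0. of_int (c u) * schubert n u)" .
  moreover have "finite {u. c u \<noteq> 0}" unfolding supp using finZ by blast
  moreover have "{u. c u \<noteq> 0} \<subseteq> fin_perms n"
  proof -
    have "rc_perm n (T z) \<in> fin_perms n" if "z \<in> Z" for z
    proof -
      have "T z \<in> rc_word_graphs n" using T that by simp
      then obtain ys where "rc_word n ys" "T z = cells n ys" unfolding rc_word_graphs_def by blast
      then show ?thesis using rc_perm_fin_perms[OF rc_word_rc_graph] by simp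
    qed
    then show ?thesis unfolding supp by blast
  qed
  ultimately show ?thesis using c unfolding schubert_schur_expansion_def by blast
qed

theorem theorem4p1:
  fixes n :: int and w :: "int \<Rightarrow> int" and \<mu> :: "nat list" and U :: "cell set"
  assumes "n \<ge> 1"
    and "w \<in> fin_perms n"
    and "\<forall>i\<le>0. w (i - 1) < w i"
    and "\<mu> \<in> partitions_n n"
    and "rc_graph n U"
    and "\<forall>p q c. p \<le> 0 \<longrightarrow> q \<le> 0 \<longrightarrow> \<not> cross_at n U p q c"
  shows "lr_coeff n w \<mu> (rc_perm n U) =
    int (card {(R, Y). rc_graph n R \<and> rc_perm n R = w \<and> Y \<in> ssyt n \<mu> \<and> insert_tableau n R Y U})"
proof -
  obtain c where c: "schubert_schur_expansion n w \<mu> c"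
    "\<forall>U\<in>rc_word_graphs n. c (rc_perm n U) = int (card (insertion_pairs n w \<mu> U))"
    using schubert_schur_insertion assms(1-4) by blast
  have "lr_coeff n w \<mu> = c" unfolding lr_coeff_def
    by (rule the_equality) (use c(1) expansion_unique in blast)+
  moreover obtain xs where "rc_word n xs" "cells n xs = U"
    using rc_word_exists[OF assms(1,5)] assms(6) by blast
  then have "U \<in> rc_word_graphs n" unfolding rc_word_graphs_def by blast
  ultimately show ?thesis using c(2) unfolding insertion_pairs_def by simp
qed

end
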